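(* Let $G$ be a finitely generated group with the $b_2-b_1$ property with respect to the prime $2$. Then for any real number $\lambda<\sqrt{2/\pi}$ there is a constant $N$ with the following property. If $G_1$ is any finite index subgroup of $G$ with $b_1(G_1;\mathbb{F}_2)\geq N$, and $\{G_i\}_{i\ge 1}$ is the derived $2$-series of $G_1$, then $$b_1(G_{i+1};\mathbb{F}_2)\geq \lambda\, 2^{b_1(G_i;\mathbb{F}_2)}\sqrt{b_1(G_i;\mathbb{F}_2)}$$ for all $i\geq 1$.
   Context: For a prime $p$, $\mathbb{F}_p$ is the field of order $p$, and for $r=1,2$, $b_r(G;\mathbb{F}_p)$ denotes the dimension over $\mathbb{F}_p$ of the group homology $H_r(G;\mathbb{F}_p)$. A group $G$ has the $b_2-b_1$ property with respect to the prime $p$ if there is a uniform upper bound on $b_2(G_i;\mathbb{F}_p)-b_1(G_i;\mathbb{F}_p)$ as $G_i$ ranges over all finite index subgroups of $G$. The derived $2$-series of $G_1$ is defined recursively by $G_{i+1}=[G_i,G_i](G_i)^2$, where $(G_i)^2$ is the subgroup generated by squares of elements of $G_i$. *)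

theory Defs
  imports
    Complex_Main
    "HOL-Algebra.Generated_Groups"
    "HOL-Number_Theory.Residues"
    "Jordan_Normal_Form.Missing_VectorSpace"
begin

text \<open>
  Group homology \<open>H\<^sub>n(G; R)\<close> with trivial coefficients in a commutative ring \<open>R\<close> is the homology of
  the (unnormalised, inhomogeneous) bar complex: \<open>C\<^sub>n(G; R)\<close> is the free \<open>R\<close>-module on \<open>G\<^sup>n\<close>, and
  \<open>\<partial>[g\<^sub>1|...|g\<^sub>n] = [g\<^sub>2|...|g\<^sub>n] + (\<Sum>0<i<n. (-1)^i [g\<^sub>1|...|g\<^sub>i g\<^sub>i\<^sub>+\<^sub>1|...|g\<^sub>n]) + (-1)^n [g\<^sub>1|...|g\<^sub>n\<^sub>-\<^sub>1]\<close>.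
\<close>

definition bar_chains ::
  "('r, 's) ring_scheme \<Rightarrow> ('a, 'b) monoid_scheme \<Rightarrow> nat \<Rightarrow> ('r, 'a list \<Rightarrow> 'r) module"
  where
  "bar_chains R G n =
    \<lparr>carrier = {c. range c \<subseteq> carrier R \<and> finite {x. c x \<noteq> \<zero>\<^bsub>R\<^esub>} \<and>
                  {x. c x \<noteq> \<zero>\<^bsub>R\<^esub>} \<subseteq> {x. length x = n \<and> set x \<subseteq> carrier G}},
     monoid.mult = undefined,
     one = undefined,
     zero = (\<lambda>x. \<zero>\<^bsub>R\<^esub>),
     add = (\<lambda>c d x. c x \<oplus>\<^bsub>R\<^esub> d x),
     module.smult = (\<lambda>r c x. r \<otimes>\<^bsub>R\<^esub> c x)\<rparr>"

text \<open>The faces of a nonempty list \<open>x\<close> are indexed by \<open>0, \<dots>, length x\<close>; lists are indexed from \<open>0\<close>.\<close>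

definition bar_face :: "('a, 'b) monoid_scheme \<Rightarrow> nat \<Rightarrow> 'a list \<Rightarrow> 'a list"
  where
  "bar_face G i x =
    (if i = 0 then tl x
     else if i = length x then butlast x
     else take (i - 1) x @ [x ! (i - 1) \<otimes>\<^bsub>G\<^esub> x ! i] @ drop (i + 1) x)"

text \<open>
  One function serves as the boundary \<open>C\<^sub>n\<^sub>+\<^sub>1 \<rightarrow> C\<^sub>n\<close> for every \<open>n \<ge> 0\<close>. It must not be applied to
  \<open>C\<^sub>0\<close>, where the boundary is zero: hence the separate case in \<open>bar_cycles\<close>.
\<close>

definition bar_boundary ::
  "('r, 's) ring_scheme \<Rightarrow> ('a, 'b) monoid_scheme \<Rightarrow> ('a list \<Rightarrow> 'r) \<Rightarrow> 'a list \<Rightarrow> 'r"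
  where
  "bar_boundary R G c y =
    (\<Oplus>\<^bsub>R\<^esub>x\<in>{x. c x \<noteq> \<zero>\<^bsub>R\<^esub>}. \<Oplus>\<^bsub>R\<^esub>i\<in>{..length x}.
       if bar_face G i x = y then (if even i then c x else \<ominus>\<^bsub>R\<^esub> c x) else \<zero>\<^bsub>R\<^esub>)"

fun bar_cycles ::
  "('r, 's) ring_scheme \<Rightarrow> ('a, 'b) monoid_scheme \<Rightarrow> nat \<Rightarrow> ('a list \<Rightarrow> 'r) set"
  where
  "bar_cycles R G 0 = carrier (bar_chains R G 0)"
| "bar_cycles R G (Suc n) = a_kernel (bar_chains R G (Suc n)) (bar_chains R G n) (bar_boundary R G)"

definition bar_boundaries ::
  "('r, 's) ring_scheme \<Rightarrow> ('a, 'b) monoid_scheme \<Rightarrow> nat \<Rightarrow> ('a list \<Rightarrow> 'r) set"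
  where "bar_boundaries R G n = bar_boundary R G ` carrier (bar_chains R G (Suc n))"

definition quotient_module ::
  "('r, 'm, 'x) module_scheme \<Rightarrow> 'm set \<Rightarrow> ('r, 'm set) module"
  where
  "quotient_module M N =
    \<lparr>carrier = a_rcosets\<^bsub>M\<^esub> N,
     monoid.mult = undefined,
     one = undefined,
     zero = N,
     add = (\<lambda>X Y. X <+>\<^bsub>M\<^esub> Y),
     module.smult = (\<lambda>r X. \<Union>x\<in>X. N +>\<^bsub>M\<^esub> (r \<odot>\<^bsub>M\<^esub> x))\<rparr>"

definition group_homology ::
  "('r, 's) ring_scheme \<Rightarrow> ('a, 'b) monoid_scheme \<Rightarrow> nat \<Rightarrow> ('r, ('a list \<Rightarrow> 'r) set) module"
  where
  "group_homology R G n =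
    quotient_module (bar_chains R G n\<lparr>carrier := bar_cycles R G n\<rparr>) (bar_boundaries R G n)"

text \<open>
  \<open>betti r G p\<close> is \<open>b\<^sub>r(G; \<bbbF>\<^sub>p)\<close>. It is meaningful only if \<open>H\<^sub>r(G; \<bbbF>\<^sub>p)\<close> is finite-dimensional, as the
  dimension of an infinite-dimensional space is an unspecified natural number.
\<close>

definition finite_betti :: "nat \<Rightarrow> ('a, 'b) monoid_scheme \<Rightarrow> nat \<Rightarrow> bool"
  where
  "finite_betti r G p \<longleftrightarrow>
    vectorspace.fin_dim (residue_ring (int p)) (group_homology (residue_ring (int p)) G r)"

definition betti :: "nat \<Rightarrow> ('a, 'b) monoid_scheme \<Rightarrow> nat \<Rightarrow> nat"
  where
  "betti r G p =
    vectorspace.dim (residue_ring (int p)) (group_homology (residue_ring (int p)) G r)"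

definition finite_index_subgroup :: "'a set \<Rightarrow> ('a, 'b) monoid_scheme \<Rightarrow> bool"
  where "finite_index_subgroup H G \<longleftrightarrow> subgroup H G \<and> finite (rcosets\<^bsub>G\<^esub> H)"

definition finitely_generated_group :: "('a, 'b) monoid_scheme \<Rightarrow> bool"
  where
  "finitely_generated_group G \<longleftrightarrow>
    group G \<and> (\<exists>S. finite S \<and> S \<subseteq> carrier G \<and> generate G S = carrier G)"

text \<open>
  For finitely generated \<open>G\<close> the first homology of a finite index subgroup is always
  finite-dimensional, but the second need not be; a bound on \<open>b\<^sub>2 - b\<^sub>1\<close> includes that it is.
\<close>

definition b2_b1_property :: "('a, 'b) monoid_scheme \<Rightarrow> nat \<Rightarrow> bool"
  where
  "b2_b1_property G p \<longleftrightarrow>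
    (\<exists>C::int. \<forall>H. finite_index_subgroup H G \<longrightarrow>
       finite_betti 1 (G\<lparr>carrier := H\<rparr>) p \<and> finite_betti 2 (G\<lparr>carrier := H\<rparr>) p \<and>
       int (betti 2 (G\<lparr>carrier := H\<rparr>) p) - int (betti 1 (G\<lparr>carrier := H\<rparr>) p) \<le> C)"

text \<open>The series is indexed from \<open>0\<close>: \<open>derived_2_series G H i\<close> is \<open>G\<^sub>i\<^sub>+\<^sub>1\<close>, where \<open>G\<^sub>1 = H\<close>.\<close>

primrec derived_2_series :: "('a, 'b) monoid_scheme \<Rightarrow> 'a set \<Rightarrow> nat \<Rightarrow> 'a set"
  where
  "derived_2_series G H 0 = H"
| "derived_2_series G H (Suc i) =
    derived G (derived_2_series G H i) <#>\<^bsub>G\<^esub>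
    generate G {h \<otimes>\<^bsub>G\<^esub> h | h. h \<in> derived_2_series G H i}"

end

theory Submission
  imports
    Defs
    "HOL-Library.Z2"
    "HOL-Library.Function_Algebras"
    "HOL-Analysis.Gamma_Function"
    "HOL-Real_Asymp.Real_Asymp"
begin

text \<open>
Let \<open>H\<close> be a group with finite \<open>n = b\<^sub>1(H; \<bbbF>\<^sub>2)\<close> and \<open>r = b\<^sub>2(H; \<bbbF>\<^sub>2)\<close>, and let \<open>K\<close> be the next term
\<open>[H,H]H\<^sup>2\<close> of the derived 2-series. The quotient \<open>H/K\<close> is \<open>\<bbbF>\<^sub>2\<^sup>n\<close>. By Shapiro's lemma
\<open>Hom(K, \<bbbF>\<^sub>2)\<close> is \<open>H\<^sup>1(H; M)\<close> for the module \<open>M\<close> of \<open>\<bbbF>\<^sub>2\<close>-valued functions on \<open>H/K\<close>. Every such function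
is a polynomial in a basis of \<open>Hom(H, \<bbbF>\<^sub>2)\<close>, and translation preserves the degree up to terms of lower degree.
Hence the polynomials of degree at most \<open>l\<close> form a submodule \<open>P\<^sub>l\<close>, and \<open>H\<close> acts trivially on
\<open>P\<^sub>l / P\<^sub>l\<^sub>-\<^sub>1\<close>, which has dimension \<open>n choose l\<close>.

The long exact cohomology sequence of \<open>P\<^sub>l\<^sub>-\<^sub>1 \<subseteq> P\<^sub>l\<close> shows that out of the \<open>n * (n choose l)\<close> dimensions of
\<open>H\<^sup>1(H; P\<^sub>l / P\<^sub>l\<^sub>-\<^sub>1)\<close> at most \<open>dim H\<^sup>2(H; P\<^sub>l\<^sub>-\<^sub>1)\<close> fail to lift to cocycles in \<open>P\<^sub>l\<close>. An Euler characteristic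
argument along a filtration of \<open>P\<^sub>l\<^sub>-\<^sub>1\<close> with one-dimensional quotients gives
\<open>dim H\<^sup>2(H; P\<^sub>l\<^sub>-\<^sub>1) \<le> dim Z\<^sup>1(H; P\<^sub>l\<^sub>-\<^sub>1) + (r - n) dim P\<^sub>l\<^sub>-\<^sub>1\<close>. Therefore
\<open>dim Z\<^sup>1(H; P\<^sub>l) \<ge> n * (n choose l) - (r - n) dim P\<^sub>l\<^sub>-\<^sub>1\<close>. A cocycle is determined by a homomorphism on \<open>K\<close> and
\<open>2\<^sup>n\<close> further bits, so \<open>b\<^sub>1(K) \<ge> n * (n choose l) - (c + 1) 2\<^sup>n\<close> whenever \<open>r - n \<le> c\<close>; this is
\<open>derived_2_step_bound\<close>. For \<open>l = n div 2\<close> the first term is asymptotic to \<open>sqrt (2 / pi) * 2\<^sup>n * sqrt n\<close> by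
Wallis' product, and the error term is of smaller order.

All modules involved are finite, so dimensions are replaced by cardinalities: \<open>H\<^sup>2\<close> enters through the number
of cosets of coboundaries in cocycles (\<open>qindex\<close>), and exactness through the multiplicativity of indices
(\<open>card_Z1_step\<close>, \<open>H2_step\<close>). The Betti numbers of the bar complex enter through \<open>card_hom2\<close> and
\<open>H2_index_bound\<close>. Both these and the identification of \<open>K\<close> with the common kernel of all homomorphisms
\<open>H \<rightarrow> \<bbbF>\<^sub>2\<close> rest on one extension principle, \<open>separating_hom2\<close>.
\<close>

section \<open>Additive subgroups and their indices\<close>

text \<open>
By default the simplifier turns arithmetic of bits into Boolean connectives and case distinctions, which
destroys the additive normal forms needed here.
\<close>
declare add_bit_eq_xor [simp del] mult_bit_eq_and [simp del] bit_not_zero_iff [simp del]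
  bit_not_one_iff [simp del] minus_bit_def [simp del] uminus_bit_def [simp del]

lemma bit_add_self [simp]: "(x::bit) + x = 0"
  by (cases x) auto

lemma bit_add_eq_0_iff: "(x::bit) + y = 0 \<longleftrightarrow> x = y"
  by (cases x; cases y) auto

lemma bit_diff_eq_add: "(x::bit) - y = x + y"
  by (simp add: minus_bit_def)

definition add_subgroup :: "'m::ab_group_add set \<Rightarrow> bool"
  where "add_subgroup A \<longleftrightarrow> 0 \<in> A \<and> (\<forall>x\<in>A. \<forall>y\<in>A. x - y \<in> A)"

lemma add_subgroupI:
  assumes "0 \<in> A" "\<And>x y. x \<in> A \<Longrightarrow> y \<in> A \<Longrightarrow> x - y \<in> A"
  shows "add_subgroup A"
  using assms by (auto simp: add_subgroup_def)

lemma add_subgroup_zero: "add_subgroup A \<Longrightarrow> 0 \<in> A"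
  and add_subgroup_diff: "add_subgroup A \<Longrightarrow> x \<in> A \<Longrightarrow> y \<in> A \<Longrightarrow> x - y \<in> A"
  by (auto simp: add_subgroup_def)

lemma add_subgroup_uminus: "add_subgroup A \<Longrightarrow> x \<in> A \<Longrightarrow> - x \<in> A"
  using add_subgroup_diff[of A 0 x] add_subgroup_zero[of A] by simp

lemma add_subgroup_add: "add_subgroup A \<Longrightarrow> x \<in> A \<Longrightarrow> y \<in> A \<Longrightarrow> x + y \<in> A"
  using add_subgroup_diff[of A x "- y"] add_subgroup_uminus[of A y] by simp

lemma add_subgroup_sum:
  assumes "add_subgroup A" "\<And>i. i \<in> I \<Longrightarrow> f i \<in> A"
  shows "(\<Sum>i\<in>I. f i) \<in> A"
  using assms(2) by (induction I rule: infinite_finite_induct)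
    (auto intro: add_subgroup_add[OF assms(1)] add_subgroup_zero[OF assms(1)])

definition additive_on :: "'m::ab_group_add set \<Rightarrow> ('m \<Rightarrow> 'k::ab_group_add) \<Rightarrow> bool"
  where "additive_on A f \<longleftrightarrow> (\<forall>x\<in>A. \<forall>y\<in>A. f (x - y) = f x - f y)"

lemma additive_on_diff: "additive_on A f \<Longrightarrow> x \<in> A \<Longrightarrow> y \<in> A \<Longrightarrow> f (x - y) = f x - f y"
  by (auto simp: additive_on_def)

lemma additive_on_subset: "additive_on A f \<Longrightarrow> B \<subseteq> A \<Longrightarrow> additive_on B f"
  by (auto simp: additive_on_def)

lemma additive_on_zero: "add_subgroup A \<Longrightarrow> additive_on A f \<Longrightarrow> f 0 = 0"
  using additive_on_diff[of A f 0 0] add_subgroup_zero[of A] by simp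

lemma additive_on_add:
  assumes "add_subgroup A" "additive_on A f" "x \<in> A" "y \<in> A"
  shows "f (x + y) = f x + f y"
  using additive_on_diff[OF assms(2) assms(3) add_subgroup_uminus[OF assms(1,4)]]
    additive_on_diff[OF assms(2) add_subgroup_zero[OF assms(1)] assms(4)]
    additive_on_zero[OF assms(1,2)] by simp

lemma add_subgroup_image:
  assumes "add_subgroup A" "additive_on A f"
  shows "add_subgroup (f ` A)"
proof (rule add_subgroupI)
  show "0 \<in> f ` A"
    using additive_on_zero[OF assms] add_subgroup_zero[OF assms(1)] by force
  show "x - y \<in> f ` A" if "x \<in> f ` A" "y \<in> f ` A" for x y
    using that additive_on_diff[OF assms(2), symmetric] add_subgroup_diff[OF assms(1)] by auto
qed

definition qindex :: "'m::ab_group_add set \<Rightarrow> 'm set \<Rightarrow> nat"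
  where "qindex Z B = card ((\<lambda>x. (+) x ` B) ` Z)"

lemma add_coset_eq_iff:
  assumes "add_subgroup B"
  shows "(+) x ` B = (+) y ` B \<longleftrightarrow> x - y \<in> B"
proof
  assume "(+) x ` B = (+) y ` B"
  then have "x + 0 \<in> (+) y ` B" using add_subgroup_zero[OF assms] by blast
  then show "x - y \<in> B" by auto
next
  assume *: "x - y \<in> B"
  have "x + b \<in> (+) y ` B" if "b \<in> B" for b
    using add_subgroup_add[OF assms * that] by (intro image_eqI[of _ _ "x - y + b"]) auto
  moreover have "y + b \<in> (+) x ` B" if "b \<in> B" for b
    using add_subgroup_diff[OF assms that *] by (intro image_eqI[of _ _ "b - (x - y)"]) auto
  ultimately show "(+) x ` B = (+) y ` B" by auto
qed

lemma card_image_cong_kernel: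
  assumes "\<And>x y. x \<in> Z \<Longrightarrow> y \<in> Z \<Longrightarrow> F x = F y \<longleftrightarrow> G x = G y"
  shows "card (F ` Z) = card (G ` Z)"
proof (rule bij_betw_same_card)
  let ?h = "\<lambda>u. G (SOME x. x \<in> Z \<and> F x = u)"
  have h: "?h (F x) = G x" if "x \<in> Z" for x
  proof -
    have "(SOME y. y \<in> Z \<and> F y = F x) \<in> Z \<and> F (SOME y. y \<in> Z \<and> F y = F x) = F x"
      by (rule someI[of _ x]) (use that in auto)
    then show ?thesis using assms that by blast
  qed
  show "bij_betw ?h (F ` Z) (G ` Z)"
    unfolding bij_betw_def inj_on_def using h assms by (auto simp: image_iff)
qed

lemma qindex_eq_card_image:
  assumes "add_subgroup B" "\<And>x y. x \<in> Z \<Longrightarrow> y \<in> Z \<Longrightarrow> F x = F y \<longleftrightarrow> x - y \<in> B"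
  shows "qindex Z B = card (F ` Z)"
  unfolding qindex_def
  by (rule card_image_cong_kernel) (use assms in \<open>simp add: add_coset_eq_iff\<close>)

lemma add_subgroup_singleton_zero: "add_subgroup {0}"
  by (rule add_subgroupI) auto

lemma add_subgroup_Int: "add_subgroup A \<Longrightarrow> add_subgroup B \<Longrightarrow> add_subgroup (A \<inter> B)"
  by (rule add_subgroupI) (auto dest: add_subgroup_zero add_subgroup_diff)

lemma qindex_zero: "qindex Z {0} = card Z"
  using qindex_eq_card_image[OF add_subgroup_singleton_zero, of Z id] by simp

text \<open>
Split an element into its chosen representative modulo \<open>Y\<close> and the chosen representative, modulo \<open>B\<close>, of
the remainder. As the proof is a bijection, the equation also holds for infinite indices, which count as \<open>0\<close>.
\<close>
lemma qindex_tower: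
  assumes B: "add_subgroup B" and Y: "add_subgroup Y" and Z: "add_subgroup Z"
    and BY: "B \<subseteq> Y" and YZ: "Y \<subseteq> Z"
  shows "qindex Z B = qindex Z Y * qindex Y B"
proof -
  define r where "r = (\<lambda>x. SOME z. z \<in> Z \<and> x - z \<in> Y)"
  define s where "s = (\<lambda>y. SOME z. z \<in> Y \<and> y - z \<in> B)"
  have r: "r x \<in> Z" "x - r x \<in> Y" if "x \<in> Z" for x
    using someI[of "\<lambda>z. z \<in> Z \<and> x - z \<in> Y" x] that add_subgroup_zero[OF Y]
    by (simp_all add: r_def)
  have s: "s x \<in> Y" "x - s x \<in> B" if "x \<in> Y" for x
    using someI[of "\<lambda>z. z \<in> Y \<and> x - z \<in> B" x] that add_subgroup_zero[OF B]
    by (simp_all add: s_def)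
  have req: "r x = r y \<longleftrightarrow> x - y \<in> Y" if "x \<in> Z" "y \<in> Z" for x y
  proof
    assume "r x = r y"
    then show "x - y \<in> Y"
      using add_subgroup_diff[OF Y r(2)[OF that(1)] r(2)[OF that(2)]] by simp
  next
    assume *: "x - y \<in> Y"
    have "x - z \<in> Y \<longleftrightarrow> y - z \<in> Y" for z
      using add_subgroup_diff[OF Y, of "x - z" "x - y"] add_subgroup_add[OF Y, of "y - z" "x - y"] *
      by auto
    then show "r x = r y" by (simp add: r_def)
  qed
  have seq: "s x = s y \<longleftrightarrow> x - y \<in> B" if "x \<in> Y" "y \<in> Y" for x y
  proof
    assume "s x = s y"
    then show "x - y \<in> B"
      using add_subgroup_diff[OF B s(2)[OF that(1)] s(2)[OF that(2)]] by simp
  next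
    assume *: "x - y \<in> B"
    have "x - z \<in> B \<longleftrightarrow> y - z \<in> B" for z
      using add_subgroup_diff[OF B, of "x - z" "x - y"] add_subgroup_add[OF B, of "y - z" "x - y"] *
      by auto
    then show "s x = s y" by (simp add: s_def)
  qed
  have rr: "r (r x) = r x" if "x \<in> Z" for x
  proof -
    have "r x - x \<in> Y" using add_subgroup_uminus[OF Y r(2)[OF that]] by (simp only: minus_diff_eq)
    then show ?thesis by (simp only: req[OF r(1)[OF that] that])
  qed
  let ?F = "\<lambda>x. (r x, s (x - r x))"
  have "qindex Z B = card (?F ` Z)"
  proof (rule qindex_eq_card_image[OF B])
    fix x y assume xy: "x \<in> Z" "y \<in> Z"
    show "?F x = ?F y \<longleftrightarrow> x - y \<in> B"
    proof
      assume "?F x = ?F y"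
      then have "r x = r y" "(x - r x) - (y - r y) \<in> B"
        using seq[OF r(2)[OF xy(1)] r(2)[OF xy(2)]] by auto
      moreover from this(1) have "(x - r x) - (y - r y) = x - y" by (simp add: algebra_simps)
      ultimately show "x - y \<in> B" by simp
    next
      assume *: "x - y \<in> B"
      then have "r x = r y" using req[OF xy] BY by blast
      moreover from this have "(x - r x) - (y - r y) = x - y" by (simp add: algebra_simps)
      then have "s (x - r x) = s (y - r y)"
        using seq[OF r(2)[OF xy(1)] r(2)[OF xy(2)]] * by metis
      ultimately show "?F x = ?F y" by simp
    qed
  qed
  also have "?F ` Z = r ` Z \<times> s ` Y"
  proof (intro equalityI subsetI)
    fix u assume "u \<in> r ` Z \<times> s ` Y"
    then obtain x y where x: "x \<in> Z" and y: "y \<in> Y" and u: "u = (r x, s y)" by blast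
    have z: "r x + y \<in> Z" using add_subgroup_add[OF Z] r(1)[OF x] y YZ by blast
    have "r (r x + y) = r x"
    proof -
      have "(r x + y) - r x \<in> Y" using y by (simp only: add_diff_cancel_left')
      then have "r (r x + y) = r (r x)" using req[OF z r(1)[OF x]] by blast
      then show ?thesis using rr[OF x] by simp
    qed
    then have "u = ?F (r x + y)" using u by simp
    then show "u \<in> ?F ` Z" using z by (rule image_eqI)
  next
    fix u assume "u \<in> ?F ` Z"
    then obtain x where "x \<in> Z" "u = ?F x" by blast
    then show "u \<in> r ` Z \<times> s ` Y" using r(2) by blast
  qed
  also have "card \<dots> = card (r ` Z) * card (s ` Y)" by (rule card_cartesian_product)
  also have "card (r ` Z) = qindex Z Y" using qindex_eq_card_image[OF Y req] by simp
  also have "card (s ` Y) = qindex Y B" using qindex_eq_card_image[OF B seq] by simp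
  finally show ?thesis .
qed

lemma card_eq_qindex:
  assumes "add_subgroup B" "add_subgroup Z" "B \<subseteq> Z"
  shows "card Z = qindex Z B * card B"
  using qindex_tower[OF add_subgroup_singleton_zero assms(1,2) _ assms(3)] add_subgroup_zero[OF assms(1)]
  by (simp add: qindex_zero)

lemma qindex_image:
  assumes Y: "add_subgroup Y" and U: "add_subgroup U" and UY: "U \<subseteq> Y"
    and f: "additive_on Y f" and ker: "\<And>y. y \<in> Y \<Longrightarrow> f y = 0 \<Longrightarrow> y \<in> U"
  shows "qindex (f ` Y) (f ` U) = qindex Y U"
proof -
  have sU: "add_subgroup (f ` U)"
    by (rule add_subgroup_image[OF U additive_on_subset[OF f UY]])
  have "qindex Y U = card ((\<lambda>x. (+) (f x) ` (f ` U)) ` Y)"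
  proof (rule qindex_eq_card_image[OF U])
    fix x y assume xy: "x \<in> Y" "y \<in> Y"
    have "f x - f y \<in> f ` U \<longleftrightarrow> x - y \<in> U"
    proof
      assume "f x - f y \<in> f ` U"
      then obtain u where u: "u \<in> U" "f (x - y) = f u"
        using additive_on_diff[OF f xy] by auto
      have "f (x - y - u) = 0"
        using additive_on_diff[OF f, of "x - y" u] add_subgroup_diff[OF Y xy] u UY by auto
      then have "x - y - u \<in> U"
        using ker add_subgroup_diff[OF Y add_subgroup_diff[OF Y xy]] u(1) UY by blast
      then show "x - y \<in> U" using add_subgroup_add[OF U _ u(1)] by fastforce
    next
      assume "x - y \<in> U"
      then show "f x - f y \<in> f ` U" using additive_on_diff[OF f xy] by (metis image_eqI)
    qed
    then show "((+) (f x) ` f ` U = (+) (f y) ` f ` U) = (x - y \<in> U)"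
      by (simp only: add_coset_eq_iff[OF sU])
  qed
  also have "\<dots> = qindex (f ` Y) (f ` U)" by (simp add: qindex_def image_image)
  finally show ?thesis ..
qed

definition sum_set :: "'m::ab_group_add set \<Rightarrow> 'm set \<Rightarrow> 'm set"
  where "sum_set A B = {a + b | a b. a \<in> A \<and> b \<in> B}"

lemma add_subgroup_sum_set:
  assumes A: "add_subgroup A" and B: "add_subgroup B"
  shows "add_subgroup (sum_set A B)"
proof (rule add_subgroupI)
  show "0 \<in> sum_set A B" unfolding sum_set_def
    using add_subgroup_zero[OF A] add_subgroup_zero[OF B] by force
  fix x y assume "x \<in> sum_set A B" "y \<in> sum_set A B"
  then obtain a b a' b' where *: "a \<in> A" "b \<in> B" "a' \<in> A" "b' \<in> B" "x = a + b" "y = a' + b'"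
    unfolding sum_set_def by blast
  have "x - y = (a - a') + (b - b')" using * by simp
  then show "x - y \<in> sum_set A B" unfolding sum_set_def
    using add_subgroup_diff[OF A *(1,3)] add_subgroup_diff[OF B *(2,4)] by blast
qed

lemma subset_sum_set:
  assumes "add_subgroup A" "add_subgroup B"
  shows "A \<subseteq> sum_set A B" "B \<subseteq> sum_set A B"
proof -
  show "A \<subseteq> sum_set A B"
  proof
    fix a assume "a \<in> A"
    then have "a + 0 \<in> sum_set A B"
      unfolding sum_set_def using add_subgroup_zero[OF assms(2)] by blast
    then show "a \<in> sum_set A B" by simp
  qed
  show "B \<subseteq> sum_set A B"
  proof
    fix b assume "b \<in> B"
    then have "0 + b \<in> sum_set A B"
      unfolding sum_set_def using add_subgroup_zero[OF assms(1)] by blast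
    then show "b \<in> sum_set A B" by simp
  qed
qed

lemma image_sum_set:
  assumes "add_subgroup Y" "additive_on Y f" "A \<subseteq> Y" "B \<subseteq> Y"
  shows "f ` sum_set A B = sum_set (f ` A) (f ` B)"
proof (intro equalityI subsetI)
  fix x assume "x \<in> f ` sum_set A B"
  then obtain a b where "a \<in> A" "b \<in> B" "x = f (a + b)" unfolding sum_set_def by blast
  then show "x \<in> sum_set (f ` A) (f ` B)"
    unfolding sum_set_def using additive_on_add[OF assms(1,2)] assms(3,4) by blast
next
  fix x assume "x \<in> sum_set (f ` A) (f ` B)"
  then obtain a b where ab: "a \<in> A" "b \<in> B" "x = f a + f b" unfolding sum_set_def by blast
  have "x = f (a + b)"
    unfolding ab(3) by (rule additive_on_add[OF assms(1,2), symmetric]) (use ab assms(3,4) in auto)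
  then show "x \<in> f ` sum_set A B"
    unfolding sum_set_def using ab(1,2) by blast
qed

lemma sum_set_zero: "sum_set A {0} = A" "sum_set {0} A = A"
  by (auto simp: sum_set_def)

text \<open>
Second isomorphism theorem, on the level of indices.
\<close>
lemma qindex_sum_set:
  assumes A: "add_subgroup A" and B: "add_subgroup B"
  shows "qindex (sum_set A B) B = qindex A (A \<inter> B)"
proof -
  have AB: "add_subgroup (A \<inter> B)" using A B by (rule add_subgroup_Int)
  have "qindex A (A \<inter> B) = card ((\<lambda>x. (+) x ` B) ` A)"
    by (rule qindex_eq_card_image[OF AB]) (use add_subgroup_diff[OF A] in \<open>auto simp: add_coset_eq_iff[OF B]\<close>)
  also have "(\<lambda>x. (+) x ` B) ` A = (\<lambda>x. (+) x ` B) ` sum_set A B"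
  proof (intro equalityI subsetI)
    fix u assume "u \<in> (\<lambda>x. (+) x ` B) ` sum_set A B"
    then obtain a b where "a \<in> A" "b \<in> B" "u = (+) (a + b) ` B" unfolding sum_set_def by blast
    moreover from this have "(+) (a + b) ` B = (+) a ` B" by (simp add: add_coset_eq_iff[OF B])
    ultimately show "u \<in> (\<lambda>x. (+) x ` B) ` A" by (metis image_eqI)
  qed (use subset_sum_set[OF A B] in blast)
  finally show ?thesis by (simp add: qindex_def)
qed

section \<open>Cohomology in degrees one and two\<close>

text \<open>
Inhomogeneous cochains with values in \<open>A\<close>. They vanish outside the carrier so that equal cochains are equal
functions and can be counted.
\<close>
definition C1 :: "('a, 'b) monoid_scheme \<Rightarrow> 'm::ab_group_add set \<Rightarrow> ('a \<Rightarrow> 'm) set"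
  where "C1 H A = {f. (\<forall>g. g \<notin> carrier H \<longrightarrow> f g = 0) \<and> (\<forall>g\<in>carrier H. f g \<in> A)}"

definition C2 :: "('a, 'b) monoid_scheme \<Rightarrow> 'm::ab_group_add set \<Rightarrow> ('a \<Rightarrow> 'a \<Rightarrow> 'm) set"
  where "C2 H A = {f. (\<forall>g h. \<not> (g \<in> carrier H \<and> h \<in> carrier H) \<longrightarrow> f g h = 0) \<and>
    (\<forall>g\<in>carrier H. \<forall>h\<in>carrier H. f g h \<in> A)}"

definition d1 :: "('a, 'b) monoid_scheme \<Rightarrow> ('a \<Rightarrow> 'm \<Rightarrow> 'm) \<Rightarrow> ('a \<Rightarrow> 'm::ab_group_add) \<Rightarrow> 'a \<Rightarrow> 'a \<Rightarrow> 'm"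
  where "d1 H act f = (\<lambda>g h. if g \<in> carrier H \<and> h \<in> carrier H
    then f g + act g (f h) - f (g \<otimes>\<^bsub>H\<^esub> h) else 0)"

definition Z1 :: "('a, 'b) monoid_scheme \<Rightarrow> ('a \<Rightarrow> 'm \<Rightarrow> 'm) \<Rightarrow> 'm::ab_group_add set \<Rightarrow> ('a \<Rightarrow> 'm) set"
  where "Z1 H act A = {f \<in> C1 H A. d1 H act f = 0}"

definition B2 :: "('a, 'b) monoid_scheme \<Rightarrow> ('a \<Rightarrow> 'm \<Rightarrow> 'm) \<Rightarrow> 'm::ab_group_add set \<Rightarrow> ('a \<Rightarrow> 'a \<Rightarrow> 'm) set"
  where "B2 H act A = d1 H act ` C1 H A"

definition Z2 :: "('a, 'b) monoid_scheme \<Rightarrow> ('a \<Rightarrow> 'm \<Rightarrow> 'm) \<Rightarrow> 'm::ab_group_add set \<Rightarrow> ('a \<Rightarrow> 'a \<Rightarrow> 'm) set"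
  where "Z2 H act A = {f \<in> C2 H A. \<forall>a\<in>carrier H. \<forall>b\<in>carrier H. \<forall>c\<in>carrier H.
    act a (f b c) - f (a \<otimes>\<^bsub>H\<^esub> b) c + f a (b \<otimes>\<^bsub>H\<^esub> c) - f a b = 0}"

abbreviation trivial_action :: "'a \<Rightarrow> 'm \<Rightarrow> 'm"
  where "trivial_action \<equiv> \<lambda>g a. a"

lemma add_subgroup_C1:
  assumes A: "add_subgroup A"
  shows "add_subgroup (C1 H A)"
  by (rule add_subgroupI) (use add_subgroup_zero[OF A] in \<open>auto simp: C1_def intro: add_subgroup_diff[OF A]\<close>)

lemma add_subgroup_C2:
  assumes A: "add_subgroup A"
  shows "add_subgroup (C2 H A)"
  by (rule add_subgroupI) (use add_subgroup_zero[OF A] in \<open>auto simp: C2_def intro: add_subgroup_diff[OF A]\<close>)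

locale group_action_module = group H for H :: "('a, 'b) monoid_scheme" (structure) +
  fixes act :: "'a \<Rightarrow> 'm::ab_group_add \<Rightarrow> 'm"
  assumes act_diff: "g \<in> carrier H \<Longrightarrow> act g (a - b) = act g a - act g b"
    and act_mult: "g \<in> carrier H \<Longrightarrow> h \<in> carrier H \<Longrightarrow> act (g \<otimes> h) a = act g (act h a)"
begin

lemma act_zero: "g \<in> carrier H \<Longrightarrow> act g 0 = 0"
  using act_diff[of g 0 0] by simp

lemma act_add: "g \<in> carrier H \<Longrightarrow> act g (a + b) = act g a + act g b"
  using act_diff[of g a "- b"] act_diff[of g 0 b] act_zero[of g] by simp

lemma additive_d1: "additive_on UNIV (d1 H act)"
  by (auto simp: additive_on_def d1_def fun_eq_iff act_diff)

definition invariant :: "'m set \<Rightarrow> bool"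
  where "invariant A \<longleftrightarrow> add_subgroup A \<and> (\<forall>g\<in>carrier H. \<forall>a\<in>A. act g a \<in> A)"

lemma invariantD: "invariant A \<Longrightarrow> add_subgroup A"
    "invariant A \<Longrightarrow> g \<in> carrier H \<Longrightarrow> a \<in> A \<Longrightarrow> act g a \<in> A"
  by (auto simp: invariant_def)

lemma add_subgroup_Z1:
  assumes A: "add_subgroup A"
  shows "add_subgroup (Z1 H act A)"
proof (rule add_subgroupI)
  show "0 \<in> Z1 H act A"
    using add_subgroup_zero[OF add_subgroup_C1[OF A, of H]]
    by (auto simp: Z1_def d1_def fun_eq_iff act_zero)
  show "x - y \<in> Z1 H act A" if "x \<in> Z1 H act A" "y \<in> Z1 H act A" for x y
    using that add_subgroup_diff[OF add_subgroup_C1[OF A, of H]] additive_on_diff[OF additive_d1]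
    by (simp add: Z1_def)
qed

lemma add_subgroup_B2: "add_subgroup A \<Longrightarrow> add_subgroup (B2 H act A)"
  unfolding B2_def
  by (rule add_subgroup_image[OF add_subgroup_C1 additive_on_subset[OF additive_d1]]) auto

lemma add_subgroup_Z2:
  assumes A: "add_subgroup A"
  shows "add_subgroup (Z2 H act A)"
proof (rule add_subgroupI)
  show "0 \<in> Z2 H act A"
    using add_subgroup_zero[OF add_subgroup_C2[OF A, of H]] by (auto simp: Z2_def act_zero)
  fix x y assume xy: "x \<in> Z2 H act A" "y \<in> Z2 H act A"
  have "act a ((x - y) b c) - (x - y) (a \<otimes> b) c + (x - y) a (b \<otimes> c) - (x - y) a b = 0"
    if "a \<in> carrier H" "b \<in> carrier H" "c \<in> carrier H" for a b c
  proof -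
    have "act a ((x - y) b c) - (x - y) (a \<otimes> b) c + (x - y) a (b \<otimes> c) - (x - y) a b =
      (act a (x b c) - x (a \<otimes> b) c + x a (b \<otimes> c) - x a b) -
      (act a (y b c) - y (a \<otimes> b) c + y a (b \<otimes> c) - y a b)"
      using that by (simp add: act_diff algebra_simps)
    also have "\<dots> = 0" using xy that by (simp add: Z2_def)
    finally show ?thesis .
  qed
  then show "x - y \<in> Z2 H act A"
    using xy add_subgroup_diff[OF add_subgroup_C2[OF A, of H]] by (simp add: Z2_def)
qed

lemma B2_subset_Z2:
  assumes A: "invariant A"
  shows "B2 H act A \<subseteq> Z2 H act A"
proof
  fix u assume "u \<in> B2 H act A"
  then obtain f where f: "f \<in> C1 H A" "u = d1 H act f" by (auto simp: B2_def)
  have fA: "f g \<in> A" if "g \<in> carrier H" for g using f(1) that by (simp add: C1_def)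
  have "u \<in> C2 H A"
    unfolding C2_def f(2)
    using fA invariantD[OF A] add_subgroup_diff[of A] add_subgroup_add[of A]
    by (simp add: d1_def)
  moreover have "act a (u b c) - u (a \<otimes> b) c + u a (b \<otimes> c) - u a b = 0"
    if "a \<in> carrier H" "b \<in> carrier H" "c \<in> carrier H" for a b c
    using that by (simp add: f(2) d1_def act_diff act_add act_mult m_assoc)
  ultimately show "u \<in> Z2 H act A" by (simp add: Z2_def)
qed

end

lemma (in group) trivial_action_module: "group_action_module G trivial_action"
  by unfold_locales auto

text \<open>
An extension of modules \<open>A \<subseteq> A'\<close> with trivial action on the quotient. The quotient is represented by an
additive complement \<open>W\<close> with projection \<open>\<rho>\<close>, so that cochains with values in the quotient lift to cochains
with values in \<open>A'\<close> by mere inclusion.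
\<close>
locale module_step = group_action_module H act
  for H :: "('a, 'b) monoid_scheme" (structure) and act :: "'a \<Rightarrow> 'm::ab_group_add \<Rightarrow> 'm" +
  fixes A A' W :: "'m set" and \<rho> :: "'m \<Rightarrow> 'm"
  assumes inv: "invariant A" and inv': "invariant A'" and W: "add_subgroup W"
    and rho_diff: "\<rho> (a - b) = \<rho> a - \<rho> b"
    and W_sub: "W \<subseteq> A'" and rho_in: "a \<in> A' \<Longrightarrow> \<rho> a \<in> W" and rho_W: "w \<in> W \<Longrightarrow> \<rho> w = w"
    and A_eq: "A = {a \<in> A'. \<rho> a = 0}"
    and rho_act: "g \<in> carrier H \<Longrightarrow> a \<in> A' \<Longrightarrow> \<rho> (act g a) = \<rho> a"
begin

interpretation triv: group_action_module H "trivial_action :: 'a \<Rightarrow> 'm \<Rightarrow> 'm"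
  by (rule trivial_action_module)

lemma rho_zero: "\<rho> 0 = 0"
  using rho_diff[of 0 0] by simp

lemma rho_add: "\<rho> (a + b) = \<rho> a + \<rho> b"
  using rho_diff[of a "- b"] rho_diff[of 0 b] rho_zero by simp

definition p1 :: "('a \<Rightarrow> 'm) \<Rightarrow> 'a \<Rightarrow> 'm" where "p1 f = (\<lambda>g. \<rho> (f g))"
definition p2 :: "('a \<Rightarrow> 'a \<Rightarrow> 'm) \<Rightarrow> 'a \<Rightarrow> 'a \<Rightarrow> 'm" where "p2 f = (\<lambda>g h. \<rho> (f g h))"

lemma additive_p1: "additive_on Y p1" and additive_p2: "additive_on Y' p2"
  by (auto simp: additive_on_def p1_def p2_def rho_diff fun_eq_iff)

lemma p1_C1: "f \<in> C1 H A' \<Longrightarrow> p1 f \<in> C1 H W" and p2_C2: "u \<in> C2 H A' \<Longrightarrow> p2 u \<in> C2 H W"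
  by (auto simp: C1_def C2_def p1_def p2_def rho_zero rho_in)

lemma p1_W: "f \<in> C1 H W \<Longrightarrow> p1 f = f"
  by (auto simp: C1_def p1_def fun_eq_iff) (metis rho_W rho_zero)

lemma C1_mono: "C1 H A \<subseteq> C1 H A'" "C1 H W \<subseteq> C1 H A'" and C2_mono: "C2 H A \<subseteq> C2 H A'"
  using W_sub A_eq by (auto simp: C1_def C2_def)

lemma C1_ker: "f \<in> C1 H A' \<Longrightarrow> p1 f = 0 \<longleftrightarrow> f \<in> C1 H A"
  unfolding C1_def p1_def A_eq by (auto simp: fun_eq_iff) (metis rho_zero)

lemma C2_ker: "f \<in> C2 H A' \<Longrightarrow> p2 f = 0 \<longleftrightarrow> f \<in> C2 H A"
  unfolding C2_def p2_def A_eq by (auto simp: fun_eq_iff) (metis rho_zero)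

lemma p2_d1: "f \<in> C1 H A' \<Longrightarrow> p2 (d1 H act f) = d1 H trivial_action (p1 f)"
  by (auto simp: p2_def p1_def d1_def fun_eq_iff rho_zero rho_diff rho_add C1_def rho_act)

lemma p2_Z2:
  assumes u: "u \<in> Z2 H act A'"
  shows "p2 u \<in> Z2 H trivial_action W"
proof -
  have *: "p2 u b c - p2 u (a \<otimes> b) c + p2 u a (b \<otimes> c) - p2 u a b = 0"
    if "a \<in> carrier H" "b \<in> carrier H" "c \<in> carrier H" for a b c
  proof -
    have "u b c \<in> A'" using u that by (auto simp: Z2_def C2_def)
    then have "p2 u b c - p2 u (a \<otimes> b) c + p2 u a (b \<otimes> c) - p2 u a b =
      \<rho> (act a (u b c) - u (a \<otimes> b) c + u a (b \<otimes> c) - u a b)"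
      using that by (simp add: p2_def rho_add rho_diff rho_act)
    also have "\<dots> = 0" using u that by (simp add: Z2_def rho_zero)
    finally show ?thesis .
  qed
  moreover have "p2 u \<in> C2 H W" using u by (auto simp: Z2_def intro: p2_C2)
  ultimately show ?thesis by (simp add: Z2_def)
qed

lemma Z2_restrict: "Z2 H act A' \<inter> C2 H A = Z2 H act A"
  using C2_mono by (auto simp: Z2_def)

lemma B2_cap_subset: "B2 H act A' \<inter> C2 H A \<subseteq> Z2 H act A"
  using B2_subset_Z2[OF inv'] Z2_restrict by blast

lemma B2_mono: "B2 H act A \<subseteq> B2 H act A' \<inter> C2 H A"
  using B2_subset_Z2[OF inv] C1_mono by (auto simp: B2_def Z2_def)

lemmas sub = invariantD(1)[OF inv] invariantD(1)[OF inv']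

lemma add_subgroup_B2_cap: "add_subgroup (B2 H act A' \<inter> C2 H A)"
  by (intro add_subgroup_Int add_subgroup_B2 add_subgroup_C2 sub)

text \<open>
By exactness, the classes in \<open>H\<^sup>2(A)\<close> that die in \<open>H\<^sup>2(A')\<close> are the image of the connecting homomorphism
\<open>H\<^sup>1(W) \<rightarrow> H\<^sup>2(A)\<close>; this is the size of that image.
\<close>
abbreviation connecting_index :: nat
  where "connecting_index \<equiv> qindex (B2 H act A' \<inter> C2 H A) (B2 H act A)"

lemma connecting_index_dvd:
  "qindex (Z2 H act A) (B2 H act A) = qindex (Z2 H act A) (B2 H act A' \<inter> C2 H A) * connecting_index"
  by (rule qindex_tower[OF add_subgroup_B2 add_subgroup_B2_cap add_subgroup_Z2])
    (use sub B2_mono B2_cap_subset in auto)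

text \<open>
Exactness at \<open>H\<^sup>1\<close>: the cocycles with values in \<open>W\<close> that lift to \<open>A'\<close> are the kernel of the connecting
homomorphism, and each of them has as many lifts as there are cocycles with values in \<open>A\<close>.
\<close>
lemma card_Z1_step:
  "card (Z1 H act A') * connecting_index = card (Z1 H act A) * card (Z1 H trivial_action W)"
proof -
  \<comment> \<open>The coboundary and the projection are both defined on \<open>Y\<close>, and the kernel of each lies in \<open>?U\<close>: the index of \<open>?U\<close> in \<open>Y\<close> can be read off in either image.\<close>
  define Y where "Y = {f \<in> C1 H A'. p1 f \<in> Z1 H trivial_action W}"
  let ?U = "sum_set (C1 H A) (Z1 H act A')"
  have Y: "add_subgroup Y"
  proof (rule add_subgroupI)
    show "0 \<in> Y" unfolding Y_def
      using add_subgroup_zero[OF add_subgroup_C1[OF sub(2), of H]]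
        additive_on_zero[OF add_subgroup_C1[OF sub(2), of H] additive_p1]
        add_subgroup_zero[OF triv.add_subgroup_Z1[OF W]] by simp
    fix x y assume "x \<in> Y" "y \<in> Y"
    then show "x - y \<in> Y" unfolding Y_def
      using add_subgroup_diff[OF add_subgroup_C1[OF sub(2), of H]]
        additive_on_diff[OF additive_p1, of x UNIV y]
        add_subgroup_diff[OF triv.add_subgroup_Z1[OF W]] by simp
  qed
  have Z1A': "add_subgroup (Z1 H act A')" and C1A: "add_subgroup (C1 H A)"
    by (intro add_subgroup_Z1 add_subgroup_C1 sub)+
  have U: "add_subgroup ?U" by (rule add_subgroup_sum_set[OF C1A Z1A'])
  have CY: "C1 H A \<subseteq> Y"
  proof
    fix f assume "f \<in> C1 H A"
    then have "f \<in> C1 H A'" "p1 f = 0" using C1_mono(1) C1_ker by auto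
    then show "f \<in> Y" using add_subgroup_zero[OF triv.add_subgroup_Z1[OF W]] by (simp add: Y_def)
  qed
  have ZY: "Z1 H act A' \<subseteq> Y"
  proof
    fix f assume f: "f \<in> Z1 H act A'"
    then have "f \<in> C1 H A'" "d1 H act f = 0" by (auto simp: Z1_def)
    moreover have "p2 0 = 0" by (simp add: p2_def rho_zero fun_eq_iff)
    ultimately show "f \<in> Y" using p2_d1[of f] p1_C1[of f] by (simp add: Y_def Z1_def)
  qed
  have UY: "?U \<subseteq> Y" using CY ZY add_subgroup_add[OF Y] by (auto simp: sum_set_def)
  have dY: "d1 H act ` Y = B2 H act A' \<inter> C2 H A"
  proof (intro equalityI subsetI)
    fix u assume "u \<in> d1 H act ` Y"
    then obtain f where f: "f \<in> C1 H A'" "p1 f \<in> Z1 H trivial_action W" "u = d1 H act f"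
      by (auto simp: Y_def)
    then have "u \<in> B2 H act A'" by (auto simp: B2_def)
    moreover have "p2 u = 0" using f p2_d1[OF f(1)] by (simp add: Z1_def)
    moreover have "u \<in> C2 H A'" using calculation(1) B2_subset_Z2[OF inv'] by (auto simp: Z2_def)
    ultimately show "u \<in> B2 H act A' \<inter> C2 H A" using C2_ker by blast
  next
    fix u assume u: "u \<in> B2 H act A' \<inter> C2 H A"
    then obtain f where f: "f \<in> C1 H A'" "u = d1 H act f" by (auto simp: B2_def)
    have "p2 u = 0" using u C2_ker C2_mono by blast
    then show "u \<in> d1 H act ` Y"
      using f p2_d1[OF f(1)] p1_C1[OF f(1)] by (auto simp: Y_def Z1_def)
  qed
  have d1Z: "d1 H act ` Z1 H act A' = {0}"
    using add_subgroup_zero[OF Z1A'] by (auto simp: Z1_def image_iff)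
  have dU: "d1 H act ` ?U = B2 H act A"
    using image_sum_set[OF Y additive_on_subset[OF additive_d1] CY ZY]
    by (simp add: d1Z sum_set_zero B2_def)
  have "connecting_index = qindex (d1 H act ` Y) (d1 H act ` ?U)"
    by (simp add: dY dU)
  also have "\<dots> = qindex Y ?U"
  proof (rule qindex_image[OF Y U UY additive_on_subset[OF additive_d1]])
    fix y assume "y \<in> Y" "d1 H act y = 0"
    then have "y \<in> Z1 H act A'" by (simp add: Y_def Z1_def)
    then show "y \<in> ?U" using subset_sum_set(2)[OF C1A Z1A'] by blast
  qed simp
  also have "\<dots> = qindex (p1 ` Y) (p1 ` ?U)"
  proof (rule qindex_image[OF Y U UY additive_p1, symmetric])
    fix y assume "y \<in> Y" "p1 y = 0"
    then have "y \<in> C1 H A" using C1_ker by (simp add: Y_def)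
    then show "y \<in> ?U" using subset_sum_set(1)[OF C1A Z1A'] by blast
  qed
  also have "p1 ` Y = Z1 H trivial_action W"
  proof (intro equalityI subsetI)
    fix f assume f: "f \<in> Z1 H trivial_action W"
    then have "f \<in> C1 H W" by (simp add: Z1_def)
    then have "f \<in> Y" "f = p1 f" using f C1_mono(2) p1_W[of f] by (auto simp: Y_def)
    then show "f \<in> p1 ` Y" by blast
  qed (auto simp: Y_def)
  also have "p1 ` ?U = p1 ` Z1 H act A'"
  proof -
    have "p1 ` C1 H A = {0}"
      using C1_ker C1_mono(1) add_subgroup_zero[OF C1A] by (auto simp: image_iff subset_iff)
    then show ?thesis
      using image_sum_set[OF Y additive_p1 CY ZY] by (simp add: sum_set_zero)
  qed
  finally have ci: "connecting_index = qindex (Z1 H trivial_action W) (p1 ` Z1 H act A')" .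
  have "card (Z1 H trivial_action W) = connecting_index * card (p1 ` Z1 H act A')"
    unfolding ci
    by (rule card_eq_qindex[OF add_subgroup_image[OF Z1A' additive_p1] triv.add_subgroup_Z1[OF W]])
      (use ZY in \<open>auto simp: Y_def\<close>)
  moreover have "card (Z1 H act A') = card (p1 ` Z1 H act A') * card (Z1 H act A)"
  proof -
    have 1: "Z1 H act A \<subseteq> Z1 H act A'" using C1_mono(1) by (auto simp: Z1_def)
    have "p1 ` Z1 H act A = {0}"
      using C1_ker C1_mono(1) add_subgroup_zero[OF add_subgroup_Z1[OF sub(1)]]
      by (auto simp: image_iff Z1_def subset_iff)
    then have "qindex (Z1 H act A') (Z1 H act A) = card (p1 ` Z1 H act A')"
      using qindex_image[OF Z1A' add_subgroup_Z1[OF sub(1)] 1 additive_p1] C1_ker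
      by (simp add: qindex_zero Z1_def)
    then show ?thesis using card_eq_qindex[OF add_subgroup_Z1[OF sub(1)] Z1A' 1] by simp
  qed
  ultimately show ?thesis by simp
qed

text \<open>
Exactness of \<open>H\<^sup>1(W) \<rightarrow> H\<^sup>2(A) \<rightarrow> H\<^sup>2(A') \<rightarrow> H\<^sup>2(W)\<close>; only an inequality results because the last map need not
be surjective.
\<close>
lemma H2_step:
  assumes fin: "qindex (Z2 H trivial_action W) (B2 H trivial_action W) > 0"
  shows "qindex (Z2 H act A') (B2 H act A') * connecting_index
    \<le> qindex (Z2 H trivial_action W) (B2 H trivial_action W) * qindex (Z2 H act A) (B2 H act A)"
    and "qindex (Z2 H act A) (B2 H act A) > 0 \<Longrightarrow> qindex (Z2 H act A') (B2 H act A') > 0"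
proof -
  let ?Z' = "Z2 H act A'" and ?B' = "B2 H act A'" and ?Z = "Z2 H act A" and ?B = "B2 H act A"
  let ?ZW = "Z2 H trivial_action W" and ?BW = "B2 H trivial_action W"
  note Z' = add_subgroup_Z2[OF sub(2)] and B' = add_subgroup_B2[OF sub(2)]
    and Z = add_subgroup_Z2[OF sub(1)] and B = add_subgroup_B2[OF sub(1)]
  let ?S = "sum_set ?Z ?B'"
  have S: "add_subgroup ?S" by (rule add_subgroup_sum_set[OF Z B'])
  have ZZ': "?Z \<subseteq> ?Z'" using Z2_restrict by blast
  have SZ': "?S \<subseteq> ?Z'"
    using ZZ' B2_subset_Z2[OF inv'] add_subgroup_add[OF Z'] by (auto simp: sum_set_def)
  have p2Z: "p2 ` ?Z = {0}"
  proof -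
    have "p2 u = 0" if "u \<in> ?Z" for u
      using that C2_ker C2_mono by (auto simp: Z2_def)
    then show ?thesis using add_subgroup_zero[OF Z] by (auto simp: image_iff)
  qed
  have p2B: "p2 ` ?B' = ?BW"
  proof (intro equalityI subsetI)
    fix u assume "u \<in> p2 ` ?B'"
    then obtain f where "f \<in> C1 H A'" "u = p2 (d1 H act f)" by (auto simp: B2_def)
    then show "u \<in> ?BW" using p2_d1 p1_C1 by (auto simp: B2_def)
  next
    fix u assume "u \<in> ?BW"
    then obtain f where f: "f \<in> C1 H W" "u = d1 H trivial_action f" by (auto simp: B2_def)
    then have "u = p2 (d1 H act f)" using p2_d1 C1_mono(2) p1_W[OF f(1)] by auto
    then show "u \<in> p2 ` ?B'" using f(1) C1_mono(2) by (auto simp: B2_def)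
  qed
  have p2S: "p2 ` ?S = ?BW"
    using image_sum_set[OF Z' additive_p2 ZZ' B2_subset_Z2[OF inv']] by (simp add: p2Z p2B sum_set_zero)
  have "qindex ?Z' ?S = qindex (p2 ` ?Z') (p2 ` ?S)"
  proof (rule qindex_image[OF Z' S SZ' additive_p2, symmetric])
    fix y assume "y \<in> ?Z'" "p2 y = 0"
    then have "y \<in> ?Z" using C2_ker Z2_restrict by (auto simp: Z2_def)
    then show "y \<in> ?S" using subset_sum_set(1)[OF Z B'] by blast
  qed
  then have 1: "qindex ?Z' ?S = qindex (p2 ` ?Z') ?BW" by (simp add: p2S)
  have W2: "add_subgroup ?BW" "add_subgroup ?ZW" "add_subgroup (p2 ` ?Z')"
    by (rule triv.add_subgroup_B2[OF W] triv.add_subgroup_Z2[OF W] add_subgroup_image[OF Z' additive_p2])+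
  have "qindex ?ZW ?BW = qindex ?ZW (p2 ` ?Z') * qindex (p2 ` ?Z') ?BW"
    by (rule qindex_tower[OF W2(1,3,2)])
      (use p2S SZ' p2_Z2 in blast)+
  then have 2: "qindex ?Z' ?S \<le> qindex ?ZW ?BW" "qindex ?Z' ?S > 0"
    using fin 1 by (auto simp: mult_le_cancel1 Suc_le_eq)
  have 3: "qindex ?S ?B' = qindex ?Z (?B' \<inter> C2 H A)"
  proof -
    have "?Z \<inter> ?B' = ?B' \<inter> C2 H A" using B2_cap_subset by (auto simp: Z2_def)
    then show ?thesis using qindex_sum_set[OF Z B'] by simp
  qed
  have 4: "qindex ?Z' ?B' = qindex ?Z' ?S * qindex ?S ?B'"
    by (rule qindex_tower[OF B' S Z' subset_sum_set(2)[OF Z B'] SZ'])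
  show "qindex ?Z' ?B' * connecting_index \<le> qindex ?ZW ?BW * qindex ?Z ?B"
    using 2(1) by (simp add: 4 3 connecting_index_dvd mult.assoc)
  show "qindex ?Z ?B > 0 \<Longrightarrow> qindex ?Z' ?B' > 0"
    using 2(2) connecting_index_dvd by (simp add: 4 3)
qed

end

section \<open>Homomorphisms to the field of two elements\<close>
abbreviation hom2 :: "('a, 'b) monoid_scheme \<Rightarrow> ('a \<Rightarrow> bit) set"
  where "hom2 H \<equiv> Z1 H trivial_action UNIV"

lemma hom2_iff: "f \<in> hom2 H \<longleftrightarrow> (\<forall>g. g \<notin> carrier H \<longrightarrow> f g = 0) \<and>
    (\<forall>g\<in>carrier H. \<forall>h\<in>carrier H. f (g \<otimes>\<^bsub>H\<^esub> h) = f g + f h)"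
  by (auto simp: Z1_def C1_def d1_def fun_eq_iff)

lemma UNIV_bit: "(UNIV :: bit set) = {0, 1}"
  using bit_not_zero_iff by blast

lemma card_UNIV_bit: "card (UNIV :: bit set) = 2"
  by (simp add: UNIV_bit)

context group
begin

lemma hom_one:
  assumes "subgroup H G" "\<And>x y. x \<in> H \<Longrightarrow> y \<in> H \<Longrightarrow> f (x \<otimes> y) = f x + f y"
  shows "f \<one> = (0::bit)"
  using assms(2)[of \<one> \<one>] subgroup.one_closed[OF assms(1)] by simp

lemma hom_inv:
  assumes H: "subgroup H G" and f: "\<And>x y. x \<in> H \<Longrightarrow> y \<in> H \<Longrightarrow> f (x \<otimes> y) = f x + f y"
    and x: "x \<in> H"
  shows "f (inv x) = (f x :: bit)"
proof -
  have "f x + f (inv x) = f (x \<otimes> inv x)"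
    using f[OF x subgroup.m_inv_closed[OF H x]] by simp
  also have "\<dots> = 0" using hom_one[OF H f] subgroup.mem_carrier[OF H x] by simp
  finally show ?thesis by (simp add: bit_add_eq_0_iff)
qed

text \<open>
Linearly independent homomorphisms take all value vectors. The induction removes one homomorphism \<open>p\<close> and
passes to its kernel, where the others stay independent.
\<close>
lemma dual_points:
  assumes "finite I" "subgroup H G"
    and "\<And>i x y. i \<in> I \<Longrightarrow> x \<in> H \<Longrightarrow> y \<in> H \<Longrightarrow> i (x \<otimes> y) = i x + (i y :: bit)"
    and "\<And>J. J \<subseteq> I \<Longrightarrow> J \<noteq> {} \<Longrightarrow> \<exists>g\<in>H. (\<Sum>i\<in>J. i g) \<noteq> 0"
  shows "\<exists>g\<in>H. \<forall>i\<in>I. i g = v i"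
  using assms
proof (induction I arbitrary: H v rule: finite_induct)
  case empty
  then show ?case using subgroup.one_closed by blast
next
  case (insert p I)
  note H = insert.prems(1) and hom = insert.prems(2)
  have homp: "p (x \<otimes> y) = p x + p y" if "x \<in> H" "y \<in> H" for x y
    using hom[of p] that by blast
  let ?K = "{g \<in> H. p g = 0}"
  have K: "subgroup ?K G"
    using H homp hom_one[OF H homp] hom_inv[OF H homp]
    by (auto simp: subgroup_def)
  have "\<exists>t\<in>H. (\<Sum>i\<in>{p}. i t) \<noteq> 0" by (rule insert.prems(3)) auto
  then obtain t where t: "t \<in> H" "p t = 1" by (auto simp: bit_not_zero_iff)
  have "\<exists>g\<in>?K. \<forall>i\<in>I. i g = w i" for w
  proof (rule insert.IH[OF K])
    show "i (x \<otimes> y) = i x + i y" if "i \<in> I" "x \<in> ?K" "y \<in> ?K" for i x y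
      using hom[of i x y] that by auto
    fix J assume J: "J \<subseteq> I" "J \<noteq> {}"
    let ?s = "\<lambda>g. \<Sum>i\<in>J. i g"
    have homs: "?s (x \<otimes> y) = ?s x + ?s y" if "x \<in> H" "y \<in> H" for x y
    proof -
      have "?s (x \<otimes> y) = (\<Sum>i\<in>J. i x + i y)"
        by (rule sum.cong) (use hom that J in auto)
      then show ?thesis by (simp add: sum.distrib)
    qed
    show "\<exists>g\<in>?K. ?s g \<noteq> 0"
    proof (rule ccontr)
      assume "\<not> ?thesis"
      then have *: "?s g = 0" if "g \<in> H" "p g = 0" for g using that by auto
      \<comment> \<open>A homomorphism that vanishes on the kernel of \<open>p\<close> is either zero or \<open>p\<close> itself; both contradict independence.\<close>
      have eq: "?s g = ?s t" if g: "g \<in> H" "p g = 1" for g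
      proof -
        have ti: "inv t \<in> H" using subgroup.m_inv_closed[OF H t(1)] .
        have "p (g \<otimes> inv t) = 0"
          using homp[OF g(1) ti] hom_inv[OF H homp t(1)] g t by simp
        then have "?s (g \<otimes> inv t) = 0"
          using *[of "g \<otimes> inv t"] subgroup.m_closed[OF H g(1) ti] by blast
        then show ?thesis
          using homs[OF g(1) ti] hom_inv[OF H homs t(1)] by (simp add: bit_add_eq_0_iff)
      qed
      obtain g where g: "g \<in> H" "?s g \<noteq> 0" using insert.prems(3)[of J] J by blast
      then have st: "?s t = 1" using * eq by (cases "p g") (force simp: bit_not_zero_iff)+
      have fJ: "finite J" and pJ: "p \<notin> J" using J insert.hyps finite_subset by auto
      obtain h where h: "h \<in> H" "(\<Sum>i\<in>insert p J. i h) \<noteq> 0"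
        using insert.prems(3)[of "insert p J"] J by blast
      then have "p h + ?s h \<noteq> 0" using fJ pJ by simp
      then show False using *[OF h(1)] eq[OF h(1)] st by (cases "p h") auto
    qed
  qed
  note IH = this
  obtain g where g: "g \<in> H" "p g = v p"
    using t hom_one[OF H homp] subgroup.one_closed[OF H] by (cases "v p") auto
  obtain k where k: "k \<in> H" "p k = 0" "\<And>i. i \<in> I \<Longrightarrow> i k = v i - i g"
    using IH[of "\<lambda>i. v i - i g"] by auto
  have "k \<otimes> g \<in> H" using subgroup.m_closed[OF H k(1) g(1)] .
  moreover have "i (k \<otimes> g) = v i" if "i \<in> insert p I" for i
  proof (cases "i = p")
    case True
    then show ?thesis using homp[OF k(1) g(1)] k g by simp
  next
    case False
    then have "i \<in> I" using that by simp
    then have "i (k \<otimes> g) = i k + i g" "i k = v i - i g" using hom[of i k g] k g by auto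
    then show ?thesis by (cases "v i"; cases "i g") auto
  qed
  ultimately show ?case by blast
qed

end

text \<open>
A maximal independent set is a basis, and the subsets of a basis parametrise the space.
\<close>
lemma (in group) hom2_basis_exists:
  assumes fin: "finite (hom2 G)"
  obtains I where "finite I" "I \<subseteq> hom2 G" "card (hom2 G) = 2 ^ card I"
    "\<And>v. \<exists>g\<in>carrier G. \<forall>i\<in>I. i g = v i"
    "\<And>f. f \<in> hom2 G \<Longrightarrow> \<exists>J\<subseteq>I. \<forall>x. f x = (\<Sum>i\<in>J. i x)"
proof -
  interpret triv: group_action_module G "trivial_action :: 'a \<Rightarrow> bit \<Rightarrow> bit"
    by (rule trivial_action_module)
  have sub: "add_subgroup (hom2 G)" by (rule triv.add_subgroup_Z1) (simp add: add_subgroup_def)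
  define ind where "ind = (\<lambda>I. I \<subseteq> hom2 G \<and> (\<forall>J\<subseteq>I. J \<noteq> {} \<longrightarrow> (\<exists>g\<in>carrier G. (\<Sum>i\<in>J. i g) \<noteq> 0)))"
  have "finite {I. ind I}" by (rule finite_subset[of _ "Pow (hom2 G)"]) (use fin in \<open>auto simp: ind_def\<close>)
  moreover have "ind {}" by (auto simp: ind_def)
  ultimately obtain I where I: "ind I" and max: "\<And>I'. ind I' \<Longrightarrow> I \<subseteq> I' \<Longrightarrow> I' = I"
    using finite_has_maximal[of "{I. ind I}"] by blast
  have finI: "finite I" using I fin finite_subset by (auto simp: ind_def)
  have IH: "I \<subseteq> hom2 G" using I by (simp add: ind_def)
  define L where "L = (\<lambda>(J :: ('a \<Rightarrow> bit) set) g. \<Sum>i\<in>J. i g)"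
  have Lfun: "L J = (\<Sum>i\<in>J. i)" for J
    by (induction J rule: infinite_finite_induct) (auto simp: L_def fun_eq_iff)
  have L: "L J \<in> hom2 G" if "J \<subseteq> I" for J
    unfolding Lfun by (rule add_subgroup_sum[OF sub]) (use that IH in blast)
  have span: "f \<in> L ` Pow I" if f: "f \<in> hom2 G" for f
  proof (cases "f \<in> I")
    case True
    then show ?thesis by (intro image_eqI[of _ _ "{f}"]) (auto simp: L_def)
  next
    case False
    then have "\<not> ind (insert f I)" using max by blast
    then obtain J where J: "J \<subseteq> insert f I" "J \<noteq> {}" "\<forall>g\<in>carrier G. (\<Sum>i\<in>J. i g) = 0"
      using f IH unfolding ind_def by blast
    have "f \<in> J"
    proof (rule ccontr)
      assume "f \<notin> J"
      then have "J \<subseteq> I" using J(1) by blast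
      then show False using J(2,3) I unfolding ind_def by blast
    qed
    have fJ: "finite J" using J finI finite_subset by blast
    have "f = L (J - {f})"
    proof
      fix g
      show "f g = L (J - {f}) g"
      proof (cases "g \<in> carrier G")
        case True
        then have "0 = f g + L (J - {f}) g"
          using J(3) sum.remove[OF fJ \<open>f \<in> J\<close>, of "\<lambda>i. i g"] by (simp add: L_def)
        then show ?thesis using bit_add_eq_0_iff[of "f g"] by simp
      next
        case False
        have "L (J - {f}) \<in> hom2 G" using L J(1) by blast
        then show ?thesis using f False by (simp add: hom2_iff)
      qed
    qed
    then show ?thesis using J(1) by blast
  qed
  have "inj_on L (Pow I)"
  proof (rule inj_onI)
    fix J J' assume J: "J \<in> Pow I" "J' \<in> Pow I" "L J = L J'"
    let ?D = "(J - J') \<union> (J' - J)"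
    have f: "finite J" "finite J'" using J finI finite_subset by auto
    have "(\<Sum>i\<in>?D. i g) = 0" for g
    proof -
      have "(\<Sum>i\<in>J. i g) = (\<Sum>i\<in>J - J'. i g) + (\<Sum>i\<in>J \<inter> J'. i g)"
        using sum.Int_Diff[OF f(1), of "\<lambda>i. i g" J'] by (simp add: add.commute)
      moreover have "(\<Sum>i\<in>J'. i g) = (\<Sum>i\<in>J' - J. i g) + (\<Sum>i\<in>J \<inter> J'. i g)"
        using sum.Int_Diff[OF f(2), of "\<lambda>i. i g" J] by (simp add: add.commute Int_commute)
      moreover have "(\<Sum>i\<in>J. i g) = (\<Sum>i\<in>J'. i g)" using J(3) by (simp add: L_def fun_eq_iff)
      ultimately have "(\<Sum>i\<in>J - J'. i g) = (\<Sum>i\<in>J' - J. i g)" by simp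
      moreover have "(\<Sum>i\<in>?D. i g) = (\<Sum>i\<in>J - J'. i g) + (\<Sum>i\<in>J' - J. i g)"
        by (rule sum.union_disjoint) (use f in auto)
      ultimately show ?thesis by simp
    qed
    moreover have "?D \<subseteq> I" using J by auto
    ultimately have "?D = {}" using I unfolding ind_def by blast
    then show "J = J'" by blast
  qed
  moreover have "L ` Pow I = hom2 G" using span L by auto
  ultimately have "card (hom2 G) = 2 ^ card I" using finI by (metis card_Pow card_image)
  moreover have "\<exists>g\<in>carrier G. \<forall>i\<in>I. i g = v i" for v
    by (rule dual_points[OF finI subgroup_self]) (use I IH in \<open>auto simp: ind_def hom2_iff subset_iff\<close>)
  moreover have "\<exists>J\<subseteq>I. \<forall>x. f x = (\<Sum>i\<in>J. i x)" if f: "f \<in> hom2 G" for f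
  proof -
    obtain J where "J \<subseteq> I" "f = L J" using span[OF f] by blast
    then show ?thesis unfolding L_def by blast
  qed
  ultimately show thesis using that finI IH by blast
qed

section \<open>Polynomial functions on an elementary abelian quotient\<close>

text \<open>
The basis elements themselves index the coordinates of \<open>H/K = \<bbbF>\<^sub>2\<^sup>n\<close>. The module of functions on \<open>H/K\<close> is
represented by coefficient vectors: \<open>a S\<close> is the coefficient of the monomial \<open>mon S\<close>.
\<close>
locale char_basis = group H for H :: "('a, 'b) monoid_scheme" (structure) +
  fixes I :: "('a \<Rightarrow> bit) set"
  assumes finI: "finite I" and I_hom: "I \<subseteq> hom2 H"
    and surj: "\<exists>g\<in>carrier H. \<forall>i\<in>I. i g = v i"
begin

definition mon :: "('a \<Rightarrow> bit) set \<Rightarrow> 'a \<Rightarrow> bit"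
  where "mon S x = (\<Prod>i\<in>S. i x)"

definition poly_fun :: "(('a \<Rightarrow> bit) set \<Rightarrow> bit) \<Rightarrow> 'a \<Rightarrow> bit"
  where "poly_fun a x = (\<Sum>S\<in>Pow I. a S * mon S x)"

text \<open>
The coefficients of the right translate by \<open>g\<close>, obtained by expanding the product of the factors
\<open>i x + i g\<close>.
\<close>
definition shift :: "'a \<Rightarrow> (('a \<Rightarrow> bit) set \<Rightarrow> bit) \<Rightarrow> ('a \<Rightarrow> bit) set \<Rightarrow> bit"
  where "shift g a T = (if T \<subseteq> I then (\<Sum>S | S \<subseteq> I \<and> T \<subseteq> S. mon (S - T) g * a S) else 0)"

text \<open>
For a family of monomials closed under divisors this is a submodule; adding monomials to the family one by one
refines the filtration by degree.
\<close>
definition supported :: "('a \<Rightarrow> bit) set set \<Rightarrow> (('a \<Rightarrow> bit) set \<Rightarrow> bit) set"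
  where "supported X = {a. \<forall>S. S \<notin> X \<longrightarrow> a S = 0}"

lemma char_mult: "i \<in> I \<Longrightarrow> x \<in> carrier H \<Longrightarrow> y \<in> carrier H \<Longrightarrow> i (x \<otimes> y) = i x + i y"
  using I_hom by (auto simp: hom2_iff)

lemma char_one: "i \<in> I \<Longrightarrow> i \<one> = 0"
  using char_mult[of i \<one> \<one>] by simp

lemma finite_sub: "S \<subseteq> I \<Longrightarrow> finite S"
  using finI finite_subset by auto

lemma mon_mult:
  assumes "S \<subseteq> I" "x \<in> carrier H" "g \<in> carrier H"
  shows "mon S (x \<otimes> g) = (\<Sum>T\<in>Pow S. mon T x * mon (S - T) g)"
proof -
  have "mon S (x \<otimes> g) = (\<Prod>i\<in>S. i x + i g)"
    unfolding mon_def by (rule prod.cong) (use assms char_mult in auto)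
  also have "\<dots> = (\<Sum>T\<in>Pow S. mon T x * mon (S - T) g)"
    unfolding mon_def by (rule prod_add[OF finite_sub[OF assms(1)]])
  finally show ?thesis .
qed

lemma poly_fun_shift:
  assumes x: "x \<in> carrier H" and g: "g \<in> carrier H"
  shows "poly_fun (shift g a) x = poly_fun a (x \<otimes> g)"
proof -
  have fin: "finite (Pow I)" using finI by simp
  have "poly_fun (shift g a) x =
      (\<Sum>T\<in>Pow I. \<Sum>S\<in>Pow I. if T \<subseteq> S then mon (S - T) g * a S * mon T x else 0)"
  proof -
    have "shift g a T * mon T x = (\<Sum>S\<in>Pow I. if T \<subseteq> S then mon (S - T) g * a S * mon T x else 0)"
      if "T \<in> Pow I" for T
    proof -
      have "shift g a T = (\<Sum>S\<in>{S \<in> Pow I. T \<subseteq> S}. mon (S - T) g * a S)"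
        using that by (simp add: shift_def)
      also have "\<dots> = (\<Sum>S\<in>Pow I. if T \<subseteq> S then mon (S - T) g * a S else 0)"
        by (rule sum.inter_filter[OF fin])
      finally have "shift g a T * mon T x
          = (\<Sum>S\<in>Pow I. (if T \<subseteq> S then mon (S - T) g * a S else 0) * mon T x)"
        by (simp only: sum_distrib_right)
      also have "\<dots> = (\<Sum>S\<in>Pow I. if T \<subseteq> S then mon (S - T) g * a S * mon T x else 0)"
        by (rule sum.cong) simp_all
      finally show ?thesis .
    qed
    then show ?thesis by (simp add: poly_fun_def)
  qed
  also have "\<dots> = (\<Sum>S\<in>Pow I. \<Sum>T\<in>Pow I. if T \<subseteq> S then mon (S - T) g * a S * mon T x else 0)"
    by (rule sum.swap)
  also have "\<dots> = (\<Sum>S\<in>Pow I. a S * mon S (x \<otimes> g))"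
  proof (rule sum.cong[OF refl])
    fix S assume S: "S \<in> Pow I"
    have "Pow S = {T \<in> Pow I. T \<subseteq> S}" using S by auto
    then have "a S * mon S (x \<otimes> g) = (\<Sum>T\<in>{T \<in> Pow I. T \<subseteq> S}. mon (S - T) g * a S * mon T x)"
      using S x g by (simp add: mon_mult sum_distrib_left mult_ac)
    also have "\<dots> = (\<Sum>T\<in>Pow I. if T \<subseteq> S then mon (S - T) g * a S * mon T x else 0)"
      using fin by (simp only: sum.inter_filter)
    finally show "(\<Sum>T\<in>Pow I. if T \<subseteq> S then mon (S - T) g * a S * mon T x else 0) = a S * mon S (x \<otimes> g)" ..
  qed
  finally show ?thesis by (simp add: poly_fun_def)
qed

text \<open>
Squarefree monomials are linearly independent as functions. The module laws for \<open>shift\<close> are consequences,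
since they are evident for functions.
\<close>
lemma poly_fun_inj:
  assumes a: "a \<in> supported (Pow I)" and b: "b \<in> supported (Pow I)"
    and eq: "\<And>x. x \<in> carrier H \<Longrightarrow> poly_fun a x = poly_fun b x"
  shows "a = b"
proof (rule ccontr)
  assume "a \<noteq> b"
  define D where "D = {S. a S \<noteq> b S}"
  have D: "D \<subseteq> Pow I" using a b by (fastforce simp: D_def supported_def)
  have "finite D" using D finI finite_subset by auto
  moreover have "D \<noteq> {}" using \<open>a \<noteq> b\<close> by (auto simp: D_def fun_eq_iff)
  ultimately obtain S where S: "S \<in> D" and min: "\<And>T. T \<in> D \<Longrightarrow> T \<subseteq> S \<Longrightarrow> T = S"
    using finite_has_minimal[of D] by blast
  \<comment> \<open>At this point a monomial is nonzero only if it divides the one of \<open>S\<close>, so the minimality of \<open>S\<close> isolates a single coefficient.\<close>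
  obtain x where x: "x \<in> carrier H" "\<And>i. i \<in> I \<Longrightarrow> i x = of_bool (i \<in> S)"
    using surj[of "\<lambda>i. of_bool (i \<in> S)"] by blast
  have mon: "mon T x = of_bool (T \<subseteq> S)" if "T \<subseteq> I" for T
  proof (cases "T \<subseteq> S")
    case True
    have "\<forall>i\<in>T. i x = 1"
    proof
      fix i assume "i \<in> T"
      then have "i \<in> I" "i \<in> S" using True that by auto
      then show "i x = 1" using x(2)[of i] by simp
    qed
    then have "mon T x = 1" unfolding mon_def by (rule prod.neutral)
    then show ?thesis using True by simp
  next
    case False
    then obtain i where "i \<in> T" "i \<notin> S" by blast
    then have "mon T x = 0"
      unfolding mon_def using x(2)[of i] that by (intro prod_zero finite_sub) auto
    then show ?thesis using False by simp
  qed
  have "poly_fun a x - poly_fun b x = (\<Sum>T\<in>Pow I. (a T - b T) * mon T x)"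
    by (simp only: poly_fun_def left_diff_distrib sum_subtractf)
  also have "\<dots> = (\<Sum>T\<in>Pow I. if T = S then a S - b S else 0)"
  proof (rule sum.cong[OF refl])
    fix T assume T: "T \<in> Pow I"
    show "(a T - b T) * mon T x = (if T = S then a S - b S else 0)"
    proof (cases "T \<subseteq> S \<and> T \<noteq> S")
      case True
      then have "a T = b T" using min[of T] by (auto simp: D_def)
      then show ?thesis using True by simp
    next
      case False
      then show ?thesis using mon[of T] T by auto
    qed
  qed
  also have "\<dots> = a S - b S" using S D finI by (subst sum.delta) auto
  finally have "a S - b S = 0" using eq[OF x(1)] by (simp only: diff_self)
  then show False using S by (auto simp: D_def bit_add_eq_0_iff)
qed

lemma shift_supported: "shift g a \<in> supported (Pow I)"
  by (auto simp: supported_def shift_def)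

lemma add_subgroup_supported: "add_subgroup (supported X)"
  by (rule add_subgroupI) (auto simp: supported_def)

sublocale group_action_module H shift
proof
  fix g a b
  show "shift g (a - b) = shift g a - shift g b"
    by (auto simp: shift_def fun_eq_iff right_diff_distrib sum_subtractf)
next
  fix g h a assume "g \<in> carrier H" "h \<in> carrier H"
  then show "shift (g \<otimes> h) a = shift g (shift h a)"
    by (intro poly_fun_inj shift_supported) (simp add: poly_fun_shift m_assoc)
qed

definition down_closed :: "('a \<Rightarrow> bit) set set \<Rightarrow> bool"
  where "down_closed X \<longleftrightarrow> X \<subseteq> Pow I \<and> (\<forall>S\<in>X. \<forall>T. T \<subseteq> S \<longrightarrow> T \<in> X)"

lemma invariant_supported:
  assumes X: "down_closed X"
  shows "invariant (supported X)"
proof -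
  have "shift g a T = 0" if a: "a \<in> supported X" and T: "T \<notin> X" for g a T
  proof -
    have "a S = 0" if "T \<subseteq> S" for S
      using X T a that unfolding down_closed_def supported_def by blast
    then show ?thesis by (auto simp: shift_def intro!: sum.neutral)
  qed
  then have "shift g a \<in> supported X" if "a \<in> supported X" for g a
    using that by (auto simp: supported_def)
  then show ?thesis using add_subgroup_supported by (auto simp: invariant_def)
qed

text \<open>
Translation changes a monomial only by proper divisors, so monomials without proper multiples in the family
span a quotient with trivial action.
\<close>
lemma module_step_supported:
  assumes X: "down_closed X" and XY: "down_closed (X \<union> Y)" and disj: "X \<inter> Y = {}"
    and max: "\<And>T S. T \<in> Y \<Longrightarrow> S \<in> X \<union> Y \<Longrightarrow> T \<subseteq> S \<Longrightarrow> S = T"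
  shows "module_step H shift (supported X) (supported (X \<union> Y)) (supported Y)
    (\<lambda>a S. if S \<in> Y then a S else 0)"
proof unfold_locales
  show "invariant (supported X)" "invariant (supported (X \<union> Y))"
    by (intro invariant_supported X XY)+
  show "add_subgroup (supported Y)" by (rule add_subgroup_supported)
  show "supported X = {a \<in> supported (X \<union> Y). (\<lambda>S. if S \<in> Y then a S else 0) = 0}"
    using disj by (auto simp: supported_def fun_eq_iff)
  fix g a assume g: "g \<in> carrier H" and a: "a \<in> supported (X \<union> Y)"
  have "shift g a T = a T" if T: "T \<in> Y" for T
  proof -
    have TI: "T \<subseteq> I" using T XY by (auto simp: down_closed_def)
    have "shift g a T = (\<Sum>S | S \<subseteq> I \<and> T \<subseteq> S. if S = T then a T else 0)"
      unfolding shift_def using TI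
    proof (simp, intro sum.cong refl)
      fix S assume S: "S \<in> {S. S \<subseteq> I \<and> T \<subseteq> S}"
      show "mon (S - T) g * a S = (if S = T then a T else 0)"
      proof (cases "S = T")
        case True
        then show ?thesis by (simp add: mon_def)
      next
        case False
        then have "S \<notin> X \<union> Y" using max[OF T] S by blast
        then show ?thesis using a False by (simp add: supported_def)
      qed
    qed
    also have "\<dots> = a T"
      using TI finI by (subst sum.delta) auto
    finally show ?thesis .
  qed
  then show "(\<lambda>S. if S \<in> Y then shift g a S else 0) = (\<lambda>S. if S \<in> Y then a S else 0)"
    by (auto simp: fun_eq_iff)
qed (auto simp: supported_def fun_eq_iff)

lemma card_Z1_trivial_supported:
  assumes Y: "finite Y"
  shows "card (Z1 H trivial_action (supported Y)) = card (hom2 H) ^ card Y"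
proof -
  let ?F = "\<lambda>f. \<lambda>S\<in>Y. \<lambda>g. (f :: 'a \<Rightarrow> ('a \<Rightarrow> bit) set \<Rightarrow> bit) g S"
  let ?G = "\<lambda>u g S. if S \<in> Y then u S g else (0::bit)"
  have "bij_betw ?F (Z1 H trivial_action (supported Y)) (Y \<rightarrow>\<^sub>E hom2 H)"
  proof (rule bij_betw_byWitness[where f' = ?G])
    show "\<forall>f\<in>Z1 H trivial_action (supported Y). ?G (?F f) = f"
    proof
      fix f assume f: "f \<in> Z1 H trivial_action (supported Y)"
      have "f g S = 0" if "S \<notin> Y" for g S
        using f that by (cases "g \<in> carrier H") (auto simp: Z1_def C1_def supported_def)
      then show "?G (?F f) = f" by (auto simp: fun_eq_iff)
    qed
    show "\<forall>u\<in>Y \<rightarrow>\<^sub>E hom2 H. ?F (?G u) = u"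
      by (auto simp: fun_eq_iff PiE_def extensional_def)
    show "?F ` Z1 H trivial_action (supported Y) \<subseteq> Y \<rightarrow>\<^sub>E hom2 H"
      by (auto simp: Z1_def C1_def d1_def fun_eq_iff split: if_splits)
    show "?G ` (Y \<rightarrow>\<^sub>E hom2 H) \<subseteq> Z1 H trivial_action (supported Y)"
      by (auto simp: Z1_def C1_def d1_def fun_eq_iff supported_def PiE_def Pi_def)
  qed
  then show ?thesis using Y by (simp add: bij_betw_same_card card_PiE)
qed

abbreviation trivial_H2_index :: nat
  where "trivial_H2_index \<equiv> qindex (Z2 H trivial_action (UNIV :: bit set)) (B2 H trivial_action UNIV)"

lemma H2_trivial_singleton:
  "qindex (Z2 H trivial_action (supported {S})) (B2 H trivial_action (supported {S})) = trivial_H2_index"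
proof -
  interpret triv: group_action_module H "trivial_action :: 'a \<Rightarrow> (('a \<Rightarrow> bit) set \<Rightarrow> bit) \<Rightarrow> _"
    by (rule trivial_action_module)
  let ?f = "\<lambda>u g h. (u :: 'a \<Rightarrow> 'a \<Rightarrow> ('a \<Rightarrow> bit) set \<Rightarrow> bit) g h S"
  let ?G = "\<lambda>u g h T. if T = S then (u :: 'a \<Rightarrow> 'a \<Rightarrow> bit) g h else 0"
  let ?G1 = "\<lambda>u g T. if T = S then (u :: 'a \<Rightarrow> bit) g else 0"
  have Z: "?f ` Z2 H trivial_action (supported {S}) = Z2 H trivial_action UNIV"
  proof (intro equalityI subsetI)
    fix u :: "'a \<Rightarrow> 'a \<Rightarrow> bit" assume "u \<in> Z2 H trivial_action UNIV"
    then have "?G u \<in> Z2 H trivial_action (supported {S})"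
      by (auto simp: Z2_def C2_def supported_def fun_eq_iff)
    then show "u \<in> ?f ` Z2 H trivial_action (supported {S})" by (rule rev_image_eqI) simp
  qed (auto simp: Z2_def C2_def fun_eq_iff)
  have B: "?f ` B2 H trivial_action (supported {S}) = B2 H trivial_action UNIV"
  proof (intro equalityI subsetI)
    fix u :: "'a \<Rightarrow> 'a \<Rightarrow> bit" assume "u \<in> B2 H trivial_action UNIV"
    then obtain w where w: "w \<in> C1 H UNIV" "u = d1 H trivial_action w" by (auto simp: B2_def)
    have "?G1 w \<in> C1 H (supported {S})"
      using w(1) by (auto simp: C1_def supported_def fun_eq_iff)
    moreover have "u = ?f (d1 H trivial_action (?G1 w))"
      by (auto simp: w(2) d1_def fun_eq_iff)
    ultimately show "u \<in> ?f ` B2 H trivial_action (supported {S})" by (auto simp: B2_def)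
  next
    fix u assume "u \<in> ?f ` B2 H trivial_action (supported {S})"
    then obtain w where w: "w \<in> C1 H (supported {S})" "u = ?f (d1 H trivial_action w)"
      by (auto simp: B2_def)
    have "(\<lambda>g. w g S) \<in> C1 H UNIV" using w(1) by (auto simp: C1_def fun_eq_iff)
    moreover have "u = d1 H trivial_action (\<lambda>g. w g S)" by (auto simp: w(2) d1_def fun_eq_iff)
    ultimately show "u \<in> B2 H trivial_action UNIV" by (auto simp: B2_def)
  qed
  have subZ: "add_subgroup (Z2 H trivial_action (supported {S}))"
    and subB: "add_subgroup (B2 H trivial_action (supported {S}))"
    by (intro triv.add_subgroup_Z2 triv.add_subgroup_B2 add_subgroup_supported)+
  have "qindex (?f ` Z2 H trivial_action (supported {S})) (?f ` B2 H trivial_action (supported {S}))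
     = qindex (Z2 H trivial_action (supported {S})) (B2 H trivial_action (supported {S}))"
  proof (rule qindex_image[OF subZ subB])
    show "B2 H trivial_action (supported {S}) \<subseteq> Z2 H trivial_action (supported {S})"
      by (rule triv.B2_subset_Z2) (simp add: triv.invariant_def add_subgroup_supported)
    show "additive_on (Z2 H trivial_action (supported {S})) ?f"
      by (auto simp: additive_on_def fun_eq_iff)
    fix u assume u: "u \<in> Z2 H trivial_action (supported {S})" "?f u = 0"
    have "u g h T = 0" for g h T
    proof (cases "T = S \<or> \<not> (g \<in> carrier H \<and> h \<in> carrier H)")
      case True
      then show ?thesis using u by (auto simp: Z2_def C2_def fun_eq_iff)
    next
      case False
      then show ?thesis using u by (auto simp: Z2_def C2_def supported_def)
    qed
    then have "u = 0" by (simp add: fun_eq_iff)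
    then show "u \<in> B2 H trivial_action (supported {S})" using add_subgroup_zero[OF subB] by simp
  qed
  then show ?thesis by (simp add: Z B)
qed

text \<open>
The truncated Euler characteristic \<open>dim H\<^sup>2 - dim Z\<^sup>1\<close> is subadditive along extensions, because the connecting
homomorphism contributes the same amount to both terms. Each one-dimensional trivial factor contributes at
most \<open>b\<^sub>2 - b\<^sub>1\<close>.
\<close>
lemma H2_card_bound:
  assumes fin: "finite (hom2 H)" and R: "trivial_H2_index > 0"
    and X: "down_closed X"
  shows "qindex (Z2 H shift (supported X)) (B2 H shift (supported X)) > 0 \<and>
    card (Z1 H shift (supported X)) > 0 \<and>
    qindex (Z2 H shift (supported X)) (B2 H shift (supported X)) * card (hom2 H) ^ card X
      \<le> card (Z1 H shift (supported X)) * trivial_H2_index ^ card X"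
  using X
proof (induction "card X" arbitrary: X rule: less_induct)
  case (less X)
  have finX: "finite X" using less.prems finI finite_subset by (auto simp: down_closed_def)
  show ?case
  proof (cases "X = {}")
    case True
    have s: "supported {} = {0}" by (auto simp: supported_def fun_eq_iff)
    have c: "C1 H {0::('a \<Rightarrow> bit) set \<Rightarrow> bit} = {0}"
    proof -
      have "f = 0" if "f \<in> C1 H {0}" for f :: "'a \<Rightarrow> ('a \<Rightarrow> bit) set \<Rightarrow> bit"
      proof -
        have "f g = 0" for g using that by (cases "g \<in> carrier H") (simp_all add: C1_def)
        then show ?thesis by (intro ext) simp
      qed
      then show ?thesis using add_subgroup_zero[OF add_subgroup_C1[OF add_subgroup_singleton_zero]] by blast
    qed
    have c2: "C2 H {0::('a \<Rightarrow> bit) set \<Rightarrow> bit} = {0}"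
    proof -
      have "f = 0" if "f \<in> C2 H {0}" for f :: "'a \<Rightarrow> 'a \<Rightarrow> ('a \<Rightarrow> bit) set \<Rightarrow> bit"
      proof -
        have "f g h = 0" for g h
          using that by (cases "g \<in> carrier H \<and> h \<in> carrier H") (simp_all add: C2_def)
        then show ?thesis by (intro ext) simp
      qed
      then show ?thesis using add_subgroup_zero[OF add_subgroup_C2[OF add_subgroup_singleton_zero]] by blast
    qed
    have z: "Z1 H shift {0} = {0}" using add_subgroup_zero[OF add_subgroup_Z1[OF add_subgroup_singleton_zero]]
      by (auto simp: Z1_def c)
    have z2: "Z2 H shift {0} = {0}" using add_subgroup_zero[OF add_subgroup_Z2[OF add_subgroup_singleton_zero]]
      by (auto simp: Z2_def c2)
    have b: "B2 H shift {0} = {0}" using add_subgroup_zero[OF add_subgroup_B2[OF add_subgroup_singleton_zero]]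
      by (auto simp: B2_def c)
    show ?thesis by (simp add: s z z2 b qindex_zero True)
  next
    case False
    then obtain S where S: "S \<in> X" and max: "\<And>T. T \<in> X \<Longrightarrow> S \<subseteq> T \<Longrightarrow> T = S"
      using finite_has_maximal[OF finX] by blast
    let ?X = "X - {S}"
    have X: "?X \<union> {S} = X" using S by auto
    have down: "down_closed ?X" using less.prems max by (auto simp: down_closed_def)
    have "module_step H shift (supported ?X) (supported (?X \<union> {S})) (supported {S})
      (\<lambda>a T. if T \<in> {S} then a T else 0)"
      by (rule module_step_supported) (use down less.prems max X in \<open>simp_all add: insert_absorb S\<close>)
    then interpret module_step H shift "supported ?X" "supported X" "supported {S}"
      "\<lambda>a T. if T \<in> {S} then a T else 0"
      unfolding X .
    have cX: "card X = Suc (card ?X)" using S finX by (metis card_Suc_Diff1)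
    have "card ?X < card X" using cX by simp
    note IH = less.hyps[OF this down]
    let ?N = "card (hom2 H)" and ?R = trivial_H2_index
    let ?h = "qindex (Z2 H shift (supported ?X)) (B2 H shift (supported ?X))"
    let ?h' = "qindex (Z2 H shift (supported X)) (B2 H shift (supported X))"
    let ?z = "card (Z1 H shift (supported ?X))" and ?z' = "card (Z1 H shift (supported X))"
    have N: "?N > 0" using fin hom2_iff[of 0 H] by (auto simp: card_gt_0_iff)
    have z: "?z' * connecting_index = ?z * ?N"
      using card_Z1_step card_Z1_trivial_supported[of "{S}"] by simp
    have IH': "?h > 0" "?z > 0" "?h * ?N ^ card ?X \<le> ?z * ?R ^ card ?X" using IH by blast+
    have R': "qindex (Z2 H trivial_action (supported {S})) (B2 H trivial_action (supported {S})) > 0"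
      using R by (simp only: H2_trivial_singleton)
    have h: "?h' * connecting_index \<le> ?R * ?h" "?h' > 0"
      using H2_step(1)[OF R'] H2_step(2)[OF R' IH'(1)] by (simp_all only: H2_trivial_singleton)
    have "?z' * connecting_index > 0" unfolding z using IH'(2) N by simp
    then have pos: "?z' > 0" "connecting_index > 0" by simp_all
    have "(?h' * ?N ^ card X) * connecting_index = (?h' * connecting_index) * ?N ^ card X" by simp
    also have "\<dots> \<le> (?R * ?h) * ?N ^ card X" using h(1) by (rule mult_right_mono) simp
    also have "\<dots> = ?R * ?N * (?h * ?N ^ card ?X)" by (simp add: cX)
    also have "\<dots> \<le> ?R * ?N * (?z * ?R ^ card ?X)"
      using IH'(3) by (rule mult_left_mono) simp
    also have "\<dots> = (?z * ?N) * ?R ^ card X" by (simp add: cX)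
    also have "\<dots> = (?z' * ?R ^ card X) * connecting_index" by (simp add: z[symmetric])
    finally have "?h' * ?N ^ card X \<le> ?z' * ?R ^ card X" using pos(2) by simp
    then show ?thesis using h(2) pos(1) by blast
  qed
qed

text \<open>
The obstruction to lifting a cocycle from the top degree \<open>l\<close> lies in \<open>H\<^sup>2\<close> of the polynomials of degree less
than \<open>l\<close>. By \<open>H2_card_bound\<close> that space is not much larger than their space of 1-cocycles, which cancels
against the number of lifts.
\<close>
lemma card_Z1_level:
  fixes l :: nat
  assumes fin: "finite (hom2 H)" and R: "trivial_H2_index > 0"
  defines "X \<equiv> {S. S \<subseteq> I \<and> card S < l}"
  shows "card (hom2 H) ^ ((card I choose l) + card X)
    \<le> card (Z1 H shift (supported {S. S \<subseteq> I \<and> card S \<le> l})) * trivial_H2_index ^ card X"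
proof -
  let ?Y = "{S. S \<subseteq> I \<and> card S = l}"
  have XY: "{S. S \<subseteq> I \<and> card S \<le> l} = X \<union> ?Y" by (auto simp: X_def)
  have cY: "card ?Y = card I choose l" using n_subsets[OF finI] .
  have finY: "finite ?Y" using finI by simp
  have sub: "T \<subseteq> I \<and> card T \<le> card S" if "S \<subseteq> I" "T \<subseteq> S" for S T
    using that card_mono[OF finite_sub[OF that(1)] that(2)] by blast
  have down: "down_closed X"
    unfolding down_closed_def X_def
  proof (intro conjI ballI allI impI)
    fix S T assume "S \<in> {S. S \<subseteq> I \<and> card S < l}" "T \<subseteq> S"
    then show "T \<in> {S. S \<subseteq> I \<and> card S < l}" using sub[of S T] by simp
  qed blast
  interpret module_step H shift "supported X" "supported (X \<union> ?Y)" "supported ?Y"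
    "\<lambda>a T. if T \<in> ?Y then a T else 0"
  proof (rule module_step_supported[OF down])
    show "down_closed (X \<union> ?Y)"
      unfolding down_closed_def XY[symmetric]
    proof (intro conjI ballI allI impI)
      fix S T assume "S \<in> {S. S \<subseteq> I \<and> card S \<le> l}" "T \<subseteq> S"
      then show "T \<in> {S. S \<subseteq> I \<and> card S \<le> l}" using sub[of S T] by simp
    qed blast
    show "S = T" if "T \<in> ?Y" "S \<in> X \<union> ?Y" "T \<subseteq> S" for S T
    proof -
      have "S \<subseteq> I" "card S \<le> card T" using that by (auto simp: X_def)
      then show ?thesis using card_seteq[OF finite_sub[of S] that(3)] by simp
    qed
  qed (auto simp: X_def)
  let ?N = "card (hom2 H)" and ?R = trivial_H2_index
  let ?h = "qindex (Z2 H shift (supported X)) (B2 H shift (supported X))"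
  let ?z = "card (Z1 H shift (supported X))" and ?z' = "card (Z1 H shift (supported (X \<union> ?Y)))"
  note b = H2_card_bound[OF fin R down]
  have z: "?z' * connecting_index = ?z * ?N ^ (card I choose l)"
    using card_Z1_step card_Z1_trivial_supported[OF finY] by (simp add: cY)
  have "0 < ?h" using b by blast
  then have "connecting_index \<le> ?h" unfolding connecting_index_dvd by simp
  then have "?z' * connecting_index * ?N ^ card X \<le> ?z' * ?h * ?N ^ card X"
    by (intro mult_right_mono mult_left_mono) auto
  also have "\<dots> \<le> ?z' * (?z * ?R ^ card X)" using b by (simp only: mult.assoc mult_le_mono2)
  finally have "?z * ?N ^ (card I choose l) * ?N ^ card X \<le> ?z' * (?z * ?R ^ card X)"
    by (simp only: z)
  then have "?z * ?N ^ ((card I choose l) + card X) \<le> ?z * (?z' * ?R ^ card X)"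
    by (simp only: power_add mult.assoc mult.left_commute[of ?z'])
  moreover have "?z > 0" using b by blast
  ultimately have "?N ^ ((card I choose l) + card X) \<le> ?z' * ?R ^ card X" by (simp only: mult_le_cancel1)
  then show ?thesis by (simp only: XY)
qed

definition common_kernel :: "'a set"
  where "common_kernel = {x \<in> carrier H. \<forall>i\<in>I. i x = 0}"

lemma poly_fun_one:
  assumes "a \<in> supported (Pow I)"
  shows "poly_fun a \<one> = a {}"
proof -
  have "poly_fun a \<one> = (\<Sum>S\<in>Pow I. if S = {} then a {} else 0)"
    unfolding poly_fun_def
  proof (rule sum.cong[OF refl])
    fix S assume S: "S \<in> Pow I"
    show "a S * mon S \<one> = (if S = {} then a {} else 0)"
    proof (cases "S = {}")
      case False
      then obtain i where "i \<in> S" by blast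
      then have "mon S \<one> = 0"
        unfolding mon_def using char_one[of i] S by (intro prod_zero finite_sub) auto
      then show ?thesis using False by simp
    qed (simp add: mon_def)
  qed
  then show ?thesis using finI by (simp add: sum.delta)
qed

lemma shift_kernel:
  assumes k: "k \<in> common_kernel" and a: "a \<in> supported (Pow I)"
  shows "shift k a = a"
proof (rule poly_fun_inj[OF shift_supported a])
  fix x assume x: "x \<in> carrier H"
  have kc: "k \<in> carrier H" using k by (simp add: common_kernel_def)
  have "mon S (x \<otimes> k) = mon S x" if "S \<subseteq> I" for S
    unfolding mon_def
  proof (rule prod.cong[OF refl])
    fix i assume "i \<in> S"
    then have "i \<in> I" using that by blast
    then show "i (x \<otimes> k) = i x" using char_mult[of i x k] k x kc by (auto simp: common_kernel_def)
  qed
  then show "poly_fun (shift k a) x = poly_fun a x"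
    using x kc by (simp add: poly_fun_shift) (simp add: poly_fun_def)
qed

text \<open>
The explicit form of Shapiro's lemma: evaluation at the identity turns a cocycle into a function on \<open>H\<close> that
determines it, is a homomorphism on the kernel \<open>K\<close>, and satisfies \<open>f (k h) = f k + f h\<close>. So it is given by its
restriction to \<open>K\<close> and its values at representatives of the \<open>2\<^sup>n\<close> cosets. The wasteful count of the latter
affects only the error term.
\<close>
lemma card_Z1_le:
  assumes fin: "finite (hom2 (H\<lparr>carrier := common_kernel\<rparr>))" and X: "X \<subseteq> Pow I"
  shows "card (Z1 H shift (supported X)) \<le> card (hom2 (H\<lparr>carrier := common_kernel\<rparr>)) * 2 ^ 2 ^ card I"
proof -
  let ?K = common_kernel
  obtain rep where rep: "\<And>J. rep J \<in> carrier H" "\<And>J i. i \<in> I \<Longrightarrow> i (rep J) = of_bool (i \<in> J)"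
  proof -
    have "\<exists>g. g \<in> carrier H \<and> (\<forall>i\<in>I. i g = of_bool (i \<in> J))" for J
      using surj[of "\<lambda>i. of_bool (i \<in> J)"] by blast
    then show thesis using that by metis
  qed
  let ?F = "\<lambda>f. (\<lambda>k. if k \<in> ?K then (f :: 'a \<Rightarrow> ('a \<Rightarrow> bit) set \<Rightarrow> bit) k {} else 0, \<lambda>J\<in>Pow I. f (rep J) {})"
  let ?T = "hom2 (H\<lparr>carrier := ?K\<rparr>) \<times> (Pow I \<rightarrow>\<^sub>E (UNIV :: bit set))"
  have sup: "f g \<in> supported (Pow I)" if "f \<in> Z1 H shift (supported X)" for f g
  proof -
    have "f g \<in> supported X"
      using that add_subgroup_zero[OF add_subgroup_supported[of X]]
      by (cases "g \<in> carrier H") (auto simp: Z1_def C1_def)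
    then show ?thesis using X by (auto simp: supported_def)
  qed
  have coc: "f (g \<otimes> h) = f g + shift g (f h)"
    if "f \<in> Z1 H shift (supported X)" "g \<in> carrier H" "h \<in> carrier H" for f g h
  proof -
    have "d1 H shift f g h = 0" using that(1) by (simp add: Z1_def)
    then show ?thesis using that(2,3) by (simp add: d1_def)
  qed
  have Kc: "?K \<subseteq> carrier H" by (auto simp: common_kernel_def)
  have cock: "f (k \<otimes> h) {} = f k {} + f h {}"
    if "f \<in> Z1 H shift (supported X)" "k \<in> ?K" "h \<in> carrier H" for f k h
    using coc[OF that(1) _ that(3), of k] shift_kernel[OF that(2) sup[OF that(1)]] that(2) Kc by auto
  have Kmult: "k \<otimes> h \<in> ?K" if "k \<in> ?K" "h \<in> ?K" for k h
    using that by (auto simp: common_kernel_def char_mult)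
  have "card (Z1 H shift (supported X)) \<le> card ?T"
  proof (rule card_inj_on_le[of ?F])
    show "finite ?T" using fin finI by (intro finite_cartesian_product finite_PiE) (auto simp: UNIV_bit)
    show "?F ` Z1 H shift (supported X) \<subseteq> ?T"
    proof
      fix u assume "u \<in> ?F ` Z1 H shift (supported X)"
      then obtain f where f: "f \<in> Z1 H shift (supported X)" "u = ?F f" by blast
      have "(\<lambda>k. if k \<in> ?K then f k {} else 0) \<in> hom2 (H\<lparr>carrier := ?K\<rparr>)"
        using cock[OF f(1)] Kmult Kc by (auto simp: hom2_iff)
      then show "u \<in> ?T" using f(2) by auto
    qed
    show "inj_on ?F (Z1 H shift (supported X))"
    proof (rule inj_onI)
      fix f f' assume f: "f \<in> Z1 H shift (supported X)" and f': "f' \<in> Z1 H shift (supported X)"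
        and eq: "?F f = ?F f'"
      have e1: "f k {} = f' k {}" if "k \<in> ?K" for k
        using eq that by (auto simp: fun_eq_iff split: if_splits)
      have e2: "f (rep J) {} = f' (rep J) {}" if "J \<subseteq> I" for J
        using eq that by (auto simp: fun_eq_iff restrict_def split: if_splits)
      have e: "f x {} = f' x {}" if x: "x \<in> carrier H" for x
      proof -
        define J where "J = {i \<in> I. i x = 1}"
        let ?k = "x \<otimes> inv (rep J)"
        have "i ?k = 0" if "i \<in> I" for i
        proof -
          have "i ?k = i x + i (rep J)"
            using char_mult[OF that x] rep(1)
              hom_inv[OF subgroup_self char_mult[OF that] rep(1)] by simp
          then show ?thesis using rep(2)[OF that] that by (cases "i x") (auto simp: J_def)
        qed
        then have k: "?k \<in> ?K" using x rep(1) by (simp add: common_kernel_def)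
        have "x = ?k \<otimes> rep J" using x rep(1) by (simp add: m_assoc)
        moreover have "f (?k \<otimes> rep J) {} = f' (?k \<otimes> rep J) {}"
          unfolding cock[OF f k rep(1)] cock[OF f' k rep(1)]
          using e1[OF k] e2[of J] by (auto simp: J_def)
        ultimately show ?thesis by simp
      qed
      \<comment> \<open>The evaluation of \<open>f g\<close> at \<open>x\<close> is the evaluation at \<open>\<one>\<close> of its translate by \<open>x\<close>, which the cocycle identity expresses by two values at \<open>\<one>\<close>.\<close>
      have val: "poly_fun (f g) x = f (x \<otimes> g) {} + f x {}"
        if f: "f \<in> Z1 H shift (supported X)" and "g \<in> carrier H" "x \<in> carrier H" for f g x
      proof -
        have "poly_fun (f g) x = poly_fun (shift x (f g)) \<one>" using that by (simp add: poly_fun_shift)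
        also have "\<dots> = shift x (f g) {}" by (rule poly_fun_one[OF shift_supported])
        also have "\<dots> = f (x \<otimes> g) {} - f x {}" using coc[OF f, of x g] that by simp
        finally show ?thesis by simp
      qed
      show "f = f'"
      proof
        fix g
        show "f g = f' g"
        proof (cases "g \<in> carrier H")
          case True
          show ?thesis
            by (rule poly_fun_inj[OF sup[OF f] sup[OF f']])
              (use val[OF f True] val[OF f' True] e True in simp)
        next
          case False
          then show ?thesis using f f' by (auto simp: Z1_def C1_def)
        qed
      qed
    qed
  qed
  also have "card ?T = card (hom2 (H\<lparr>carrier := ?K\<rparr>)) * 2 ^ 2 ^ card I"
  proof -
    show ?thesis using finI by (simp add: card_cartesian_product card_PiE card_Pow card_UNIV_bit)
  qed
  finally show ?thesis .
qed

lemma covering_bound: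
  fixes l :: nat
  assumes fin: "finite (hom2 H)" "finite (hom2 (H\<lparr>carrier := common_kernel\<rparr>))"
    and R: "trivial_H2_index > 0"
  defines "s \<equiv> card {S. S \<subseteq> I \<and> card S < l}"
  shows "card (hom2 H) ^ ((card I choose l) + s)
    \<le> card (hom2 (H\<lparr>carrier := common_kernel\<rparr>)) * 2 ^ 2 ^ card I * trivial_H2_index ^ s"
proof -
  have "card (hom2 H) ^ ((card I choose l) + s)
    \<le> card (Z1 H shift (supported {S. S \<subseteq> I \<and> card S \<le> l})) * trivial_H2_index ^ s"
    unfolding s_def by (rule card_Z1_level[OF fin(1) R])
  also have "\<dots> \<le> card (hom2 (H\<lparr>carrier := common_kernel\<rparr>)) * 2 ^ 2 ^ card I * trivial_H2_index ^ s"
    by (intro mult_right_mono card_Z1_le fin(2)) auto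
  finally show ?thesis .
qed

end

section \<open>Separating homomorphisms and the derived 2-series\<close>

text \<open>
A maximal subgroup among those that contain \<open>K\<close> but not \<open>g\<close> has index two, and its indicator is the required
homomorphism. For groups of exponent two the hypothesis on squares is void, and this becomes the extension
theorem for linear functionals on arbitrary \<open>\<bbbF>\<^sub>2\<close>-vector spaces.
\<close>
lemma (in group) separating_hom2:
  assumes K: "subgroup K G" and sq: "\<And>x. x \<in> carrier G \<Longrightarrow> x \<otimes> x \<in> K"
    and g: "g \<in> carrier G" "g \<notin> K"
  shows "\<exists>f\<in>hom2 G. (\<forall>k\<in>K. f k = 0) \<and> f g = 1"
proof -
  let ?S = "{M. subgroup M G \<and> K \<subseteq> M \<and> g \<notin> M}"
  have "\<exists>M\<in>?S. \<forall>X\<in>?S. M \<subseteq> X \<longrightarrow> X = M"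
  proof (rule subset_Zorn_nonempty)
    show "?S \<noteq> {}" using K g by blast
    fix C assume C: "C \<noteq> {}" "subset.chain ?S C"
    have sub: "subgroup M G" "K \<subseteq> M" "g \<notin> M" if "M \<in> C" for M
      using C(2) that unfolding subset_chain_def by blast+
    have "subgroup (\<Union>C) G"
    proof (rule subgroupI)
      show "\<Union>C \<subseteq> carrier G" using subgroup.subset[OF sub(1)] by blast
      obtain N where N: "N \<in> C" using C(1) by blast
      then show "\<Union>C \<noteq> {}" using subgroup.one_closed[OF sub(1)[OF N]] by blast
      fix a assume "a \<in> \<Union>C"
      then obtain A where A: "A \<in> C" "a \<in> A" by blast
      then show "inv a \<in> \<Union>C" using subgroup.m_inv_closed[OF sub(1)[OF A(1)] A(2)] by blast
      fix b assume "b \<in> \<Union>C"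
      then obtain B where B: "B \<in> C" "b \<in> B" by blast
      have "A \<subseteq> B \<or> B \<subseteq> A" using C(2) A(1) B(1) unfolding subset_chain_def by blast
      then have "\<exists>D\<in>C. a \<in> D \<and> b \<in> D" using A B by blast
      then obtain D where D: "D \<in> C" "a \<in> D" "b \<in> D" by blast
      then show "a \<otimes> b \<in> \<Union>C" using subgroup.m_closed[OF sub(1)[OF D(1)] D(2,3)] by blast
    qed
    then show "\<Union>C \<in> ?S" using sub(2,3) C(1) by blast
  qed
  then obtain M where "M \<in> ?S" and max: "\<forall>X\<in>?S. M \<subseteq> X \<longrightarrow> X = M" ..
  then have M: "subgroup M G" "K \<subseteq> M" "g \<notin> M" by simp_all
  have Mc: "m \<in> carrier G" if "m \<in> M" for m using subgroup.mem_carrier[OF M(1) that] .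
  note Mm = subgroup.m_closed[OF M(1)] and Mi = subgroup.m_inv_closed[OF M(1)]
  \<comment> \<open>A subgroup that contains all squares is normal: \<open>x m x\<^sup>-\<^sup>1 = (x m)\<^sup>2 m\<^sup>-\<^sup>1 x\<^sup>-\<^sup>2\<close>.\<close>
  have conj: "x \<otimes> m \<otimes> inv x \<in> M" if x: "x \<in> carrier G" and m: "m \<in> M" for x m
  proof -
    have "((x \<otimes> m) \<otimes> (x \<otimes> m)) \<otimes> inv m \<otimes> (inv x \<otimes> inv x) \<in> M"
    proof -
      have "(x \<otimes> m) \<otimes> (x \<otimes> m) \<in> M" "inv x \<otimes> inv x \<in> M"
        using sq[of "x \<otimes> m"] sq[of "inv x"] M(2) x Mc[OF m] by auto
      then show ?thesis using Mm Mi[OF m] by blast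
    qed
    moreover have "((x \<otimes> m) \<otimes> (x \<otimes> m)) \<otimes> inv m \<otimes> (inv x \<otimes> inv x) = x \<otimes> m \<otimes> inv x"
    proof -
      have 1: "m \<otimes> (inv m \<otimes> (inv x \<otimes> inv x)) = inv x \<otimes> inv x"
        using x Mc[OF m] by (simp add: m_assoc[symmetric])
      have 2: "x \<otimes> (inv x \<otimes> inv x) = inv x" using x by (simp add: m_assoc[symmetric])
      have "((x \<otimes> m) \<otimes> (x \<otimes> m)) \<otimes> inv m \<otimes> (inv x \<otimes> inv x)
          = x \<otimes> (m \<otimes> (x \<otimes> (m \<otimes> (inv m \<otimes> (inv x \<otimes> inv x)))))"
        using x Mc[OF m] by (simp only: m_assoc m_closed inv_closed)
      then show ?thesis unfolding 1 2 using x Mc[OF m] by (simp add: m_assoc)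
    qed
    ultimately show ?thesis by simp
  qed
  \<comment> \<open>Otherwise \<open>M \<union> M x\<close> would be a larger subgroup avoiding \<open>g\<close>. Hence \<open>M\<close> has exactly two cosets.\<close>
  have key: "g \<otimes> inv x \<in> M" if x: "x \<in> carrier G" "x \<notin> M" for x
  proof (rule ccontr)
    assume nin: "g \<otimes> inv x \<notin> M"
    let ?X = "{y \<in> carrier G. y \<in> M \<or> y \<otimes> inv x \<in> M}"
    have xx: "x \<otimes> x \<in> M" using sq M(2) x by blast
    have "subgroup ?X G"
    proof (rule subgroupI)
      show "?X \<noteq> {}" using subgroup.one_closed[OF M(1)] by blast
      fix a assume a: "a \<in> ?X"
      then have ac: "a \<in> carrier G" by blast
      show "inv a \<in> ?X"
      proof (cases "a \<in> M")
        case True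
        then show ?thesis using Mi ac by blast
      next
        case False
        then have m: "a \<otimes> inv x \<in> M" using a by blast
        have "inv x \<otimes> inv (a \<otimes> inv x) \<otimes> inv (inv x) \<otimes> inv (x \<otimes> x) \<in> M"
          using conj[OF inv_closed[OF x(1)] Mi[OF m]] Mi[OF xx] Mm by blast
        moreover have "inv x \<otimes> inv (a \<otimes> inv x) \<otimes> inv (inv x) \<otimes> inv (x \<otimes> x) = inv a \<otimes> inv x"
        proof -
          have "inv x \<otimes> inv (a \<otimes> inv x) \<otimes> inv (inv x) \<otimes> inv (x \<otimes> x)
             = (inv x \<otimes> x) \<otimes> inv a \<otimes> ((x \<otimes> inv x) \<otimes> inv x)"
            using x(1) ac by (simp only: inv_mult_group inv_inv m_assoc m_closed inv_closed)
          also have "\<dots> = inv a \<otimes> inv x" using x(1) ac by simp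
          finally show ?thesis .
        qed
        ultimately show ?thesis using ac by simp
      qed
      fix b assume b: "b \<in> ?X"
      then have bc: "b \<in> carrier G" by blast
      have 1: "a \<otimes> b \<otimes> inv x = a \<otimes> (b \<otimes> inv x)" using ac bc x(1) by (simp add: m_assoc)
      have 2: "a \<otimes> b \<otimes> inv x = (a \<otimes> inv x) \<otimes> (x \<otimes> b \<otimes> inv x)"
      proof -
        have "(a \<otimes> inv x) \<otimes> (x \<otimes> b \<otimes> inv x) = a \<otimes> ((inv x \<otimes> x) \<otimes> (b \<otimes> inv x))"
          using ac bc x(1) by (simp only: m_assoc m_closed inv_closed)
        then show ?thesis using ac bc x(1) by (simp add: m_assoc)
      qed
      have 3: "a \<otimes> b = (a \<otimes> inv x) \<otimes> (x \<otimes> (b \<otimes> inv x) \<otimes> inv x) \<otimes> (x \<otimes> x)"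
      proof -
        have "(a \<otimes> inv x) \<otimes> (x \<otimes> (b \<otimes> inv x) \<otimes> inv x) \<otimes> (x \<otimes> x)
          = a \<otimes> ((inv x \<otimes> x) \<otimes> (b \<otimes> (inv x \<otimes> ((inv x \<otimes> x) \<otimes> x))))"
          using ac bc x(1) by (simp only: m_assoc m_closed inv_closed)
        then show ?thesis using ac bc x(1) by simp
      qed
      show "a \<otimes> b \<in> ?X"
      proof (cases "a \<in> M"; cases "b \<in> M")
        assume "a \<in> M" "b \<in> M"
        then show ?thesis using Mm ac bc by simp
      next
        assume "a \<in> M" "b \<notin> M"
        then have "a \<otimes> b \<otimes> inv x \<in> M" using Mm[of a "b \<otimes> inv x"] b 1 by simp
        then show ?thesis using ac bc by simp
      next
        assume "a \<notin> M" "b \<in> M"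
        then have "a \<otimes> inv x \<in> M" "x \<otimes> b \<otimes> inv x \<in> M" using a conj[OF x(1)] by auto
        then have "a \<otimes> b \<otimes> inv x \<in> M" using Mm 2 by metis
        then show ?thesis using ac bc by simp
      next
        assume "a \<notin> M" "b \<notin> M"
        then have "a \<otimes> inv x \<in> M" "x \<otimes> (b \<otimes> inv x) \<otimes> inv x \<in> M" using a b conj[OF x(1)] by auto
        then have "a \<otimes> b \<in> M" using Mm xx 3 by metis
        then show ?thesis using ac bc by simp
      qed
    qed auto
    moreover have "K \<subseteq> ?X" "M \<subseteq> ?X" using M(2) Mc by blast+
    moreover have "g \<notin> ?X" using nin M(3) by blast
    ultimately have "?X = M" using max[THEN bspec, of ?X] by simp
    moreover have "x \<in> ?X" using x subgroup.one_closed[OF M(1)] by simp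
    ultimately show False using x by blast
  qed
  define f where "f = (\<lambda>x. if x \<in> carrier G \<and> x \<notin> M then 1 else 0 :: bit)"
  have split: "x \<otimes> y \<in> M \<longleftrightarrow> (x \<in> M \<longleftrightarrow> y \<in> M)" if xy: "x \<in> carrier G" "y \<in> carrier G" for x y
  proof (cases "x \<in> M")
    case True
    have "y = inv x \<otimes> (x \<otimes> y)" using xy by (simp add: m_assoc[symmetric])
    then show ?thesis using True Mm Mi by metis
  next
    case x: False
    show ?thesis
    proof (cases "y \<in> M")
      case True
      have "x = (x \<otimes> y) \<otimes> inv y" using xy by (simp add: m_assoc)
      then show ?thesis using True x Mm Mi by metis
    next
      case False
      then have "inv y \<notin> M" using Mi xy by (metis inv_inv)
      then have "g \<otimes> y \<in> M" using key[of "inv y"] xy by simp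
      then have "inv (g \<otimes> inv x) \<otimes> (g \<otimes> y) \<in> M" using key[OF xy(1) x] Mm Mi by blast
      moreover have "inv (g \<otimes> inv x) \<otimes> (g \<otimes> y) = x \<otimes> ((inv g \<otimes> g) \<otimes> y)"
        using xy g(1) by (simp only: inv_mult_group inv_inv m_assoc m_closed inv_closed)
      ultimately have "x \<otimes> y \<in> M" using xy g(1) by simp
      then show ?thesis using x False by blast
    qed
  qed
  have "f \<in> hom2 G" unfolding hom2_iff by (auto simp: f_def split)
  moreover have "\<forall>k\<in>K. f k = 0" using M(2) by (auto simp: f_def)
  moreover have "f g = 1" using g(1) M(3) by (simp add: f_def)
  ultimately show ?thesis by blast
qed

lemma (in group) hom2_kernel_subgroup:
  assumes H: "subgroup H G"
  shows "subgroup {x \<in> H. \<forall>f\<in>hom2 (G\<lparr>carrier := H\<rparr>). f x = 0} G"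
proof -
  have f: "f (x \<otimes> y) = f x + f y" if "f \<in> hom2 (G\<lparr>carrier := H\<rparr>)" "x \<in> H" "y \<in> H" for f x y
    using that by (simp add: hom2_iff)
  note Hm = subgroup.m_closed[OF H] and Hi = subgroup.m_inv_closed[OF H]
  show ?thesis
  proof (rule subgroupI)
    show "{x \<in> H. \<forall>f\<in>hom2 (G\<lparr>carrier := H\<rparr>). f x = 0} \<subseteq> carrier G"
      using subgroup.subset[OF H] by blast
    have "f \<one> = 0" if "f \<in> hom2 (G\<lparr>carrier := H\<rparr>)" for f
      by (rule hom_one[OF H f[OF that]])
    then show "{x \<in> H. \<forall>f\<in>hom2 (G\<lparr>carrier := H\<rparr>). f x = 0} \<noteq> {}"
      using subgroup.one_closed[OF H] by blast
    fix a assume a: "a \<in> {x \<in> H. \<forall>f\<in>hom2 (G\<lparr>carrier := H\<rparr>). f x = 0}"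
    have "f (inv a) = 0" if "f \<in> hom2 (G\<lparr>carrier := H\<rparr>)" for f
      using hom_inv[OF H f[OF that], of a] a that by simp
    then show "inv a \<in> {x \<in> H. \<forall>f\<in>hom2 (G\<lparr>carrier := H\<rparr>). f x = 0}" using Hi a by blast
    fix b assume b: "b \<in> {x \<in> H. \<forall>f\<in>hom2 (G\<lparr>carrier := H\<rparr>). f x = 0}"
    have "f (a \<otimes> b) = 0" if "f \<in> hom2 (G\<lparr>carrier := H\<rparr>)" for f
    proof -
      have "f a = 0" "f b = 0" using a b that by blast+
      then show ?thesis using f[OF that, of a b] a b by simp
    qed
    then show "a \<otimes> b \<in> {x \<in> H. \<forall>f\<in>hom2 (G\<lparr>carrier := H\<rparr>). f x = 0}" using Hm a b by blast
  qed
qed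

text \<open>
The subgroup generated by the squares already contains the common kernel, by \<open>separating_hom2\<close>; commutators are
products of squares.
\<close>
lemma (in group) derived_2_step_eq:
  assumes H: "subgroup H G"
  shows "derived G H <#> generate G {h \<otimes> h | h. h \<in> H}
    = {x \<in> H. \<forall>f\<in>hom2 (G\<lparr>carrier := H\<rparr>). f x = 0}" (is "?D <#> ?Q = ?C")
proof
  have Hc: "H \<subseteq> carrier G" using subgroup.subset[OF H] .
  note Hm = subgroup.m_closed[OF H] and Hi = subgroup.m_inv_closed[OF H]
  have C: "subgroup ?C G" by (rule hom2_kernel_subgroup[OF H])
  have f: "f (x \<otimes> y) = f x + f y" if "f \<in> hom2 (G\<lparr>carrier := H\<rparr>)" "x \<in> H" "y \<in> H" for f x y
    using that by (simp add: hom2_iff)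
  have finv: "f (inv x) = f x" if "f \<in> hom2 (G\<lparr>carrier := H\<rparr>)" "x \<in> H" for f x
    by (rule hom_inv[OF H f[OF that(1)] that(2)])
  have "derived_set G H \<subseteq> ?C"
  proof
    fix z assume "z \<in> derived_set G H"
    then obtain x y where xy: "x \<in> H" "y \<in> H" "z = x \<otimes> y \<otimes> inv x \<otimes> inv y" by blast
    have "f z = 0" if "f \<in> hom2 (G\<lparr>carrier := H\<rparr>)" for f
    proof -
      have "f z = f x + f y + f (inv x) + f (inv y)"
        unfolding xy(3)
        by (simp only: f[OF that] xy(1,2) Hm[OF Hm[OF xy(1,2)] Hi[OF xy(1)]] Hm[OF xy(1,2)] Hi[OF xy(1)] Hi[OF xy(2)])
      also have "\<dots> = (f x + f x) + (f y + f y)"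
        by (simp only: finv[OF that xy(1)] finv[OF that xy(2)] add_ac)
      finally have "f z = (f x + f x) + (f y + f y)" .
      then show ?thesis by simp
    qed
    moreover have "z \<in> H" unfolding xy(3) by (intro Hm Hi xy(1,2))
    ultimately show "z \<in> ?C" by blast
  qed
  then have "?D \<subseteq> ?C" unfolding derived_def by (rule generate_subgroup_incl[OF _ C])
  moreover have "?Q \<subseteq> ?C"
  proof (rule generate_subgroup_incl[OF _ C], rule subsetI)
    fix z assume "z \<in> {h \<otimes> h | h. h \<in> H}"
    then obtain h where h: "h \<in> H" "z = h \<otimes> h" by blast
    have "f z = 0" if "f \<in> hom2 (G\<lparr>carrier := H\<rparr>)" for f using f[OF that h(1) h(1)] h(2) by simp
    moreover have "z \<in> H" unfolding h(2) by (rule Hm[OF h(1) h(1)])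
    ultimately show "z \<in> ?C" by blast
  qed
  ultimately show "?D <#> ?Q \<subseteq> ?C"
  proof -
    assume "?D \<subseteq> ?C" "?Q \<subseteq> ?C"
    then have "x \<otimes> y \<in> ?C" if "x \<in> ?D" "y \<in> ?Q" for x y
      using subgroup.m_closed[OF C, of x y] that by (meson subsetD)
    then show ?thesis unfolding set_mult_def by blast
  qed
  show "?C \<subseteq> ?D <#> ?Q"
  proof
    fix x assume x: "x \<in> ?C"
    interpret H: group "G\<lparr>carrier := H\<rparr>" by (rule subgroup.subgroup_is_group[OF H group_axioms])
    have sq: "{h \<otimes> h | h. h \<in> H} \<subseteq> H" using Hm by blast
    have "x \<in> ?Q"
    proof (rule ccontr)
      assume "x \<notin> ?Q"
      moreover have "subgroup ?Q (G\<lparr>carrier := H\<rparr>)"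
        by (rule subgroup_incl[OF generate_is_subgroup H generate_subgroup_incl[OF sq H]])
          (use sq Hc in blast)
      ultimately have "\<exists>f\<in>hom2 (G\<lparr>carrier := H\<rparr>). (\<forall>k\<in>?Q. f k = 0) \<and> f x = 1"
        using x by (intro H.separating_hom2) (auto intro: generate.incl)
      then show False using x by auto
    qed
    moreover have "\<one> \<in> ?D" unfolding derived_def by (rule generate.one)
    moreover have "x = \<one> \<otimes> x" using x Hc by auto
    ultimately show "x \<in> ?D <#> ?Q" unfolding set_mult_def by blast
  qed
qed

section \<open>Quotient spaces over the field of two elements\<close>
lemma field_residue_ring_2: "field (residue_ring 2)"
  using residues_prime.is_field[of 2] by (simp add: residues_prime_def)

lemma residue_ring_2_simps:
  "carrier (residue_ring 2) = {0, 1}"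
  "x \<oplus>\<^bsub>residue_ring 2\<^esub> y = (x + y) mod 2"
  "x \<otimes>\<^bsub>residue_ring 2\<^esub> y = (x * y) mod 2"
  "\<zero>\<^bsub>residue_ring 2\<^esub> = 0" "\<one>\<^bsub>residue_ring 2\<^esub> = 1"
  by (auto simp: residue_ring_def)

text \<open>
Over a field with two elements the scalar multiplication carries no information beyond \<open>x + x = 0\<close>, so that
submodules of the quotient are just subgroups.
\<close>
locale f2_quotient = abelian_subgroup B M for B and M :: "(int, 'c, 'x) module_scheme" (structure) +
  assumes double: "x \<in> carrier M \<Longrightarrow> x \<oplus> x = \<zero>"
    and smult_zero: "x \<in> carrier M \<Longrightarrow> 0 \<odot> x = \<zero>"
    and smult_one: "x \<in> carrier M \<Longrightarrow> 1 \<odot> x = x"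
begin

abbreviation Q where "Q \<equiv> quotient_module M B"

lemma B_subset: "B \<subseteq> carrier M"
  by (rule a_subset)

lemma zero_B: "\<zero> \<in> B"
  by (rule additive_subgroup.zero_closed[OF is_additive_subgroup])

lemma carrier_Q: "carrier Q = {B +> x | x. x \<in> carrier M}"
  by (auto simp: quotient_module_def A_RCOSETS_def')

lemma coset_in: "x \<in> carrier M \<Longrightarrow> B +> x \<in> carrier Q"
  by (auto simp: carrier_Q)

lemma coset_zero: "B +> \<zero> = B"
  by (rule a_coset_add_zero[OF B_subset])

lemma coset_eqI: "y \<in> B +> x \<Longrightarrow> x \<in> carrier M \<Longrightarrow> B +> y = B +> x"
  using a_repr_independence[OF _ _ a_subgroup] by simp

lemma zero_Q: "\<zero>\<^bsub>Q\<^esub> = B +> \<zero>"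
  by (simp only: coset_zero) (simp add: quotient_module_def)

lemma add_Q: "x \<in> carrier M \<Longrightarrow> y \<in> carrier M \<Longrightarrow> (B +> x) \<oplus>\<^bsub>Q\<^esub> (B +> y) = B +> (x \<oplus> y)"
  by (simp add: quotient_module_def a_rcos_sum)

lemma smult_Q_zero:
  assumes x: "x \<in> carrier M"
  shows "0 \<odot>\<^bsub>Q\<^esub> (B +> x) = B +> \<zero>"
proof -
  have "(\<Union>y\<in>B +> x. B +> (0 \<odot> y)) = (\<Union>y\<in>B +> x. B +> \<zero>)"
    using a_r_coset_subset_G[OF B_subset x] smult_zero by (intro SUP_cong) auto
  then show ?thesis using a_rcos_self[OF x] by (auto simp: quotient_module_def)
qed

lemma smult_Q_one:
  assumes x: "x \<in> carrier M"
  shows "1 \<odot>\<^bsub>Q\<^esub> (B +> x) = B +> x"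
proof -
  have "(\<Union>y\<in>B +> x. B +> (1 \<odot> y)) = (\<Union>y\<in>B +> x. B +> x)"
    using a_r_coset_subset_G[OF B_subset x] smult_one coset_eqI[OF _ x] by (intro SUP_cong) auto
  then show ?thesis using a_rcos_self[OF x] by (auto simp: quotient_module_def)
qed

sublocale vs: vectorspace "residue_ring 2" Q
proof (rule vs_criteria)
  show "field (residue_ring 2)" by (rule field_residue_ring_2)
  show "\<zero>\<^bsub>Q\<^esub> \<in> carrier Q" by (simp add: zero_Q coset_in)
  show "\<forall>v w. v \<in> carrier Q \<and> w \<in> carrier Q \<longrightarrow> v \<oplus>\<^bsub>Q\<^esub> w \<in> carrier Q"
    by (auto simp: carrier_Q add_Q)
  show "\<forall>v\<in>carrier Q. \<exists>neg_v\<in>carrier Q. v \<oplus>\<^bsub>Q\<^esub> neg_v = \<zero>\<^bsub>Q\<^esub>"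
  proof
    fix v assume "v \<in> carrier Q"
    moreover from this have "v \<oplus>\<^bsub>Q\<^esub> v = \<zero>\<^bsub>Q\<^esub>" by (auto simp: carrier_Q add_Q double zero_Q)
    ultimately show "\<exists>neg_v\<in>carrier Q. v \<oplus>\<^bsub>Q\<^esub> neg_v = \<zero>\<^bsub>Q\<^esub>" by blast
  qed
  show "\<forall>c v. c \<in> carrier (residue_ring 2) \<and> v \<in> carrier Q \<longrightarrow> c \<odot>\<^bsub>Q\<^esub> v \<in> carrier Q"
    by (auto simp: carrier_Q residue_ring_2_simps smult_Q_zero smult_Q_one)
  show "\<forall>v w. v \<in> carrier Q \<and> w \<in> carrier Q \<longrightarrow> v \<oplus>\<^bsub>Q\<^esub> w = w \<oplus>\<^bsub>Q\<^esub> v"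
    by (auto simp: carrier_Q add_Q a_comm)
  show "\<forall>v w x. v \<in> carrier Q \<and> w \<in> carrier Q \<and> x \<in> carrier Q \<longrightarrow>
      (v \<oplus>\<^bsub>Q\<^esub> w) \<oplus>\<^bsub>Q\<^esub> x = v \<oplus>\<^bsub>Q\<^esub> (w \<oplus>\<^bsub>Q\<^esub> x)"
    by (auto simp: carrier_Q add_Q a_assoc)
  show "\<forall>v\<in>carrier Q. v \<oplus>\<^bsub>Q\<^esub> \<zero>\<^bsub>Q\<^esub> = v"
    by (auto simp: carrier_Q add_Q zero_Q)
  show "\<forall>a b v. a \<in> carrier (residue_ring 2) \<and> b \<in> carrier (residue_ring 2) \<and> v \<in> carrier Q \<longrightarrow>
      (a \<otimes>\<^bsub>residue_ring 2\<^esub> b) \<odot>\<^bsub>Q\<^esub> v = a \<odot>\<^bsub>Q\<^esub> (b \<odot>\<^bsub>Q\<^esub> v)"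
    by (auto simp: carrier_Q residue_ring_2_simps smult_Q_zero smult_Q_one)
  show "\<forall>v\<in>carrier Q. \<one>\<^bsub>residue_ring 2\<^esub> \<odot>\<^bsub>Q\<^esub> v = v"
    by (auto simp: carrier_Q residue_ring_2_simps smult_Q_one)
  show "\<forall>a b v. a \<in> carrier (residue_ring 2) \<and> b \<in> carrier (residue_ring 2) \<and> v \<in> carrier Q \<longrightarrow>
      (a \<oplus>\<^bsub>residue_ring 2\<^esub> b) \<odot>\<^bsub>Q\<^esub> v = (a \<odot>\<^bsub>Q\<^esub> v) \<oplus>\<^bsub>Q\<^esub> (b \<odot>\<^bsub>Q\<^esub> v)"
    by (auto simp: carrier_Q residue_ring_2_simps smult_Q_zero smult_Q_one add_Q double)
  show "\<forall>a v w. a \<in> carrier (residue_ring 2) \<and> v \<in> carrier Q \<and> w \<in> carrier Q \<longrightarrow>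
      a \<odot>\<^bsub>Q\<^esub> (v \<oplus>\<^bsub>Q\<^esub> w) = (a \<odot>\<^bsub>Q\<^esub> v) \<oplus>\<^bsub>Q\<^esub> (a \<odot>\<^bsub>Q\<^esub> w)"
    by (auto simp: carrier_Q residue_ring_2_simps smult_Q_zero smult_Q_one add_Q double)
qed

lemma submoduleI:
  assumes "W \<subseteq> carrier Q" "B +> \<zero> \<in> W"
    and "\<And>x y. x \<in> carrier M \<Longrightarrow> y \<in> carrier M \<Longrightarrow> B +> x \<in> W \<Longrightarrow> B +> y \<in> W \<Longrightarrow> B +> (x \<oplus> y) \<in> W"
  shows "submodule (residue_ring 2) W Q"
proof (rule submodule.intro)
  show "module (residue_ring 2) Q" by (rule vs.module_axioms)
  show "W \<subseteq> carrier Q" by fact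
  have el: "\<exists>x\<in>carrier M. v = B +> x" if "v \<in> W" for v using that assms(1) by (auto simp: carrier_Q)
  show "v \<oplus>\<^bsub>Q\<^esub> w \<in> W" if vw: "v \<in> W" "w \<in> W" for v w
  proof -
    obtain x y where "x \<in> carrier M" "y \<in> carrier M" "v = B +> x" "w = B +> y" using el vw by blast
    then show ?thesis using assms(3)[of x y] vw by (simp add: add_Q)
  qed
  show "\<zero>\<^bsub>Q\<^esub> \<in> W" using assms(2) by (simp add: zero_Q)
  show "c \<odot>\<^bsub>Q\<^esub> v \<in> W" if cv: "c \<in> carrier (residue_ring 2)" "v \<in> W" for c v
  proof -
    obtain x where "x \<in> carrier M" "v = B +> x" using el cv by blast
    moreover have "c = 0 \<or> c = 1" using cv(1) by (auto simp: residue_ring_def)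
    ultimately show ?thesis using cv(2) assms(2) by (auto simp: smult_Q_zero smult_Q_one)
  qed
qed

text \<open>
Representatives of a generating set of minimal size detect functionals: those functionals that vanish on them
and on \<open>B\<close> vanish everywhere. Together with \<open>dim_le_card\<close> this is the form in which dimensions are used; it
avoids linear combinations.
\<close>
lemma representatives_exist:
  assumes "vs.fin_dim"
  obtains Z where "finite Z" "Z \<subseteq> carrier M" "card Z \<le> vs.dim"
    "\<And>\<phi>. (\<And>x y. x \<in> carrier M \<Longrightarrow> y \<in> carrier M \<Longrightarrow> \<phi> (x \<oplus> y) = \<phi> x + (\<phi> y :: bit)) \<Longrightarrow>
      (\<And>b. b \<in> B \<Longrightarrow> \<phi> b = 0) \<Longrightarrow> (\<And>z. z \<in> Z \<Longrightarrow> \<phi> z = 0) \<Longrightarrow> (\<And>x. x \<in> carrier M \<Longrightarrow> \<phi> x = 0)"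
proof -
  have "\<exists>n A. finite A \<and> card A = n \<and> A \<subseteq> carrier Q \<and> vs.gen_set A"
    using assms unfolding vs.fin_dim_def by blast
  then have "\<exists>A. finite A \<and> card A = vs.dim \<and> A \<subseteq> carrier Q \<and> vs.gen_set A"
    unfolding vs.dim_def by (rule LeastI_ex)
  then obtain A where A: "finite A" "card A = vs.dim" "A \<subseteq> carrier Q" "vs.gen_set A" by blast
  have "\<exists>x\<in>carrier M. X = B +> x" if "X \<in> A" for X using A(3) that by (auto simp: carrier_Q)
  then obtain r where r: "\<And>X. X \<in> A \<Longrightarrow> r X \<in> carrier M \<and> X = B +> r X" by metis
  show thesis
  proof (rule that)
    show "finite (r ` A)" using A(1) by simp
    show "r ` A \<subseteq> carrier M" using r by blast
    show "card (r ` A) \<le> vs.dim" using card_image_le[OF A(1)] A(2) by metis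
    fix \<phi> :: "'c \<Rightarrow> bit" and x
    assume add: "\<And>x y. x \<in> carrier M \<Longrightarrow> y \<in> carrier M \<Longrightarrow> \<phi> (x \<oplus> y) = \<phi> x + \<phi> y"
      and zB: "\<And>b. b \<in> B \<Longrightarrow> \<phi> b = 0" and zZ: "\<And>z. z \<in> r ` A \<Longrightarrow> \<phi> z = 0" and x: "x \<in> carrier M"
    let ?W = "{B +> x | x. x \<in> carrier M \<and> \<phi> x = 0}"
    have co: "\<phi> y = \<phi> z" if y: "y \<in> B +> z" and z: "z \<in> carrier M" for y z
    proof -
      obtain b where "b \<in> B" "y = b \<oplus> z" using y by (auto simp: a_r_coset_def')
      then show ?thesis using add[of b z] zB z B_subset by auto
    qed
    have iff: "B +> y \<in> ?W \<longleftrightarrow> \<phi> y = 0" if y: "y \<in> carrier M" for y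
    proof
      assume "B +> y \<in> ?W"
      then obtain z where z: "B +> y = B +> z" "z \<in> carrier M" "\<phi> z = 0" by blast
      then have "\<phi> y = \<phi> z" using co[of y z] a_rcos_self[OF y] by simp
      then show "\<phi> y = 0" using z(3) by simp
    qed (use y in blast)
    have "submodule (residue_ring 2) ?W Q"
    proof (rule submoduleI)
      show "?W \<subseteq> carrier Q" by (auto simp: carrier_Q)
      show "B +> \<zero> \<in> ?W" using iff[of \<zero>] zB zero_B B_subset by blast
      show "B +> (x \<oplus> y) \<in> ?W" if "x \<in> carrier M" "y \<in> carrier M" "B +> x \<in> ?W" "B +> y \<in> ?W" for x y
      proof -
        have "\<phi> x = 0" "\<phi> y = 0" using that iff by blast+
        then have "\<phi> (x \<oplus> y) = 0" using add[OF that(1,2)] by simp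
        then show ?thesis using iff[OF a_closed[OF that(1,2)]] by blast
      qed
    qed
    moreover have "A \<subseteq> ?W" using r zZ by blast
    ultimately have "vs.span A \<subseteq> ?W" by (intro vs.span_is_subset)
    moreover have "B +> x \<in> vs.span A" unfolding A(4) by (rule coset_in[OF x])
    ultimately have "B +> x \<in> ?W" by (rule subsetD)
    then show "\<phi> x = 0" by (rule iff[OF x, THEN iffD1])
  qed
qed

text \<open>
If the classes of \<open>Z\<close> did not generate, a functional separating their span from some element would not be
detected by \<open>Z\<close>.
\<close>
lemma dim_le_card:
  assumes Z: "finite Z" "Z \<subseteq> carrier M"
    and detect: "\<And>\<phi>. (\<And>x y. x \<in> carrier M \<Longrightarrow> y \<in> carrier M \<Longrightarrow> \<phi> (x \<oplus> y) = \<phi> x + (\<phi> y :: bit)) \<Longrightarrow>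
      (\<And>b. b \<in> B \<Longrightarrow> \<phi> b = 0) \<Longrightarrow> (\<And>z. z \<in> Z \<Longrightarrow> \<phi> z = 0) \<Longrightarrow> (\<And>x. x \<in> carrier M \<Longrightarrow> \<phi> x = 0)"
  shows "vs.dim \<le> card Z"
proof -
  let ?A = "(\<lambda>z. B +> z) ` Z"
  have A: "finite ?A" "?A \<subseteq> carrier Q" using Z coset_in by auto
  interpret W: submodule "residue_ring 2" "vs.span ?A" Q by (rule vs.span_is_submodule[OF A(2)])
  let ?U = "{x \<in> carrier M. B +> x \<in> vs.span ?A}"
  have zero: "\<zero> \<in> ?U" using W.zero_closed by (simp add: zero_Q)
  have U: "subgroup ?U (add_monoid M)"
  proof (rule group.subgroupI[OF a_group])
    show "?U \<subseteq> carrier (add_monoid M)" by auto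
    show "?U \<noteq> {}" using zero by blast
    fix a assume a: "a \<in> ?U"
    have "inv\<^bsub>add_monoid M\<^esub> a = a" by (rule group.inv_equality[OF a_group]) (use a double in simp_all)
    then show "inv\<^bsub>add_monoid M\<^esub> a \<in> ?U" using a by simp
    fix b assume b: "b \<in> ?U"
    have "(B +> a) \<oplus>\<^bsub>Q\<^esub> (B +> b) \<in> vs.span ?A" using a b W.m_closed by blast
    then show "a \<otimes>\<^bsub>add_monoid M\<^esub> b \<in> ?U" using a b by (simp add: add_Q)
  qed
  have "carrier Q \<subseteq> vs.span ?A"
  proof
    fix X assume "X \<in> carrier Q"
    then obtain x where x: "x \<in> carrier M" "X = B +> x" by (auto simp: carrier_Q)
    show "X \<in> vs.span ?A"
    proof (rule ccontr)
      assume "X \<notin> vs.span ?A"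
      then have "x \<notin> ?U" using x by blast
      then have "\<exists>f\<in>hom2 (add_monoid M). (\<forall>k\<in>?U. f k = 0) \<and> f x = 1"
        by (intro group.separating_hom2[OF a_group U]) (use x(1) double zero in simp_all)
      then obtain f where f: "f \<in> hom2 (add_monoid M)" "\<And>k. k \<in> ?U \<Longrightarrow> f k = 0" "f x = 1" by blast
      have "f x = 0"
      proof (rule detect[OF _ _ _ x(1)])
        show "f (x \<oplus> y) = f x + f y" if "x \<in> carrier M" "y \<in> carrier M" for x y
          using f(1) that by (simp add: hom2_iff)
        show "f b = 0" if "b \<in> B" for b
        proof (rule f(2))
          have "B +> b = B +> \<zero>" using that B_subset a_coset_join2[OF _ a_subgroup] coset_zero by auto
          then show "b \<in> ?U" using zero that B_subset by auto
        qed
        show "f z = 0" if "z \<in> Z" for z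
          using f(2)[of z] vs.in_own_span[OF A(2)] that Z(2) by blast
      qed
      then show False using f(3) by simp
    qed
  qed
  then have "vs.gen_set ?A" using W.subset by blast
  then have "vs.dim \<le> card ?A" unfolding vs.dim_def using A by (intro Least_le) blast
  also have "\<dots> \<le> card Z" by (rule card_image_le[OF Z(1)])
  finally show ?thesis .
qed

end

section \<open>The bar complex modulo two\<close>

text \<open>
Cycles are characterised by \<open>cycles_Suc\<close> below, in terms of explicit boundaries.
\<close>
declare bar_cycles.simps [simp del]

lemma of_int_mod_2_bit: "(of_int (a mod 2) :: bit) = of_int a"
proof -
  have "(of_int a :: bit) = of_int (2 * (a div 2) + a mod 2)" by simp
  also have "\<dots> = of_int (a mod 2)" unfolding of_int_add of_int_mult by simp
  finally show ?thesis ..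
qed

lemma of_int_bit_inj:
  assumes "a \<in> {0, 1}" "b \<in> {0, 1}" "(of_int a :: bit) = of_int b"
  shows "a = b"
  using assms by auto

lemma residues_2: "residues 2"
  by unfold_locales simp

lemma finsum_residue_ring_2:
  assumes "finite A" "f \<in> A \<rightarrow> {0, 1}"
  shows "finsum (residue_ring 2) f A \<in> {0, 1}"
    "(of_int (finsum (residue_ring 2) f A) :: bit) = (\<Sum>x\<in>A. of_int (f x))"
proof -
  have am: "abelian_monoid (residue_ring 2)"
    using residues.abelian_group[OF residues_2] by (rule abelian_group.axioms(1))
  have "finsum (residue_ring 2) f A \<in> {0, 1} \<and>
    (of_int (finsum (residue_ring 2) f A) :: bit) = (\<Sum>x\<in>A. of_int (f x))"
    using assms
  proof (induction A rule: finite_induct)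
    case empty
    then show ?case by (simp add: abelian_monoid.finsum_empty[OF am] residue_ring_2_simps)
  next
    case (insert x A)
    have "finsum (residue_ring 2) f (insert x A) = f x \<oplus>\<^bsub>residue_ring 2\<^esub> finsum (residue_ring 2) f A"
      by (rule abelian_monoid.finsum_insert[OF am insert.hyps(1,2)])
        (use insert.prems in \<open>auto simp: residue_ring_2_simps\<close>)
    then have *: "finsum (residue_ring 2) f (insert x A) = (f x + finsum (residue_ring 2) f A) mod 2"
      by (simp add: residue_ring_2_simps)
    have "(f x + finsum (residue_ring 2) f A) mod 2 \<in> {0, 1}" by auto
    moreover have "(of_int ((f x + finsum (residue_ring 2) f A) mod 2) :: bit) = (\<Sum>x\<in>insert x A. of_int (f x))"
      using insert.IH insert.prems insert.hyps by (simp add: of_int_mod_2_bit)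
    ultimately show ?case by (simp only: *)
  qed
  then show "finsum (residue_ring 2) f A \<in> {0, 1}"
    "(of_int (finsum (residue_ring 2) f A) :: bit) = (\<Sum>x\<in>A. of_int (f x))" by blast+
qed

text \<open>
Evaluation of a cochain on a chain modulo two. Chains have coefficients in \<open>{0, 1}\<close>, so they are determined by
their supports.
\<close>
definition pair :: "('a list \<Rightarrow> bit) \<Rightarrow> ('a list \<Rightarrow> int) \<Rightarrow> bit"
  where "pair u c = (\<Sum>x | c x \<noteq> 0. u x)"

definition single :: "'a list \<Rightarrow> 'a list \<Rightarrow> int"
  where "single x y = of_bool (y = x)"

definition cobd :: "('a, 'b) monoid_scheme \<Rightarrow> ('a list \<Rightarrow> bit) \<Rightarrow> 'a list \<Rightarrow> bit"
  where "cobd G u x = (\<Sum>i\<le>length x. u (bar_face G i x))"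

lemma pair_single [simp]: "pair u (single x) = u x"
proof -
  have "{y. single x y \<noteq> 0} = {x}" by (auto simp: single_def)
  then show ?thesis by (simp add: pair_def)
qed

lemma pair_eq:
  assumes "finite F" "{x. c x \<noteq> 0} \<subseteq> F" "range c \<subseteq> {0, 1}"
  shows "pair u c = (\<Sum>x\<in>F. u x * of_int (c x))"
  unfolding pair_def
proof (rule sum.mono_neutral_cong_left[OF assms(1,2)])
  show "\<forall>i\<in>F - {x. c x \<noteq> 0}. u i * of_int (c i) = 0" by simp
  fix x assume "x \<in> {x. c x \<noteq> 0}"
  then have "c x = 1" using assms(3) by blast
  then show "u x = u x * of_int (c x)" by simp
qed

context group
begin

abbreviation ch :: "nat \<Rightarrow> (int, 'a list \<Rightarrow> int) module"
  where "ch n \<equiv> bar_chains (residue_ring 2) G n"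

abbreviation bnd :: "('a list \<Rightarrow> int) \<Rightarrow> 'a list \<Rightarrow> int"
  where "bnd \<equiv> bar_boundary (residue_ring 2) G"

definition simplices :: "nat \<Rightarrow> 'a list set"
  where "simplices n = {x. length x = n \<and> set x \<subseteq> carrier G}"

lemma ch_iff: "c \<in> carrier (ch n) \<longleftrightarrow>
    range c \<subseteq> {0, 1} \<and> finite {x. c x \<noteq> 0} \<and> {x. c x \<noteq> 0} \<subseteq> simplices n"
  by (simp add: bar_chains_def residue_ring_2_simps simplices_def)

lemma chD: "c \<in> carrier (ch n) \<Longrightarrow> range c \<subseteq> {0, 1}" "c \<in> carrier (ch n) \<Longrightarrow> finite {x. c x \<noteq> 0}"
  "c \<in> carrier (ch n) \<Longrightarrow> c x \<noteq> 0 \<Longrightarrow> x \<in> simplices n"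
  by (auto simp: ch_iff)

lemma ch_add: "c \<oplus>\<^bsub>ch n\<^esub> d = (\<lambda>x. (c x + d x) mod 2)"
  by (simp add: bar_chains_def residue_ring_2_simps)

lemma ch_zero: "\<zero>\<^bsub>ch n\<^esub> = (\<lambda>x. 0)"
  by (simp add: bar_chains_def residue_ring_2_simps)

lemma ch_smult: "r \<odot>\<^bsub>ch n\<^esub> c = (\<lambda>x. (r * c x) mod 2)"
  by (simp add: bar_chains_def residue_ring_2_simps)

lemma single_ch: "x \<in> simplices n \<Longrightarrow> single x \<in> carrier (ch n)"
proof -
  have "{y. single x y \<noteq> 0} = {x}" by (auto simp: single_def)
  then show "x \<in> simplices n \<Longrightarrow> single x \<in> carrier (ch n)"
    unfolding ch_iff by (auto simp: single_def)
qed

lemma zero_ch: "(\<lambda>x. 0) \<in> carrier (ch n)"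
  by (auto simp: ch_iff)

lemma add_ch:
  assumes "c \<in> carrier (ch n)" "d \<in> carrier (ch n)"
  shows "c \<oplus>\<^bsub>ch n\<^esub> d \<in> carrier (ch n)"
proof -
  have sub: "{x. (c x + d x) mod 2 \<noteq> 0} \<subseteq> {x. c x \<noteq> 0} \<union> {x. d x \<noteq> 0}" by auto
  moreover have "finite ({x. c x \<noteq> 0} \<union> {x. d x \<noteq> 0})" using assms chD(2) by simp
  moreover have "{x. c x \<noteq> 0} \<union> {x. d x \<noteq> 0} \<subseteq> simplices n" using assms by (simp add: ch_iff)
  moreover have "range (\<lambda>x. (c x + d x) mod 2) \<subseteq> {0, 1}" by auto
  ultimately show ?thesis unfolding ch_add ch_iff by (meson finite_subset order_trans)
qed

lemma pair_zero: "pair u (\<lambda>x. 0) = 0"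
  by (simp add: pair_def)

lemma pair_add:
  assumes c: "c \<in> carrier (ch n)" and d: "d \<in> carrier (ch n)"
  shows "pair u (c \<oplus>\<^bsub>ch n\<^esub> d) = pair u c + pair u d"
proof -
  let ?F = "{x. c x \<noteq> 0} \<union> {x. d x \<noteq> 0}"
  have F: "finite ?F" using c d chD(2) by simp
  have "pair u (c \<oplus>\<^bsub>ch n\<^esub> d) = (\<Sum>x\<in>?F. u x * of_int ((c x + d x) mod 2))"
    unfolding ch_add by (rule pair_eq[OF F]) auto
  also have "\<dots> = (\<Sum>x\<in>?F. u x * of_int (c x)) + (\<Sum>x\<in>?F. u x * of_int (d x))"
    by (simp add: of_int_mod_2_bit distrib_left sum.distrib)
  also have "\<dots> = pair u c + pair u d"
    using pair_eq[OF F _ chD(1)[OF c]] pair_eq[OF F _ chD(1)[OF d]] by simp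
  finally show ?thesis .
qed

text \<open>
Chains are separated by cochains. This reduces identities for the boundary, whose definition is a sum in a
residue ring, to identities for the coboundary.
\<close>
lemma ch_eqI:
  assumes c: "c \<in> carrier (ch n)" and d: "d \<in> carrier (ch n)" and eq: "\<And>u. pair u c = pair u d"
  shows "c = d"
proof
  fix y
  have val: "pair (\<lambda>x. of_bool (x = y)) e = of_int (e y)" if e: "e \<in> carrier (ch n)" for e
  proof -
    have "pair (\<lambda>x. of_bool (x = y)) e = (\<Sum>x\<in>insert y {x. e x \<noteq> 0}. of_bool (x = y) * of_int (e x))"
      by (rule pair_eq) (use e chD in auto)
    also have "\<dots> = (\<Sum>x\<in>insert y {x. e x \<noteq> 0}. if x = y then of_int (e y) else 0)"
      by (rule sum.cong) auto
    also have "\<dots> = of_int (e y)" using chD(2)[OF e] by (subst sum.delta) auto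
    finally show ?thesis .
  qed
  have "c y \<in> {0, 1}" "d y \<in> {0, 1}" using chD(1)[OF c] chD(1)[OF d] by blast+
  then show "c y = d y"
    by (rule of_int_bit_inj) (simp only: val[OF c, symmetric] val[OF d, symmetric] eq)
qed

lemma add_self_ch: "c \<oplus>\<^bsub>ch n\<^esub> c = \<zero>\<^bsub>ch n\<^esub>"
  unfolding ch_add ch_zero by (intro ext) presburger

lemma abelian_group_ch: "abelian_group (ch n)"
proof (rule abelian_groupI)
  fix x y z assume xyz: "x \<in> carrier (ch n)" "y \<in> carrier (ch n)" "z \<in> carrier (ch n)"
  show "(x \<oplus>\<^bsub>ch n\<^esub> y) \<oplus>\<^bsub>ch n\<^esub> z = x \<oplus>\<^bsub>ch n\<^esub> (y \<oplus>\<^bsub>ch n\<^esub> z)"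
    unfolding ch_add by (simp add: mod_add_left_eq mod_add_right_eq add.assoc)
next
  fix x y assume xy: "x \<in> carrier (ch n)" "y \<in> carrier (ch n)"
  show "x \<oplus>\<^bsub>ch n\<^esub> y \<in> carrier (ch n)" by (rule add_ch[OF xy])
  show "x \<oplus>\<^bsub>ch n\<^esub> y = y \<oplus>\<^bsub>ch n\<^esub> x" by (simp add: ch_add add.commute)
next
  show "\<zero>\<^bsub>ch n\<^esub> \<in> carrier (ch n)" unfolding ch_zero by (rule zero_ch)
next
  fix x assume x: "x \<in> carrier (ch n)"
  have "x i mod 2 = x i" for i
  proof -
    have "x i \<in> {0, 1}" using chD(1)[OF x] by blast
    then show ?thesis by auto
  qed
  then show "\<zero>\<^bsub>ch n\<^esub> \<oplus>\<^bsub>ch n\<^esub> x = x" by (simp add: ch_add ch_zero)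
  show "\<exists>y\<in>carrier (ch n). y \<oplus>\<^bsub>ch n\<^esub> x = \<zero>\<^bsub>ch n\<^esub>" using add_self_ch x by blast
qed

lemma bar_face_simplex:
  assumes x: "x \<in> simplices (Suc n)" and i: "i \<le> length x"
  shows "bar_face G i x \<in> simplices n"
proof -
  have len: "length x = Suc n" and sub: "set x \<subseteq> carrier G" using x by (auto simp: simplices_def)
  consider "i = 0" | "i \<noteq> 0" "i = length x" | "i \<noteq> 0" "i < length x" using i by linarith
  then show ?thesis
  proof cases
    case 1
    then show ?thesis using len sub by (cases x) (auto simp: bar_face_def simplices_def)
  next
    case 2
    then show ?thesis using len sub by (auto simp: bar_face_def simplices_def dest: in_set_butlastD)
  next
    case 3
    then have "x ! (i - 1) \<otimes> x ! i \<in> carrier G" using sub by (intro m_closed) auto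
    then show ?thesis
      using 3 len sub by (auto simp: bar_face_def simplices_def dest: in_set_takeD in_set_dropD)
  qed
qed

lemma bnd_bit:
  assumes c: "range c \<subseteq> {0, 1}" "finite {x. c x \<noteq> 0}"
  shows "bnd c y \<in> {0, 1}"
    "(of_int (bnd c y) :: bit) = (\<Sum>x | c x \<noteq> 0. \<Sum>i\<le>length x. of_bool (bar_face G i x = y))"
proof -
  let ?t = "\<lambda>x i. if bar_face G i x = y then (if even i then c x else \<ominus>\<^bsub>residue_ring 2\<^esub> c x)
    else \<zero>\<^bsub>residue_ring 2\<^esub>"
  have t: "?t x i \<in> {0, 1}" "c x \<noteq> 0 \<Longrightarrow> (of_int (?t x i) :: bit) = of_bool (bar_face G i x = y)" for x i
  proof -
    have cx: "c x \<in> {0, 1}" using c(1) by blast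
    then show "?t x i \<in> {0, 1}"
      using residues.res_neg_eq[OF residues_2] by (auto simp: residue_ring_2_simps)
    show "c x \<noteq> 0 \<Longrightarrow> (of_int (?t x i) :: bit) = of_bool (bar_face G i x = y)"
      using cx residues.res_neg_eq[OF residues_2] by (auto simp: residue_ring_2_simps)
  qed
  note inner = finsum_residue_ring_2[of "{..length x}" "?t x" for x]
  have i1: "finsum (residue_ring 2) (?t x) {..length x} \<in> {0, 1}" for x
    by (rule inner(1)) (use t(1) in auto)
  have i2: "(of_int (finsum (residue_ring 2) (?t x) {..length x}) :: bit)
      = (\<Sum>i\<le>length x. of_bool (bar_face G i x = y))" if "c x \<noteq> 0" for x
  proof -
    have "(of_int (finsum (residue_ring 2) (?t x) {..length x}) :: bit) = (\<Sum>i\<le>length x. of_int (?t x i))"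
      by (rule inner(2)) (use t(1) in auto)
    also have "\<dots> = (\<Sum>i\<le>length x. of_bool (bar_face G i x = y))"
      by (rule sum.cong[OF refl t(2)[OF that]])
    finally show ?thesis .
  qed
  have bnd: "bnd c y = finsum (residue_ring 2) (\<lambda>x. finsum (residue_ring 2) (?t x) {..length x}) {x. c x \<noteq> 0}"
    by (simp add: bar_boundary_def residue_ring_2_simps)
  show "bnd c y \<in> {0, 1}"
    unfolding bnd by (rule finsum_residue_ring_2(1)[OF c(2)]) (use i1 in auto)
  have "(of_int (bnd c y) :: bit) = (\<Sum>x | c x \<noteq> 0. of_int (finsum (residue_ring 2) (?t x) {..length x}))"
    unfolding bnd by (rule finsum_residue_ring_2(2)[OF c(2)]) (use i1 in auto)
  also have "\<dots> = (\<Sum>x | c x \<noteq> 0. \<Sum>i\<le>length x. of_bool (bar_face G i x = y))"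
    by (rule sum.cong[OF refl]) (simp add: i2)
  finally show "(of_int (bnd c y) :: bit) = (\<Sum>x | c x \<noteq> 0. \<Sum>i\<le>length x. of_bool (bar_face G i x = y))" .
qed

definition faces :: "('a list \<Rightarrow> int) \<Rightarrow> 'a list set"
  where "faces c = (\<Union>x\<in>{x. c x \<noteq> 0}. (\<lambda>i. bar_face G i x) ` {..length x})"

lemma bnd_support:
  assumes c: "c \<in> carrier (ch n)"
  shows "finite (faces c)" "{y. bnd c y \<noteq> 0} \<subseteq> faces c"
proof -
  show "finite (faces c)" unfolding faces_def using chD(2)[OF c] by auto
  show "{y. bnd c y \<noteq> 0} \<subseteq> faces c"
  proof
    fix y assume y: "y \<in> {y. bnd c y \<noteq> 0}"
    show "y \<in> faces c"
    proof (rule ccontr)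
      assume "y \<notin> faces c"
      then have no: "bar_face G i x \<noteq> y" if "c x \<noteq> 0" "i \<le> length x" for x i
        using that unfolding faces_def by blast
      have "(\<Sum>x | c x \<noteq> 0. \<Sum>i\<le>length x. of_bool (bar_face G i x = y) :: bit) = 0"
        by (intro sum.neutral ballI) (simp add: no)
      then have "(of_int (bnd c y) :: bit) = 0" by (simp only: bnd_bit(2)[OF chD(1,2)[OF c]])
      moreover have "bnd c y \<in> {0, 1}" by (rule bnd_bit(1)[OF chD(1,2)[OF c]])
      ultimately show False using y by auto
    qed
  qed
qed

lemma bnd_ch:
  assumes c: "c \<in> carrier (ch (Suc n))"
  shows "bnd c \<in> carrier (ch n)"
proof -
  have "faces c \<subseteq> simplices n"
    unfolding faces_def using chD(3)[OF c] bar_face_simplex by auto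
  moreover have "range (bnd c) \<subseteq> {0, 1}" using bnd_bit(1)[OF chD(1,2)[OF c]] by blast
  ultimately show ?thesis
    unfolding ch_iff using bnd_support[OF c] finite_subset by blast
qed

lemma pair_bnd:
  assumes c: "c \<in> carrier (ch (Suc n))"
  shows "pair u (bnd c) = pair (cobd G u) c"
proof -
  note fin = bnd_support[OF c]
  have "pair u (bnd c) = (\<Sum>y\<in>faces c. u y * of_int (bnd c y))"
    by (rule pair_eq[OF fin chD(1)[OF bnd_ch[OF c]]])
  also have "\<dots> = (\<Sum>y\<in>faces c. \<Sum>x | c x \<noteq> 0. \<Sum>i\<le>length x. u y * of_bool (bar_face G i x = y))"
    unfolding bnd_bit(2)[OF chD(1,2)[OF c]] by (simp only: sum_distrib_left)
  also have "\<dots> = (\<Sum>x | c x \<noteq> 0. \<Sum>y\<in>faces c. \<Sum>i\<le>length x. u y * of_bool (bar_face G i x = y))"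
    by (rule sum.swap)
  also have "\<dots> = (\<Sum>x | c x \<noteq> 0. \<Sum>i\<le>length x. \<Sum>y\<in>faces c. u y * of_bool (bar_face G i x = y))"
    by (intro sum.cong refl sum.swap)
  also have "\<dots> = (\<Sum>x | c x \<noteq> 0. \<Sum>i\<le>length x. u (bar_face G i x))"
  proof (intro sum.cong refl)
    fix x i assume xi: "x \<in> {x. c x \<noteq> 0}" "i \<in> {..length x}"
    have "(\<Sum>y\<in>faces c. u y * of_bool (bar_face G i x = y))
        = (\<Sum>y\<in>faces c. if y = bar_face G i x then u (bar_face G i x) else 0)"
      by (rule sum.cong) auto
    also have "\<dots> = u (bar_face G i x)"
      using xi fin(1) by (subst sum.delta) (auto simp: faces_def)
    finally show "(\<Sum>y\<in>faces c. u y * of_bool (bar_face G i x = y)) = u (bar_face G i x)" .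
  qed
  finally show ?thesis by (simp add: pair_def cobd_def)
qed

lemma cobd_1: "cobd G u [a] = 0"
  by (simp add: cobd_def bar_face_def)

lemma cobd_2: "cobd G u [a, b] = u [b] + u [a \<otimes> b] + u [a]"
proof -
  have "{..length [a, b]} = {0, 1, 2}" by auto
  then show ?thesis by (simp add: cobd_def bar_face_def add.assoc)
qed

lemma cobd_3: "cobd G u [a, b, c] = u [b, c] + u [a \<otimes> b, c] + u [a, b \<otimes> c] + u [a, b]"
proof -
  have "{..length [a, b, c]} = {0, 1, 2, 3}" by auto
  then show ?thesis by (simp add: cobd_def bar_face_def add.assoc)
qed

lemma simplices_1: "x \<in> simplices 1 \<longleftrightarrow> (\<exists>a\<in>carrier G. x = [a])"
  by (auto simp: simplices_def length_Suc_conv)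

lemma simplices_2: "x \<in> simplices 2 \<longleftrightarrow> (\<exists>a\<in>carrier G. \<exists>b\<in>carrier G. x = [a, b])"
  by (auto simp: simplices_def length_Suc_conv numeral_2_eq_2)

lemma simplices_3: "x \<in> simplices 3 \<longleftrightarrow>
    (\<exists>a\<in>carrier G. \<exists>b\<in>carrier G. \<exists>c\<in>carrier G. x = [a, b, c])"
  by (auto simp: simplices_def length_Suc_conv numeral_3_eq_3)

lemma pair_vanish: "c \<in> carrier (ch n) \<Longrightarrow> (\<And>x. x \<in> simplices n \<Longrightarrow> u x = 0) \<Longrightarrow> pair u c = 0"
  unfolding pair_def by (rule sum.neutral) (use chD(3) in blast)

lemma bnd_add:
  assumes c: "c \<in> carrier (ch (Suc n))" and d: "d \<in> carrier (ch (Suc n))"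
  shows "bnd (c \<oplus>\<^bsub>ch (Suc n)\<^esub> d) = bnd c \<oplus>\<^bsub>ch n\<^esub> bnd d"
  by (rule ch_eqI[OF bnd_ch[OF add_ch[OF c d]] add_ch[OF bnd_ch[OF c] bnd_ch[OF d]]])
    (simp only: pair_bnd[OF add_ch[OF c d]] pair_add[OF c d] pair_add[OF bnd_ch[OF c] bnd_ch[OF d]]
      pair_bnd[OF c] pair_bnd[OF d])

lemma bnd_zero: "bnd (\<lambda>x. 0) = (\<lambda>x. 0)"
proof -
  have "bnd (\<lambda>x. 0) \<in> carrier (ch 0)" by (rule bnd_ch[OF zero_ch])
  then show ?thesis
    by (rule ch_eqI[OF _ zero_ch]) (simp only: pair_bnd[OF zero_ch] pair_zero)
qed

lemma cycles_Suc: "bar_cycles (residue_ring 2) G (Suc n) = {c \<in> carrier (ch (Suc n)). bnd c = (\<lambda>x. 0)}"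
  by (simp add: bar_cycles.simps a_kernel_def' ch_zero)

lemma bnd_single_pair:
  assumes "a \<in> carrier G" "b \<in> carrier G"
  shows "bnd (single [a, b]) = single [b] \<oplus>\<^bsub>ch 1\<^esub> single [a \<otimes> b] \<oplus>\<^bsub>ch 1\<^esub> single [a]"
proof -
  have s: "single [b] \<in> carrier (ch 1)" "single [a \<otimes> b] \<in> carrier (ch 1)" "single [a] \<in> carrier (ch 1)"
    "single [a, b] \<in> carrier (ch (Suc 1))"
    using assms by (auto intro!: single_ch simp: simplices_def)
  show ?thesis
    by (rule ch_eqI[OF bnd_ch[OF s(4)]])
      (use s in \<open>simp_all add: add_ch pair_add pair_bnd[OF s(4)] cobd_2 del: One_nat_def\<close>)
qed

text \<open>
The hypothesis is the cochain form of the fact that boundaries are cycles.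
\<close>
lemma f2_quotient_homology:
  assumes sq: "\<And>u x. x \<in> simplices (Suc (Suc k)) \<Longrightarrow> cobd G (cobd G u) x = 0"
  shows "f2_quotient (bar_boundaries (residue_ring 2) G (Suc k))
    (ch (Suc k)\<lparr>carrier := bar_cycles (residue_ring 2) G (Suc k)\<rparr>)"
proof -
  let ?Z = "bar_cycles (residue_ring 2) G (Suc k)" and ?B = "bar_boundaries (residue_ring 2) G (Suc k)"
  let ?M = "ch (Suc k)\<lparr>carrier := ?Z\<rparr>"
  have add: "c \<oplus>\<^bsub>ch (Suc k)\<^esub> d \<in> ?Z" if "c \<in> ?Z" "d \<in> ?Z" for c d
  proof -
    have "(\<lambda>x. 0) \<oplus>\<^bsub>ch k\<^esub> (\<lambda>x. 0) = (\<lambda>x. 0)" by (simp add: ch_add)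
    then show ?thesis using that bnd_add[of c k d] add_ch[of c "Suc k" d] by (simp add: cycles_Suc)
  qed
  have zero: "(\<lambda>x. 0) \<in> ?Z" by (simp add: cycles_Suc zero_ch bnd_zero)
  have sub: "c \<in> carrier (ch (Suc k))" if "c \<in> ?Z" for c using that by (simp add: cycles_Suc)
  note ch = abelian_group_ch[of "Suc k"]
  have M: "abelian_group ?M"
  proof (rule abelian_groupI)
    fix x y z assume "x \<in> carrier ?M" "y \<in> carrier ?M" "z \<in> carrier ?M"
    then have xyz: "x \<in> carrier (ch (Suc k))" "y \<in> carrier (ch (Suc k))" "z \<in> carrier (ch (Suc k))"
      using sub by simp_all
    show "x \<oplus>\<^bsub>?M\<^esub> y \<oplus>\<^bsub>?M\<^esub> z = x \<oplus>\<^bsub>?M\<^esub> (y \<oplus>\<^bsub>?M\<^esub> z)"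
      using abelian_monoid.a_assoc[OF abelian_group.axioms(1)[OF ch] xyz] by simp
  next
    fix x y assume "x \<in> carrier ?M" "y \<in> carrier ?M"
    then have xy: "x \<in> ?Z" "y \<in> ?Z" by simp_all
    show "x \<oplus>\<^bsub>?M\<^esub> y \<in> carrier ?M" using add[OF xy] by simp
    show "x \<oplus>\<^bsub>?M\<^esub> y = y \<oplus>\<^bsub>?M\<^esub> x"
      using abelian_monoid.a_comm[OF abelian_group.axioms(1)[OF ch] sub[OF xy(1)] sub[OF xy(2)]] by simp
  next
    show "\<zero>\<^bsub>?M\<^esub> \<in> carrier ?M" using zero by (simp add: ch_zero)
    fix x assume "x \<in> carrier ?M"
    then have x: "x \<in> ?Z" by simp
    show "\<zero>\<^bsub>?M\<^esub> \<oplus>\<^bsub>?M\<^esub> x = x"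
      using abelian_monoid.l_zero[OF abelian_group.axioms(1)[OF ch] sub[OF x]] by simp
    show "\<exists>y\<in>carrier ?M. y \<oplus>\<^bsub>?M\<^esub> x = \<zero>\<^bsub>?M\<^esub>"
      by (rule bexI[of _ x]) (use x add_self_ch in simp_all)
  qed
  have BZ: "?B \<subseteq> ?Z"
  proof
    fix b assume "b \<in> ?B"
    then obtain c where c: "c \<in> carrier (ch (Suc (Suc k)))" "b = bnd c" by (auto simp: bar_boundaries_def)
    note b = bnd_ch[OF c(1)]
    have "bnd (bnd c) = (\<lambda>x. 0)"
      by (rule ch_eqI[OF bnd_ch[OF b] zero_ch])
        (simp only: pair_bnd[OF b] pair_bnd[OF c(1)] pair_zero pair_vanish[OF c(1) sq])
    then show "b \<in> ?Z" using b c(2) by (simp add: cycles_Suc)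
  qed
  have "subgroup ?B (add_monoid ?M)"
  proof (rule group.subgroupI[OF abelian_group.a_group[OF M]])
    show "?B \<subseteq> carrier (add_monoid ?M)" using BZ by simp
    show "?B \<noteq> {}" using zero_ch by (auto simp: bar_boundaries_def)
    fix a assume a: "a \<in> ?B"
    have "inv\<^bsub>add_monoid ?M\<^esub> a = a"
      by (rule group.inv_equality[OF abelian_group.a_group[OF M]]) (use a BZ add_self_ch in auto)
    then show "inv\<^bsub>add_monoid ?M\<^esub> a \<in> ?B" using a by simp
    fix b assume b: "b \<in> ?B"
    obtain c d where "c \<in> carrier (ch (Suc (Suc k)))" "a = bnd c" "d \<in> carrier (ch (Suc (Suc k)))" "b = bnd d"
      using a b by (auto simp: bar_boundaries_def)
    then have "a \<oplus>\<^bsub>ch (Suc k)\<^esub> b = bnd (c \<oplus>\<^bsub>ch (Suc (Suc k))\<^esub> d)"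
      "c \<oplus>\<^bsub>ch (Suc (Suc k))\<^esub> d \<in> carrier (ch (Suc (Suc k)))"
      by (simp_all add: bnd_add add_ch)
    then show "a \<otimes>\<^bsub>add_monoid ?M\<^esub> b \<in> ?B" by (auto simp: bar_boundaries_def)
  qed
  then have "abelian_subgroup ?B ?M"
    by (intro abelian_subgroupI3 additive_subgroupI M)
  moreover have "f2_quotient_axioms ?M"
  proof
    fix x assume "x \<in> carrier ?M"
    then have x: "x \<in> carrier (ch (Suc k))" using sub by simp
    show "x \<oplus>\<^bsub>?M\<^esub> x = \<zero>\<^bsub>?M\<^esub>" using add_self_ch by simp
    show "0 \<odot>\<^bsub>?M\<^esub> x = \<zero>\<^bsub>?M\<^esub>" by (simp add: ch_smult ch_zero)
    have "x i mod 2 = x i" for i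
    proof -
      have "x i \<in> {0, 1}" using chD(1)[OF x] by blast
      then show ?thesis by auto
    qed
    then show "1 \<odot>\<^bsub>?M\<^esub> x = x" by (simp add: ch_smult)
  qed
  ultimately show ?thesis by (rule f2_quotient.intro)
qed

end

context group
begin

section \<open>Betti numbers and low-dimensional cohomology\<close>
lemma f2_quotient_H1: "f2_quotient (bar_boundaries (residue_ring 2) G 1)
    (ch 1\<lparr>carrier := bar_cycles (residue_ring 2) G 1\<rparr>)"
proof -
  have "cobd G (cobd G u) x = 0" if "x \<in> simplices (Suc (Suc 0))" for u x
    using that simplices_2 by (auto simp: cobd_1 cobd_2 numeral_2_eq_2)
  then show ?thesis using f2_quotient_homology[of 0] by simp
qed

lemma f2_quotient_H2: "f2_quotient (bar_boundaries (residue_ring 2) G 2)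
    (ch 2\<lparr>carrier := bar_cycles (residue_ring 2) G 2\<rparr>)"
proof -
  have eq: "cobd G (cobd G u) [a, b, c] = 0"
    if "a \<in> carrier G" "b \<in> carrier G" "c \<in> carrier G" for u a b c
  proof -
    have "cobd G (cobd G u) [a, b, c] = (u [c] + u [c]) + (u [b] + u [b]) + (u [a] + u [a])
      + (u [a \<otimes> b] + u [a \<otimes> b]) + (u [b \<otimes> c] + u [b \<otimes> c])
      + (u [a \<otimes> (b \<otimes> c)] + u [a \<otimes> (b \<otimes> c)])"
      using that by (simp only: cobd_3 cobd_2 m_assoc add_ac)
    then show ?thesis by simp
  qed
  have "cobd G (cobd G u) x = 0" if x: "x \<in> simplices (Suc (Suc 1))" for u x
  proof -
    have "x \<in> simplices 3" using x by (simp add: numeral_3_eq_3)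
    then obtain a b c where "a \<in> carrier G" "b \<in> carrier G" "c \<in> carrier G" "x = [a, b, c]"
      unfolding simplices_3 by blast
    then show ?thesis using eq by simp
  qed
  then show ?thesis using f2_quotient_homology[of 1] by (simp add: numeral_2_eq_2)
qed

lemma cycles_1: "bar_cycles (residue_ring 2) G 1 = carrier (ch 1)"
proof -
  have "bnd c = (\<lambda>x. 0)" if c: "c \<in> carrier (ch (Suc 0))" for c
    by (rule ch_eqI[OF bnd_ch[OF c] zero_ch])
      (use simplices_1 in \<open>auto simp: pair_bnd[OF c] pair_zero cobd_1 intro!: pair_vanish[OF c]\<close>)
  then show ?thesis using cycles_Suc[of 0] by auto
qed

definition lift1 :: "('a \<Rightarrow> bit) \<Rightarrow> 'a list \<Rightarrow> bit" where "lift1 f x = f (x ! 0)"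
definition lift2 :: "('a \<Rightarrow> 'a \<Rightarrow> bit) \<Rightarrow> 'a list \<Rightarrow> bit" where "lift2 f x = f (x ! 0) (x ! 1)"

lemma pair_lift1_boundary:
  assumes f: "f \<in> hom2 G" and b: "b \<in> bar_boundaries (residue_ring 2) G 1"
  shows "pair (lift1 f) b = 0"
proof -
  obtain c where c: "c \<in> carrier (ch (Suc 1))" "b = bnd c" using b by (auto simp: bar_boundaries_def)
  have "pair (cobd G (lift1 f)) c = 0"
  proof (rule pair_vanish[OF c(1)])
    fix x assume "x \<in> simplices (Suc 1)"
    then obtain a b where ab: "a \<in> carrier G" "b \<in> carrier G" "x = [a, b]"
      using simplices_2[of x] by (auto simp: numeral_2_eq_2)
    then have "cobd G (lift1 f) x = f b + (f a + f b) + f a"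
      using f by (simp add: cobd_2 lift1_def hom2_iff)
    also have "\<dots> = (f a + f a) + (f b + f b)" by (simp only: add_ac)
    finally show "cobd G (lift1 f) x = 0" by simp
  qed
  then show ?thesis unfolding c(2) pair_bnd[OF c(1)] .
qed

lemma pair_lift2_boundary:
  assumes f: "f \<in> Z2 G trivial_action UNIV" and b: "b \<in> bar_boundaries (residue_ring 2) G 2"
  shows "pair (lift2 f) b = 0"
proof -
  obtain c where c: "c \<in> carrier (ch (Suc 2))" "b = bnd c" using b by (auto simp: bar_boundaries_def)
  have "pair (cobd G (lift2 f)) c = 0"
  proof (rule pair_vanish[OF c(1)])
    fix x assume "x \<in> simplices (Suc 2)"
    then obtain a b d where abd: "a \<in> carrier G" "b \<in> carrier G" "d \<in> carrier G" "x = [a, b, d]"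
      using simplices_3[of x] by (auto simp: numeral_3_eq_3 numeral_2_eq_2)
    then have "f b d - f (a \<otimes> b) d + f a (b \<otimes> d) - f a b = 0"
      using f by (simp add: Z2_def)
    then show "cobd G (lift2 f) x = 0" using abd by (simp add: cobd_3 lift2_def bit_diff_eq_add)
  qed
  then show ?thesis unfolding c(2) pair_bnd[OF c(1)] .
qed

lemma additive_zero_on_ch:
  assumes add: "\<And>x y. x \<in> carrier (ch n) \<Longrightarrow> y \<in> carrier (ch n) \<Longrightarrow>
      \<phi> (x \<oplus>\<^bsub>ch n\<^esub> y) = \<phi> x + (\<phi> y :: bit)"
    and single: "\<And>x. x \<in> simplices n \<Longrightarrow> \<phi> (single x) = 0"
    and c: "c \<in> carrier (ch n)"
  shows "\<phi> c = 0"
  using c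
proof (induction "card {x. c x \<noteq> 0}" arbitrary: c rule: less_induct)
  case (less c)
  show ?case
  proof (cases "{x. c x \<noteq> 0} = {}")
    case True
    then have "c = c \<oplus>\<^bsub>ch n\<^esub> c" by (auto simp: ch_add)
    then have "\<phi> c = \<phi> c + \<phi> c" using add[OF less.prems less.prems] by simp
    then show ?thesis by simp
  next
    case False
    then obtain x where x: "c x \<noteq> 0" by blast
    have xs: "x \<in> simplices n" using chD(3)[OF less.prems x] .
    note sx = single_ch[OF xs]
    let ?d = "c \<oplus>\<^bsub>ch n\<^esub> single x"
    have cval: "c y = 0 \<or> c y = 1" for y using chD(1)[OF less.prems] by blast
    have supp: "{y. ?d y \<noteq> 0} = {y. c y \<noteq> 0} - {x}"
    proof (rule Set.set_eqI)
      have "c x = 1" using cval[of x] x by simp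
      then show "y \<in> {y. ?d y \<noteq> 0} \<longleftrightarrow> y \<in> {y. c y \<noteq> 0} - {x}" for y
        using cval[of y] by (auto simp: ch_add single_def)
    qed
    have "card {y. ?d y \<noteq> 0} < card {y. c y \<noteq> 0}"
      unfolding supp by (rule card_Diff1_less[OF chD(2)[OF less.prems]]) (use x in simp)
    then have "\<phi> ?d = 0" by (rule less.hyps[OF _ add_ch[OF less.prems sx]])
    then show ?thesis using add[OF less.prems sx] single[OF xs] by simp
  qed
qed

text \<open>
Homomorphisms to \<open>\<bbbF>\<^sub>2\<close> are the functionals on first homology. A generating set of homology detects them, which
bounds their number from above; conversely, points dual to a basis of homomorphisms give a generating set of
homology, because a functional on 1-chains is determined by its values at single group elements.
\<close>
lemma card_hom2:
  assumes fin: "finite_betti 1 G 2"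
  shows "finite (hom2 G)" "card (hom2 G) = 2 ^ betti 1 G 2"
proof -
  let ?B = "bar_boundaries (residue_ring 2) G 1" and ?M = "ch 1\<lparr>carrier := bar_cycles (residue_ring 2) G 1\<rparr>"
  interpret Q: f2_quotient ?B ?M by (rule f2_quotient_H1)
  have fd: "Q.vs.fin_dim" using fin by (simp add: finite_betti_def group_homology_def)
  have dim: "Q.vs.dim = betti 1 G 2" by (simp add: betti_def group_homology_def)
  have carM: "carrier ?M = carrier (ch 1)" by (simp add: cycles_1 del: One_nat_def)
  have s1: "[a] \<in> simplices 1" if "a \<in> carrier G" for a using that by (auto simp: simplices_1 simp del: One_nat_def)
  obtain Z where Z: "finite Z" "Z \<subseteq> carrier ?M" "card Z \<le> Q.vs.dim"
    and detect: "\<And>\<phi> x. (\<And>x y. x \<in> carrier ?M \<Longrightarrow> y \<in> carrier ?M \<Longrightarrow> \<phi> (x \<oplus>\<^bsub>?M\<^esub> y) = \<phi> x + (\<phi> y :: bit)) \<Longrightarrow>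
      (\<And>b. b \<in> ?B \<Longrightarrow> \<phi> b = 0) \<Longrightarrow> (\<And>z. z \<in> Z \<Longrightarrow> \<phi> z = 0) \<Longrightarrow> x \<in> carrier ?M \<Longrightarrow> \<phi> x = 0"
    using Q.representatives_exist[OF fd] by blast
  let ?F = "\<lambda>f. \<lambda>z\<in>Z. pair (lift1 f) z"
  have inj: "inj_on ?F (hom2 G)"
  proof (rule inj_onI)
    fix f f' assume f: "f \<in> hom2 G" "f' \<in> hom2 G" and eq: "?F f = ?F f'"
    let ?\<phi> = "\<lambda>c. pair (lift1 f) c + pair (lift1 f') c"
    have zero: "?\<phi> c = 0" if c: "c \<in> carrier ?M" for c
    proof (rule detect[OF _ _ _ c])
      fix x y assume xy: "x \<in> carrier ?M" "y \<in> carrier ?M"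
      then have xy: "x \<in> carrier (ch 1)" "y \<in> carrier (ch 1)" by (simp_all only: carM)
      have "x \<oplus>\<^bsub>?M\<^esub> y = x \<oplus>\<^bsub>ch 1\<^esub> y" by simp
      then show "?\<phi> (x \<oplus>\<^bsub>?M\<^esub> y) = ?\<phi> x + ?\<phi> y"
        by (simp only: pair_add[OF xy] add_ac)
    next
      show "?\<phi> b = 0" if "b \<in> ?B" for b
        using pair_lift1_boundary[OF f(1) that] pair_lift1_boundary[OF f(2) that] by simp
    next
      show "?\<phi> z = 0" if "z \<in> Z" for z
        using fun_cong[OF eq, of z] that by simp
    qed
    show "f = f'"
    proof
      fix g
      show "f g = f' g"
      proof (cases "g \<in> carrier G")
        case True
        then have "single [g] \<in> carrier ?M" unfolding carM by (rule single_ch[OF s1])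
        then have "f g + f' g = 0" using zero[of "single [g]"] by (simp add: lift1_def)
        then show ?thesis by (simp only: bit_add_eq_0_iff)
      next
        case False
        then show ?thesis using f by (simp add: hom2_iff)
      qed
    qed
  qed
  have img: "?F ` hom2 G \<subseteq> Z \<rightarrow>\<^sub>E UNIV" by auto
  have finE: "finite (Z \<rightarrow>\<^sub>E (UNIV :: bit set))" using Z(1) by (intro finite_PiE) (auto simp: UNIV_bit)
  show finH: "finite (hom2 G)" using inj_on_finite[OF inj img finE] .
  have "card (hom2 G) \<le> card (Z \<rightarrow>\<^sub>E (UNIV :: bit set))" by (rule card_inj_on_le[OF inj img finE])
  also have "\<dots> = 2 ^ card Z" using Z(1) by (simp add: card_PiE card_UNIV_bit)
  also have "\<dots> \<le> 2 ^ Q.vs.dim" using Z(3) by (rule power_increasing) simp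
  finally have le: "card (hom2 G) \<le> 2 ^ Q.vs.dim" .
  obtain I where I: "finite I" "I \<subseteq> hom2 G" "card (hom2 G) = 2 ^ card I"
    and sj: "\<And>v. \<exists>g\<in>carrier G. \<forall>i\<in>I. i g = v i"
    and span: "\<And>f. f \<in> hom2 G \<Longrightarrow> \<exists>J\<subseteq>I. \<forall>x. f x = (\<Sum>i\<in>J. i x)"
    using hom2_basis_exists[OF finH] by blast
  have "\<exists>g. g \<in> carrier G \<and> (\<forall>j\<in>I. j g = of_bool (j = i))" for i
    using sj[of "\<lambda>j. of_bool (j = i)"] by blast
  then obtain \<gamma> where \<gamma>: "\<And>i. \<gamma> i \<in> carrier G" "\<And>i j. j \<in> I \<Longrightarrow> j (\<gamma> i) = of_bool (j = i)" by metis
  let ?S = "(\<lambda>i. single [\<gamma> i]) ` I"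
  have "Q.vs.dim \<le> card ?S"
  proof (rule Q.dim_le_card)
    show "finite ?S" using I(1) by simp
    show "?S \<subseteq> carrier ?M" unfolding carM using single_ch[OF s1[OF \<gamma>(1)]] by blast
    fix \<phi> :: "('a list \<Rightarrow> int) \<Rightarrow> bit" and c
    assume add: "\<And>x y. x \<in> carrier ?M \<Longrightarrow> y \<in> carrier ?M \<Longrightarrow> \<phi> (x \<oplus>\<^bsub>?M\<^esub> y) = \<phi> x + \<phi> y"
      and zB: "\<And>b. b \<in> ?B \<Longrightarrow> \<phi> b = 0" and zS: "\<And>z. z \<in> ?S \<Longrightarrow> \<phi> z = 0" and c: "c \<in> carrier ?M"
    have add1: "\<phi> (x \<oplus>\<^bsub>ch 1\<^esub> y) = \<phi> x + \<phi> y" if "x \<in> carrier (ch 1)" "y \<in> carrier (ch 1)" for x y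
      using add[of x y] that unfolding carM by simp
    let ?f = "\<lambda>g. if g \<in> carrier G then \<phi> (single [g]) else 0"
    have "?f \<in> hom2 G"
      unfolding hom2_iff
    proof (intro conjI allI ballI impI)
      fix a b assume ab: "a \<in> carrier G" "b \<in> carrier G"
      have s: "single [b] \<in> carrier (ch 1)" "single [a \<otimes> b] \<in> carrier (ch 1)" "single [a] \<in> carrier (ch 1)"
        using ab by (auto intro!: single_ch s1 simp del: One_nat_def)
      have "single [a, b] \<in> carrier (ch (Suc 1))"
        using ab by (auto intro!: single_ch simp: simplices_def)
      then have "bnd (single [a, b]) \<in> ?B" unfolding bar_boundaries_def by blast
      then have "\<phi> (bnd (single [a, b])) = 0" by (rule zB)
      then have "\<phi> (single [b]) + \<phi> (single [a \<otimes> b]) + \<phi> (single [a]) = 0"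
        unfolding bnd_single_pair[OF ab] by (simp only: add1 add_ch s)
      then have "(\<phi> (single [a]) + \<phi> (single [b])) + \<phi> (single [a \<otimes> b]) = 0" by (simp only: add_ac)
      then show "?f (a \<otimes> b) = ?f a + ?f b" using ab by (simp add: bit_add_eq_0_iff)
    qed simp
    then obtain J where J: "J \<subseteq> I" "\<And>x. ?f x = (\<Sum>i\<in>J. i x)" using span[of ?f] by blast
    have "J = {}"
    proof (rule ccontr)
      assume "J \<noteq> {}"
      then obtain j where j: "j \<in> J" by blast
      have "?f (\<gamma> j) = (\<Sum>i\<in>J. if i = j then 1 else 0)"
        unfolding J(2)
      proof (rule sum.cong[OF refl])
        fix i assume "i \<in> J"
        then show "i (\<gamma> j) = (if i = j then 1 else 0)" using \<gamma>(2)[of i j] J(1) by auto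
      qed
      also have "\<dots> = 1" using j finite_subset[OF J(1) I(1)] by simp
      finally have "\<phi> (single [\<gamma> j]) = 1" using \<gamma>(1) by simp
      then show False using zS[of "single [\<gamma> j]"] j J(1) by auto
    qed
    then have f0: "?f x = 0" for x unfolding J(2) by simp
    show "\<phi> c = 0"
    proof (rule additive_zero_on_ch[OF add1])
      show "\<phi> (single x) = 0" if x: "x \<in> simplices 1" for x
      proof -
        obtain a where "a \<in> carrier G" "x = [a]" using x unfolding simplices_1 by blast
        then show ?thesis using f0[of a] by simp
      qed
      show "c \<in> carrier (ch 1)" using c unfolding carM .
    qed
  qed
  also have "\<dots> \<le> card I" by (rule card_image_le[OF I(1)])
  finally have "2 ^ Q.vs.dim \<le> card (hom2 G)" unfolding I(3) by (rule power_increasing) simp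
  then show "card (hom2 G) = 2 ^ betti 1 G 2" using le dim by simp
qed

text \<open>
Such a cocycle factors through the boundary map, hence defines a functional on the boundaries. An extension of
that functional to all 1-chains is a 1-cochain with coboundary \<open>f\<close>.
\<close>
lemma cocycle_vanishing_on_cycles:
  assumes f: "f \<in> Z2 G trivial_action (UNIV :: bit set)"
    and van: "\<And>c. c \<in> bar_cycles (residue_ring 2) G 2 \<Longrightarrow> pair (lift2 f) c = 0"
  shows "f \<in> B2 G trivial_action UNIV"
proof -
  let ?p = "pair (lift2 f)"
  have s2: "single [a, b] \<in> carrier (ch (Suc 1))" if "a \<in> carrier G" "b \<in> carrier G" for a b
    using that by (auto intro!: single_ch simp: simplices_def)
  have s1: "single [a] \<in> carrier (ch 1)" if "a \<in> carrier G" for a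
    using that by (auto intro!: single_ch simp: simplices_def)
  have "\<exists>l. (\<forall>x\<in>carrier (ch 1). \<forall>y\<in>carrier (ch 1). l (x \<oplus>\<^bsub>ch 1\<^esub> y) = l x + (l y :: bit)) \<and>
    (\<forall>c\<in>carrier (ch (Suc 1)). l (bnd c) = ?p c)"
  proof (cases "\<exists>c\<in>carrier (ch (Suc 1)). ?p c \<noteq> 0")
    case False
    then show ?thesis by (intro exI[of _ "\<lambda>c. 0"]) auto
  next
    case True
    then obtain c0 where c0: "c0 \<in> carrier (ch (Suc 1))" "?p c0 = 1" by (auto simp: bit_not_zero_iff)
    \<comment> \<open>The functional on boundaries that \<open>?p\<close> induces has kernel \<open>?U\<close>; any functional on 1-chains that kills \<open>?U\<close> but not the boundary of \<open>c0\<close> extends it.\<close>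
    let ?K = "{c \<in> carrier (ch (Suc 1)). ?p c = 0}"
    let ?U = "bnd ` ?K"
    note grp = abelian_group.a_group[OF abelian_group_ch[of 1]]
    have zK: "(\<lambda>x. 0) \<in> ?K" using zero_ch pair_zero by blast
    have zU: "(\<lambda>x. 0) \<in> ?U" by (rule image_eqI[where f = bnd, OF bnd_zero[symmetric] zK])
    have U: "subgroup ?U (add_monoid (ch 1))"
    proof (rule group.subgroupI[OF grp])
      show "?U \<subseteq> carrier (add_monoid (ch 1))" using bnd_ch by auto
      show "?U \<noteq> {}" using zU by blast
      fix a assume a: "a \<in> ?U"
      then have ac: "a \<in> carrier (ch 1)" using bnd_ch by auto
      have "inv\<^bsub>add_monoid (ch 1)\<^esub> a = a"
        by (rule group.inv_equality[OF grp]) (use ac add_self_ch in simp_all)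
      then show "inv\<^bsub>add_monoid (ch 1)\<^esub> a \<in> ?U" using a by simp
      fix b assume b: "b \<in> ?U"
      obtain c d where cd: "c \<in> ?K" "a = bnd c" "d \<in> ?K" "b = bnd d" using a b by blast
      then have cd': "c \<in> carrier (ch (Suc 1))" "d \<in> carrier (ch (Suc 1))" by simp_all
      have "c \<oplus>\<^bsub>ch (Suc 1)\<^esub> d \<in> ?K" using cd add_ch[OF cd'] pair_add[OF cd'] by simp
      moreover have "a \<oplus>\<^bsub>ch 1\<^esub> b = bnd (c \<oplus>\<^bsub>ch (Suc 1)\<^esub> d)"
        unfolding cd(2,4) by (rule bnd_add[OF cd', symmetric])
      ultimately show "a \<otimes>\<^bsub>add_monoid (ch 1)\<^esub> b \<in> ?U" by simp
    qed
    have notin: "bnd c0 \<notin> ?U"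
    proof
      assume "bnd c0 \<in> ?U"
      then obtain c where c: "c \<in> carrier (ch (Suc 1))" "?p c = 0" "bnd c0 = bnd c" by blast
      have "bnd (c0 \<oplus>\<^bsub>ch (Suc 1)\<^esub> c) = (\<lambda>x. 0)"
        unfolding bnd_add[OF c0(1) c(1)] c(3) add_self_ch ch_zero ..
      then have "c0 \<oplus>\<^bsub>ch (Suc 1)\<^esub> c \<in> bar_cycles (residue_ring 2) G 2"
        using add_ch[OF c0(1) c(1)] cycles_Suc[of 1] by (simp add: numeral_2_eq_2)
      then have "?p (c0 \<oplus>\<^bsub>ch (Suc 1)\<^esub> c) = 0" by (rule van)
      then show False using pair_add[OF c0(1) c(1), of "lift2 f"] c0(2) c(2) by simp
    qed
    have "\<exists>l\<in>hom2 (add_monoid (ch 1)). (\<forall>k\<in>?U. l k = 0) \<and> l (bnd c0) = 1"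
    proof (rule group.separating_hom2[OF grp U _ _ notin])
      show "x \<otimes>\<^bsub>add_monoid (ch 1)\<^esub> x \<in> ?U" for x
        using zU add_self_ch[of 1 x] by (simp add: ch_zero)
      show "bnd c0 \<in> carrier (add_monoid (ch 1))" using bnd_ch[OF c0(1)] by simp
    qed
    then obtain l where l: "l \<in> hom2 (add_monoid (ch 1))" "\<And>k. k \<in> ?U \<Longrightarrow> l k = 0" "l (bnd c0) = 1" by blast
    have add: "l (x \<oplus>\<^bsub>ch 1\<^esub> y) = l x + l y" if "x \<in> carrier (ch 1)" "y \<in> carrier (ch 1)" for x y
      using l(1) that by (simp add: hom2_iff)
    have "l (bnd c) = ?p c" if c: "c \<in> carrier (ch (Suc 1))" for c
    proof (cases "?p c = 0")
      case True
      then show ?thesis using l(2)[of "bnd c"] c by simp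
    next
      case False
      then have p: "?p c = 1" by (simp add: bit_not_zero_iff)
      have "c \<oplus>\<^bsub>ch (Suc 1)\<^esub> c0 \<in> ?K" using add_ch[OF c c0(1)] pair_add[OF c c0(1)] p c0(2) by simp
      then have "l (bnd (c \<oplus>\<^bsub>ch (Suc 1)\<^esub> c0)) = 0" by (intro l(2) imageI)
      then have "l (bnd c) + l (bnd c0) = 0"
        using add[OF bnd_ch[OF c] bnd_ch[OF c0(1)]] bnd_add[OF c c0(1)] by simp
      then show ?thesis using l(3) p by (simp add: bit_add_eq_0_iff)
    qed
    then show ?thesis using add by blast
  qed
  then obtain l :: "('a list \<Rightarrow> int) \<Rightarrow> bit"
    where add: "\<And>x y. x \<in> carrier (ch 1) \<Longrightarrow> y \<in> carrier (ch 1) \<Longrightarrow> l (x \<oplus>\<^bsub>ch 1\<^esub> y) = l x + l y"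
      and l: "\<And>c. c \<in> carrier (ch (Suc 1)) \<Longrightarrow> l (bnd c) = ?p c" by blast
  define w where "w = (\<lambda>g. if g \<in> carrier G then l (single [g]) else 0)"
  have "w \<in> C1 G UNIV" by (simp add: C1_def w_def)
  moreover have "f = d1 G trivial_action w"
  proof (intro ext)
    fix a b
    show "f a b = d1 G trivial_action w a b"
    proof (cases "a \<in> carrier G \<and> b \<in> carrier G")
      case True
      then have ab: "a \<in> carrier G" "b \<in> carrier G" by simp_all
      have "f a b = l (bnd (single [a, b]))" using l[OF s2[OF ab]] by (simp add: lift2_def)
      also have "\<dots> = l (single [b]) + l (single [a \<otimes> b]) + l (single [a])"
        unfolding bnd_single_pair[OF ab]
        by (simp only: add add_ch s1[OF ab(1)] s1[OF ab(2)] s1[OF m_closed[OF ab]])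
      also have "\<dots> = w a + w b - w (a \<otimes> b)"
        using ab by (simp add: w_def bit_diff_eq_add add_ac)
      finally show ?thesis using ab by (simp add: d1_def)
    next
      case False
      then show ?thesis using f by (auto simp: d1_def Z2_def C2_def)
    qed
  qed
  ultimately show ?thesis by (auto simp: B2_def)
qed

lemma H2_index_bound:
  assumes fin: "finite_betti 2 G 2"
  shows "0 < qindex (Z2 G trivial_action (UNIV :: bit set)) (B2 G trivial_action UNIV)"
    "qindex (Z2 G trivial_action (UNIV :: bit set)) (B2 G trivial_action UNIV) \<le> 2 ^ betti 2 G 2"
proof -
  let ?B = "bar_boundaries (residue_ring 2) G 2" and ?M = "ch 2\<lparr>carrier := bar_cycles (residue_ring 2) G 2\<rparr>"
  let ?ZZ = "Z2 G trivial_action (UNIV :: bit set)" and ?BB = "B2 G trivial_action (UNIV :: bit set)"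
  interpret triv: group_action_module G "trivial_action :: 'a \<Rightarrow> bit \<Rightarrow> bit"
    by (rule trivial_action_module)
  have U: "add_subgroup (UNIV :: bit set)" by (rule add_subgroupI) auto
  interpret Q: f2_quotient ?B ?M by (rule f2_quotient_H2)
  have fd: "Q.vs.fin_dim" using fin by (simp add: finite_betti_def group_homology_def)
  have dim: "Q.vs.dim = betti 2 G 2" by (simp add: betti_def group_homology_def)
  have cyc: "c \<in> carrier (ch 2)" if "c \<in> carrier ?M" for c
    using that cycles_Suc[of 1] by (simp add: numeral_2_eq_2)
  obtain Z where Z: "finite Z" "Z \<subseteq> carrier ?M" "card Z \<le> Q.vs.dim"
    and detect: "\<And>\<phi> x. (\<And>x y. x \<in> carrier ?M \<Longrightarrow> y \<in> carrier ?M \<Longrightarrow> \<phi> (x \<oplus>\<^bsub>?M\<^esub> y) = \<phi> x + (\<phi> y :: bit)) \<Longrightarrow>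
      (\<And>b. b \<in> ?B \<Longrightarrow> \<phi> b = 0) \<Longrightarrow> (\<And>z. z \<in> Z \<Longrightarrow> \<phi> z = 0) \<Longrightarrow> x \<in> carrier ?M \<Longrightarrow> \<phi> x = 0"
    using Q.representatives_exist[OF fd] by blast
  let ?F = "\<lambda>f. \<lambda>z\<in>Z. pair (lift2 f) z"
  have eqB: "f - f' \<in> ?BB" if f: "f \<in> ?ZZ" "f' \<in> ?ZZ" and eq: "?F f = ?F f'" for f f'
  proof (rule cocycle_vanishing_on_cycles)
    show d: "f - f' \<in> ?ZZ" by (rule add_subgroup_diff[OF triv.add_subgroup_Z2[OF U] f])
    fix c assume "c \<in> bar_cycles (residue_ring 2) G 2"
    then have c: "c \<in> carrier ?M" by simp
    have lin: "pair (lift2 (f - f')) x = pair (lift2 f) x + pair (lift2 f') x" for x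
      by (simp add: pair_def lift2_def bit_diff_eq_add sum.distrib)
    show "pair (lift2 (f - f')) c = 0"
    proof (rule detect[OF _ _ _ c])
      fix x y assume "x \<in> carrier ?M" "y \<in> carrier ?M"
      then have xy: "x \<in> carrier (ch 2)" "y \<in> carrier (ch 2)" by (simp_all only: cyc)
      have "x \<oplus>\<^bsub>?M\<^esub> y = x \<oplus>\<^bsub>ch 2\<^esub> y" by simp
      then show "pair (lift2 (f - f')) (x \<oplus>\<^bsub>?M\<^esub> y) = pair (lift2 (f - f')) x + pair (lift2 (f - f')) y"
        by (simp only: pair_add[OF xy])
    next
      show "pair (lift2 (f - f')) b = 0" if "b \<in> ?B" for b by (rule pair_lift2_boundary[OF d that])
    next
      show "pair (lift2 (f - f')) z = 0" if "z \<in> Z" for z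
        using fun_cong[OF eq, of z] that by (simp add: lin)
    qed
  qed
  have sB: "add_subgroup ?BB" by (rule triv.add_subgroup_B2[OF U])
  have finE: "finite (Z \<rightarrow>\<^sub>E (UNIV :: bit set))" using Z(1) by (intro finite_PiE) (auto simp: UNIV_bit)
  have finF: "finite (?F ` ?ZZ)" by (rule finite_subset[OF _ finE]) auto
  let ?G = "\<lambda>v. (+) (SOME f. f \<in> ?ZZ \<and> ?F f = v) ` ?BB"
  have sub: "(\<lambda>f. (+) f ` ?BB) ` ?ZZ \<subseteq> ?G ` ?F ` ?ZZ"
  proof
    fix X assume "X \<in> (\<lambda>f. (+) f ` ?BB) ` ?ZZ"
    then obtain f where f: "f \<in> ?ZZ" "X = (+) f ` ?BB" by blast
    let ?h = "SOME h. h \<in> ?ZZ \<and> ?F h = ?F f"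
    have h: "?h \<in> ?ZZ \<and> ?F ?h = ?F f" by (rule someI[of _ f]) (use f in simp)
    have "f - ?h \<in> ?BB" by (rule eqB[OF f(1)]) (use h in simp_all)
    then have "X = ?G (?F f)" unfolding f(2) by (simp only: add_coset_eq_iff[OF sB])
    then show "X \<in> ?G ` ?F ` ?ZZ" using f(1) by (intro image_eqI[of _ _ "?F f"] imageI)
  qed
  have "qindex ?ZZ ?BB \<le> card (?G ` ?F ` ?ZZ)"
    unfolding qindex_def by (rule card_mono[OF finite_imageI[OF finF] sub])
  also have "\<dots> \<le> card (?F ` ?ZZ)" by (rule card_image_le[OF finF])
  also have "\<dots> \<le> card (Z \<rightarrow>\<^sub>E (UNIV :: bit set))" by (rule card_mono[OF finE]) auto
  also have "\<dots> = 2 ^ card Z" using Z(1) by (simp add: card_PiE card_UNIV_bit)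
  also have "\<dots> \<le> 2 ^ Q.vs.dim" using Z(3) by (rule power_increasing) simp
  finally show "qindex ?ZZ ?BB \<le> 2 ^ betti 2 G 2" by (simp only: dim)
  have "finite ((\<lambda>f. (+) f ` ?BB) ` ?ZZ)"
    by (rule finite_subset[OF sub finite_imageI[OF finF]])
  moreover have "?ZZ \<noteq> {}" using add_subgroup_zero[OF triv.add_subgroup_Z2[OF U]] by blast
  ultimately show "0 < qindex ?ZZ ?BB" unfolding qindex_def by (simp add: card_gt_0_iff)
qed

end

section \<open>The middle binomial coefficient\<close>
definition central_ratio :: "nat \<Rightarrow> real"
  where "central_ratio m = real ((2 * m) choose m) / 4 ^ m"

lemma central_ratio_pos: "central_ratio m > 0"
  by (simp add: central_ratio_def)

lemma central_choose_Suc_half: "((2 * Suc m) choose Suc m) = 2 * (Suc (2 * m) choose m)"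
proof -
  have "(Suc (2 * m) choose Suc m) = (Suc (2 * m) choose m)"
    using binomial_symmetric[of m "Suc (2 * m)"] by simp
  then show ?thesis using binomial_Suc_Suc[of "Suc (2 * m)" m] by simp
qed

lemma central_ratio_Suc: "central_ratio (Suc m) = central_ratio m * (2 * real m + 1) / (2 * real m + 2)"
proof -
  have "Suc m * (Suc (2 * m) choose Suc m) = Suc (2 * m) * ((2 * m) choose m)"
    using Suc_times_binomial_eq[of "2 * m" m] by (simp only: mult.commute)
  moreover have "(Suc (2 * m) choose Suc m) = (Suc (2 * m) choose m)"
    using binomial_symmetric[of m "Suc (2 * m)"] by simp
  ultimately have "real (Suc m) * real (Suc (2 * m) choose m) = real (Suc (2 * m)) * real ((2 * m) choose m)"
    by (metis of_nat_mult)
  then have x: "real (Suc (2 * m) choose m) = (2 * real m + 1) * real ((2 * m) choose m) / (real m + 1)"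
    by (simp add: field_simps)
  have "central_ratio (Suc m) = real (Suc (2 * m) choose m) / (2 * 4 ^ m)"
    unfolding central_ratio_def central_choose_Suc_half by simp
  also have "\<dots> = (2 * real m + 1) * real ((2 * m) choose m) / ((real m + 1) * (2 * 4 ^ m))"
    unfolding x by simp
  also have "(real m + 1) * (2 * 4 ^ m) = 4 ^ m * (2 * real m + 2)" by (simp add: algebra_simps)
  finally show ?thesis unfolding central_ratio_def by simp
qed

text \<open>
The square of the central binomial ratio is a partial product of Wallis' product in disguise.
\<close>
lemma central_ratio_wallis:
  "(central_ratio m)\<^sup>2 * (2 * real m + 1) = inverse (\<Prod>k=1..m. (4 * real k ^ 2) / (4 * real k ^ 2 - 1))"
proof (induction m)
  case 0
  then show ?case by (simp add: central_ratio_def)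
next
  case (Suc m)
  let ?P = "\<Prod>k=1..m. (4 * real k ^ 2) / (4 * real k ^ 2 - 1)"
  let ?x = "real m"
  have e: "inverse ((4 * real (Suc m) ^ 2) / (4 * real (Suc m) ^ 2 - 1))
      = ((2 * ?x + 1) * (2 * ?x + 3)) / (2 * ?x + 2) ^ 2"
  proof -
    have 1: "4 * real (Suc m) ^ 2 = (2 * ?x + 2) ^ 2" by (simp add: power2_eq_square algebra_simps)
    have 2: "(2 * ?x + 2) ^ 2 - 1 = (2 * ?x + 1) * (2 * ?x + 3)" by (simp add: power2_eq_square algebra_simps)
    show ?thesis unfolding 1 2 by (simp only: inverse_divide)
  qed
  have "(\<Prod>k=1..Suc m. (4 * real k ^ 2) / (4 * real k ^ 2 - 1))
      = ?P * ((4 * real (Suc m) ^ 2) / (4 * real (Suc m) ^ 2 - 1))"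
    by (subst prod.cl_ivl_Suc) simp
  then have "inverse (\<Prod>k=1..Suc m. (4 * real k ^ 2) / (4 * real k ^ 2 - 1))
      = inverse ?P * inverse ((4 * real (Suc m) ^ 2) / (4 * real (Suc m) ^ 2 - 1))"
    by (simp only: inverse_mult_distrib)
  also have "\<dots> = (central_ratio m)\<^sup>2 * (2 * ?x + 1) * (((2 * ?x + 1) * (2 * ?x + 3)) / (2 * ?x + 2) ^ 2)"
    by (simp only: e Suc.IH)
  also have "\<dots> = (central_ratio m * (2 * ?x + 1) / (2 * ?x + 2))\<^sup>2 * (2 * ?x + 3)"
    by (simp add: power_divide power_mult_distrib power2_eq_square)
  also have "\<dots> = (central_ratio (Suc m))\<^sup>2 * (2 * real (Suc m) + 1)"
    by (simp add: central_ratio_Suc)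
  finally show ?case ..
qed

lemma central_ratio_limit: "(\<lambda>m. central_ratio m * sqrt (2 * real m + 1)) \<longlonglongrightarrow> sqrt (2 / pi)"
proof -
  have "(\<lambda>m. sqrt (inverse (\<Prod>k=1..m. (4 * real k ^ 2) / (4 * real k ^ 2 - 1)))) \<longlonglongrightarrow> sqrt (inverse (pi / 2))"
    by (intro tendsto_real_sqrt tendsto_inverse wallis) simp
  moreover have "sqrt (inverse (\<Prod>k=1..m. (4 * real k ^ 2) / (4 * real k ^ 2 - 1)))
      = central_ratio m * sqrt (2 * real m + 1)" for m
    unfolding central_ratio_wallis[symmetric] using central_ratio_pos[of m] by (simp add: real_sqrt_mult)
  ultimately show ?thesis by simp
qed

lemma middle_choose: "real (n choose (n div 2)) = 2 ^ n * central_ratio ((n + 1) div 2)"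
proof (cases "even n")
  case True
  then obtain m where "n = 2 * m" by blast
  then show ?thesis by (simp add: central_ratio_def power_mult)
next
  case False
  then obtain m where m: "n = 2 * m + 1" using oddE by blast
  have "real (n choose (n div 2)) = real ((2 * Suc m) choose Suc m) / 2"
    unfolding central_choose_Suc_half m by simp
  also have "\<dots> = 2 ^ n * central_ratio (Suc m)" by (simp add: central_ratio_def m power_mult)
  finally show ?thesis by (simp add: m)
qed

lemma middle_choose_lower_bound:
  fixes lam c :: real
  assumes lam: "lam < sqrt (2 / pi)" and c: "c \<ge> 0"
  shows "\<exists>N. \<forall>n\<ge>N. lam * 2 ^ n * sqrt (real n) \<le> real n * real (n choose (n div 2)) - c * 2 ^ n"
proof -
  let ?g = "\<lambda>m. sqrt ((2 * real m - 1) / (2 * real m + 1)) * (central_ratio m * sqrt (2 * real m + 1))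
    - c / sqrt (2 * real m - 1)"
  have "(\<lambda>m. sqrt ((2 * real m - 1) / (2 * real m + 1))) \<longlonglongrightarrow> 1" by real_asymp
  moreover have "(\<lambda>m. c / sqrt (2 * real m - 1)) \<longlonglongrightarrow> 0" by real_asymp
  ultimately have "?g \<longlonglongrightarrow> 1 * sqrt (2 / pi) - 0"
    by (intro tendsto_diff tendsto_mult central_ratio_limit)
  then have "eventually (\<lambda>m. lam < ?g m) sequentially"
    using lam by (intro order_tendstoD(1)) simp_all
  then obtain M where M: "\<And>m. m \<ge> M \<Longrightarrow> lam < ?g m" by (auto simp: eventually_sequentially)
  show ?thesis
  proof (intro exI allI impI)
    fix n assume n: "n \<ge> 2 * M + 1"
    \<comment> \<open>With this \<open>?m\<close> both parities of \<open>n\<close> satisfy \<open>2 ?m - 1 \<le> n\<close> and the same formula for the middle binomial coefficient.\<close>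
    let ?m = "(n + 1) div 2"
    have m: "?m \<ge> M" "?m \<ge> 1" "n \<ge> 2 * ?m - 1" using n by auto
    have m1: "2 * real ?m - 1 \<ge> 1" "2 * real ?m - 1 \<le> real n" using m by linarith+
    have "?g ?m = sqrt (2 * real ?m - 1) * central_ratio ?m - c / sqrt (2 * real ?m - 1)"
      by (simp add: real_sqrt_divide)
    also have "\<dots> \<le> sqrt (real n) * central_ratio ?m - c / sqrt (real n)"
    proof -
      have "sqrt (2 * real ?m - 1) * central_ratio ?m \<le> sqrt (real n) * central_ratio ?m"
        using m1(2) central_ratio_pos[of ?m] by (intro mult_right_mono) auto
      moreover have "c / sqrt (real n) \<le> c / sqrt (2 * real ?m - 1)"
        using m1 c by (intro divide_left_mono mult_pos_pos) auto
      ultimately show ?thesis by linarith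
    qed
    finally have "lam \<le> sqrt (real n) * central_ratio ?m - c / sqrt (real n)" using M[OF m(1)] by linarith
    then have "lam * (2 ^ n * sqrt (real n))
        \<le> (sqrt (real n) * central_ratio ?m - c / sqrt (real n)) * (2 ^ n * sqrt (real n))"
      by (rule mult_right_mono) simp
    also have "\<dots> = (sqrt (real n) * sqrt (real n)) * (2 ^ n * central_ratio ?m) - c * 2 ^ n"
      using n by (simp add: field_simps)
    also have "\<dots> = real n * real (n choose (n div 2)) - c * 2 ^ n"
      by (simp add: middle_choose)
    finally show "lam * 2 ^ n * sqrt (real n) \<le> real n * real (n choose (n div 2)) - c * 2 ^ n"
      by (simp add: mult.assoc)
  qed
qed

section \<open>Growth along the derived 2-series\<close>
lemma finite_image_factor:
  assumes fin: "finite (F ` A)" and eq: "\<And>x y. x \<in> A \<Longrightarrow> y \<in> A \<Longrightarrow> F x = F y \<Longrightarrow> G x = G y"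
  shows "finite (G ` A)"
proof -
  have "G x \<in> (\<lambda>v. G (SOME y. y \<in> A \<and> F y = v)) ` F ` A" if x: "x \<in> A" for x
  proof -
    have "(SOME y. y \<in> A \<and> F y = F x) \<in> A \<and> F (SOME y. y \<in> A \<and> F y = F x) = F x"
      by (rule someI[of _ x]) (use x in simp)
    then have "G x = G (SOME y. y \<in> A \<and> F y = F x)" using eq[of x] x by metis
    then show ?thesis using x by blast
  qed
  then have "G ` A \<subseteq> (\<lambda>v. G (SOME y. y \<in> A \<and> F y = v)) ` F ` A" by blast
  then show ?thesis using fin finite_subset by blast
qed

context group
begin

text \<open>
A coset of the kernel is determined by the coset \<open>H #> g\<close> together with the values of the finitely many
homomorphisms at \<open>g\<close> divided by the representative of \<open>H #> g\<close>.
\<close>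
lemma finite_index_hom2_kernel:
  assumes H: "finite_index_subgroup H G" and fin: "finite (hom2 (G\<lparr>carrier := H\<rparr>))"
  shows "finite_index_subgroup {x \<in> H. \<forall>f\<in>hom2 (G\<lparr>carrier := H\<rparr>). f x = 0} G"
proof -
  let ?K = "{x \<in> H. \<forall>f\<in>hom2 (G\<lparr>carrier := H\<rparr>). f x = 0}"
  have sH: "subgroup H G" and fH: "finite (rcosets H)" using H by (auto simp: finite_index_subgroup_def)
  have K: "subgroup ?K G" by (rule hom2_kernel_subgroup[OF sH])
  define r where "r = (\<lambda>X. SOME x. x \<in> X \<and> x \<in> carrier G)"
  have r: "r (H #> g) \<in> H #> g" "r (H #> g) \<in> carrier G" if g: "g \<in> carrier G" for g
  proof -
    have "g \<in> H #> g \<and> g \<in> carrier G" using rcos_self[OF g sH] g by blast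
    then have "r (H #> g) \<in> H #> g \<and> r (H #> g) \<in> carrier G" unfolding r_def by (rule someI)
    then show "r (H #> g) \<in> H #> g" "r (H #> g) \<in> carrier G" by auto
  qed
  have inH: "g \<otimes> inv (r (H #> g)) \<in> H" if g: "g \<in> carrier G" for g
  proof -
    obtain h where h: "h \<in> H" "r (H #> g) = h \<otimes> g" using r(1)[OF g] by (auto simp: r_coset_def)
    have hc: "h \<in> carrier G" using subgroup.mem_carrier[OF sH h(1)] .
    have "g \<otimes> inv (r (H #> g)) = inv h"
      using h(2) hc g by (simp add: inv_mult_group m_assoc[symmetric])
    then show ?thesis using subgroup.m_inv_closed[OF sH h(1)] by simp
  qed
  let ?F = "\<lambda>g. (H #> g, \<lambda>f\<in>hom2 (G\<lparr>carrier := H\<rparr>). f (g \<otimes> inv (r (H #> g))))"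
  have "finite ((\<lambda>g. ?K #> g) ` carrier G)"
  proof (rule finite_image_factor[where F = ?F])
    have "?F ` carrier G \<subseteq> (rcosets H) \<times> (hom2 (G\<lparr>carrier := H\<rparr>) \<rightarrow>\<^sub>E UNIV)"
      using rcosetsI[OF subgroup.subset[OF sH]] by auto
    moreover have "finite ((rcosets H) \<times> (hom2 (G\<lparr>carrier := H\<rparr>) \<rightarrow>\<^sub>E (UNIV :: bit set)))"
      using fH fin by (intro finite_cartesian_product finite_PiE) (auto simp: UNIV_bit)
    ultimately show "finite (?F ` carrier G)" by (rule finite_subset)
    fix g g' assume g: "g \<in> carrier G" "g' \<in> carrier G" and eq: "?F g = ?F g'"
    have co: "H #> g' = H #> g" using arg_cong[OF eq, of fst] by simp
    have val: "(\<lambda>f\<in>hom2 (G\<lparr>carrier := H\<rparr>). f (g \<otimes> inv (r (H #> g))))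
        = (\<lambda>f\<in>hom2 (G\<lparr>carrier := H\<rparr>). f (g' \<otimes> inv (r (H #> g'))))"
      using arg_cong[OF eq, of snd] by (simp only: snd_conv)
    define t where "t = r (H #> g)"
    have t: "t \<in> carrier G" unfolding t_def by (rule r(2)[OF g(1)])
    have h: "g \<otimes> inv t \<in> H" "g' \<otimes> inv t \<in> H"
      using inH[OF g(1)] inH[OF g(2)] unfolding co t_def by simp_all
    have hi: "inv (g' \<otimes> inv t) \<in> H" by (rule subgroup.m_inv_closed[OF sH h(2)])
    have e: "g \<otimes> inv g' = (g \<otimes> inv t) \<otimes> inv (g' \<otimes> inv t)"
    proof -
      have "(g \<otimes> inv t) \<otimes> inv (g' \<otimes> inv t) = g \<otimes> ((inv t \<otimes> t) \<otimes> inv g')"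
        using g t by (simp only: inv_mult_group inv_inv m_assoc m_closed inv_closed)
      then show ?thesis using g t by simp
    qed
    have "g \<otimes> inv g' \<in> ?K"
    proof -
      have "f (g \<otimes> inv g') = 0" if f: "f \<in> hom2 (G\<lparr>carrier := H\<rparr>)" for f
      proof -
        have hom: "f (x \<otimes> y) = f x + f y" if "x \<in> H" "y \<in> H" for x y
          using f that by (simp add: hom2_iff)
        have "f (g \<otimes> inv g') = f (g \<otimes> inv t) + f (g' \<otimes> inv t)"
          using hom[OF h(1) hi] hom_inv[of H f, OF sH hom h(2)] by (simp only: e)
        also have "f (g \<otimes> inv t) = f (g' \<otimes> inv t)"
          using fun_cong[OF val, of f] f unfolding co t_def by simp
        finally show ?thesis by simp
      qed
      moreover have "g \<otimes> inv g' \<in> H" unfolding e by (rule subgroup.m_closed[OF sH h(1) hi])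
      ultimately show ?thesis by blast
    qed
    then have "(g \<otimes> inv g') \<otimes> g' \<in> ?K #> g'" by (rule rcosI[OF _ subgroup.subset[OF K] g(2)])
    moreover have "(g \<otimes> inv g') \<otimes> g' = g" using g by (simp add: m_assoc)
    ultimately have "g \<in> ?K #> g'" by simp
    then show "?K #> g = ?K #> g'" using repr_independence[OF _ g(2) K] by simp
  qed
  moreover have "rcosets ?K = (\<lambda>g. ?K #> g) ` carrier G" by (auto simp: RCOSETS_def)
  ultimately show ?thesis using K by (simp add: finite_index_subgroup_def)
qed

text \<open>
The exponents of two in \<open>covering_bound\<close>, with \<open>s \<le> 2\<^sup>n\<close> for the number \<open>s\<close> of monomials of degree less than
\<open>l\<close>.
\<close>
lemma derived_2_step_bound:
  fixes l :: nat
  assumes fin: "finite_betti 1 G 2" "finite_betti 2 G 2"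
    and finK: "finite_betti 1 (G\<lparr>carrier := K\<rparr>) 2"
    and K: "subgroup K G" "K = {x \<in> carrier G. \<forall>f\<in>hom2 G. f x = 0}"
    and b2: "betti 2 G 2 \<le> betti 1 G 2 + c"
  shows "betti 1 G 2 * (betti 1 G 2 choose l) \<le> betti 1 (G\<lparr>carrier := K\<rparr>) 2 + (c + 1) * 2 ^ betti 1 G 2"
proof -
  let ?n = "betti 1 G 2" and ?b = "betti 1 (G\<lparr>carrier := K\<rparr>) 2" and ?r = "betti 2 G 2"
  note h = card_hom2[OF fin(1)]
  obtain I where I: "finite I" "I \<subseteq> hom2 G" "card (hom2 G) = 2 ^ card I"
    and sj: "\<And>v. \<exists>g\<in>carrier G. \<forall>i\<in>I. i g = v i"
    and span: "\<And>f. f \<in> hom2 G \<Longrightarrow> \<exists>J\<subseteq>I. \<forall>x. f x = (\<Sum>i\<in>J. i x)"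
    using hom2_basis_exists[OF h(1)] by blast
  have n: "card I = ?n" using I(3) h(2) by simp
  interpret char_basis G I by unfold_locales (use I sj in auto)
  have ker: "common_kernel = K"
  proof -
    have "f x = 0" if x: "\<forall>i\<in>I. i x = 0" and f: "f \<in> hom2 G" for f x
    proof -
      obtain J where J: "J \<subseteq> I" "\<forall>x. f x = (\<Sum>i\<in>J. i x)" using span[OF f] by blast
      then have "f x = (\<Sum>i\<in>J. i x)" by blast
      also have "\<dots> = 0" by (rule sum.neutral) (use x J(1) in blast)
      finally show ?thesis .
    qed
    then show ?thesis unfolding common_kernel_def K(2) using I(2) by blast
  qed
  interpret K: group "G\<lparr>carrier := K\<rparr>" by (rule subgroup.subgroup_is_group[OF K(1) group_axioms])
  note hK = K.card_hom2[OF finK]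
  note R = H2_index_bound[OF fin(2)]
  define s where "s = card {S. S \<subseteq> I \<and> card S < l}"
  have s: "s \<le> 2 ^ ?n"
    unfolding s_def n[symmetric] card_Pow[OF I(1), symmetric]
    by (rule card_mono) (use I(1) in auto)
  have "(2 ^ ?n) ^ ((?n choose l) + s) \<le> 2 ^ ?b * 2 ^ 2 ^ ?n * trivial_H2_index ^ s"
    using covering_bound[OF h(1) _ R(1), of l] hK unfolding ker h(2) n s_def[symmetric] by simp
  also have "\<dots> \<le> 2 ^ ?b * 2 ^ 2 ^ ?n * (2 ^ ?r) ^ s"
    by (intro mult_left_mono power_mono R(2)) auto
  finally have "(2::nat) ^ (?n * ((?n choose l) + s)) \<le> 2 ^ (?b + 2 ^ ?n + ?r * s)"
    by (simp only: power_mult power_add)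
  then have "?n * ((?n choose l) + s) \<le> ?b + 2 ^ ?n + ?r * s" by simp
  also have "?r * s \<le> (?n + c) * s" using b2 by (rule mult_right_mono) simp
  also have "?b + 2 ^ ?n + (?n + c) * s = ?b + 2 ^ ?n + c * s + ?n * s" by (simp add: algebra_simps)
  also have "c * s \<le> c * 2 ^ ?n" using s by (rule mult_left_mono) simp
  finally show ?thesis by (simp add: algebra_simps)
qed

end

theorem mainTheorem7:
  fixes G :: "('a, 'b) monoid_scheme" and lam :: real
  assumes "finitely_generated_group G"
    and "b2_b1_property G 2"
    and "lam < sqrt (2 / pi)"
  shows "\<exists>N::nat. \<forall>G\<^sub>1. finite_index_subgroup G\<^sub>1 G \<and> betti 1 (G\<lparr>carrier := G\<^sub>1\<rparr>) 2 \<ge> N \<longrightarrow>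
    (\<forall>i. real (betti 1 (G\<lparr>carrier := derived_2_series G G\<^sub>1 (Suc i)\<rparr>) 2)
       \<ge> lam * 2 ^ betti 1 (G\<lparr>carrier := derived_2_series G G\<^sub>1 i\<rparr>) 2
           * sqrt (real (betti 1 (G\<lparr>carrier := derived_2_series G G\<^sub>1 i\<rparr>) 2)))"
proof -
  interpret group G using assms(1) by (simp add: finitely_generated_group_def)
  obtain C :: int where C: "\<And>H. finite_index_subgroup H G \<Longrightarrow>
       finite_betti 1 (G\<lparr>carrier := H\<rparr>) 2 \<and> finite_betti 2 (G\<lparr>carrier := H\<rparr>) 2 \<and>
       int (betti 2 (G\<lparr>carrier := H\<rparr>) 2) - int (betti 1 (G\<lparr>carrier := H\<rparr>) 2) \<le> C"
    using assms(2) unfolding b2_b1_property_def by blast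
  define c where "c = nat C"
  \<comment> \<open>A positive constant makes the lower bound exceed the previous Betti number, so that it stays above the threshold along the whole series.\<close>
  define mu where "mu = max lam (1 / 2)"
  have "pi < 4" using pi_less_4 .
  then have "1 / 4 < 2 / pi" using pi_gt_zero by (simp add: field_simps)
  then have "sqrt (1 / 4) < sqrt (2 / pi)" by (rule real_sqrt_less_mono)
  then have mu: "mu < sqrt (2 / pi)" using assms(3) by (simp add: mu_def real_sqrt_divide)
  obtain N0 where N0: "\<And>n. n \<ge> N0 \<Longrightarrow>
      mu * 2 ^ n * sqrt (real n) \<le> real n * real (n choose (n div 2)) - real (c + 1) * 2 ^ n"
    using middle_choose_lower_bound[OF mu, of "real (c + 1)"] by auto
  let ?b = "\<lambda>H. betti 1 (G\<lparr>carrier := H\<rparr>) 2"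
  have cast: "real p * real q - real (c + 1) * 2 ^ n \<le> real k"
    if "p * q \<le> k + (c + 1) * 2 ^ n" for p q k n :: nat
  proof -
    have "real (p * q) \<le> real (k + (c + 1) * 2 ^ n)" using that by (simp only: of_nat_le_iff)
    then show ?thesis unfolding of_nat_add of_nat_mult of_nat_power of_nat_numeral by linarith
  qed
  have step: "finite_index_subgroup (derived_2_series G H (Suc i)) G \<and>
      mu * 2 ^ ?b (derived_2_series G H i) * sqrt (real (?b (derived_2_series G H i)))
        \<le> real (?b (derived_2_series G H (Suc i)))"
    if fi: "finite_index_subgroup (derived_2_series G H i) G" and N: "?b (derived_2_series G H i) \<ge> N0" for H i
  proof -
    let ?H = "derived_2_series G H i" and ?K = "derived_2_series G H (Suc i)"
    have sH: "subgroup ?H G" using fi by (simp add: finite_index_subgroup_def)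
    have K: "?K = {x \<in> ?H. \<forall>f\<in>hom2 (G\<lparr>carrier := ?H\<rparr>). f x = 0}"
      using derived_2_step_eq[OF sH] by simp
    interpret H: group "G\<lparr>carrier := ?H\<rparr>" by (rule subgroup.subgroup_is_group[OF sH group_axioms])
    note CH = C[OF fi]
    have finH: "finite_betti 1 (G\<lparr>carrier := ?H\<rparr>) 2" using CH by blast
    have fK: "finite_index_subgroup ?K G"
      unfolding K by (rule finite_index_hom2_kernel[OF fi H.card_hom2(1)[OF finH]])
    then have sK: "subgroup ?K G" by (simp add: finite_index_subgroup_def)
    have "?K \<subseteq> ?H" unfolding K by blast
    then have sKH: "subgroup ?K (G\<lparr>carrier := ?H\<rparr>)" by (rule subgroup_incl[OF sK sH])
    have "betti 2 (G\<lparr>carrier := ?H\<rparr>) 2 \<le> ?b ?H + c" using CH unfolding c_def by linarith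
    then have "?b ?H * (?b ?H choose (?b ?H div 2)) \<le> ?b ?K + (c + 1) * 2 ^ ?b ?H"
      using H.derived_2_step_bound[of ?K c "?b ?H div 2"] CH C[OF fK] sKH K by simp
    then have "real (?b ?H) * real (?b ?H choose (?b ?H div 2)) - real (c + 1) * 2 ^ ?b ?H \<le> real (?b ?K)"
      by (rule cast)
    then have "mu * 2 ^ ?b ?H * sqrt (real (?b ?H)) \<le> real (?b ?K)" using N0[OF N] by linarith
    then show ?thesis using fK by blast
  qed
  show ?thesis
  proof (intro exI allI impI)
    fix G1 i assume G1: "finite_index_subgroup G1 G \<and> ?b G1 \<ge> max N0 1"
    have inv: "finite_index_subgroup (derived_2_series G G1 i) G \<and> ?b (derived_2_series G G1 i) \<ge> max N0 1" for i
    proof (induction i)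
      case 0
      then show ?case using G1 by simp
    next
      case (Suc i)
      let ?n = "?b (derived_2_series G G1 i)"
      have n: "?n \<ge> N0" "?n \<ge> 1" using Suc by auto
      note st = step[OF conjunct1[OF Suc] n(1)]
      have "real ?n \<le> 1 / 2 * 2 ^ ?n * 1"
      proof -
        have "?n \<le> 2 ^ (?n - 1)" using n(2) less_exp[of "?n - 1"] by linarith
        moreover have "2 * 2 ^ (?n - 1) = (2::nat) ^ ?n" using n(2) using power_Suc[of "2::nat" "?n - 1"] by simp
        ultimately have "2 * ?n \<le> 2 ^ ?n" by linarith
        then have "real (2 * ?n) \<le> real (2 ^ ?n)" by (simp only: of_nat_le_iff)
        then show ?thesis by simp
      qed
      also have "\<dots> \<le> mu * 2 ^ ?n * sqrt (real ?n)"
        using n(2) by (intro mult_mono) (auto simp: mu_def)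
      also have "\<dots> \<le> real (?b (derived_2_series G G1 (Suc i)))" using st by blast
      finally have "?n \<le> ?b (derived_2_series G G1 (Suc i))" by (simp only: of_nat_le_iff)
      then show ?case using st Suc by (meson order_trans)
    qed
    have "lam * 2 ^ ?b (derived_2_series G G1 i) * sqrt (real (?b (derived_2_series G G1 i)))
      \<le> mu * 2 ^ ?b (derived_2_series G G1 i) * sqrt (real (?b (derived_2_series G G1 i)))"
      by (intro mult_right_mono) (auto simp: mu_def)
    also have "\<dots> \<le> real (?b (derived_2_series G G1 (Suc i)))"
      using step[of G1 i] inv[of i] by simp
    finally show "lam * 2 ^ ?b (derived_2_series G G1 i) * sqrt (real (?b (derived_2_series G G1 i)))
      \<le> real (?b (derived_2_series G G1 (Suc i)))" .
  qed
qed

end
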